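(* Let $(M,g)$ be a smooth compact connected Riemannian manifold of dimension $n+1\geq 3$ with nonempty boundary $\Sigma$. For each $p\in\Sigma$ and each $\varepsilon>0$, there exists a sequence of conformal deformations $h_m^2g$ ($m\in\mathbb{N}$) such that each $h_m>0$ is a smooth function on $M$ which is identically equal to $1$ on $\Sigma$ and on the complement of the ball $B(p,\varepsilon)\subset M$, and such that $$\lim_{m\to\infty}\sigma_k(M,h_m^2g)=0\quad\text{for each integer }k\ge 1.$$
   Context: $B(p,\varepsilon)$ is the open ball of center $p$ and radius $\varepsilon$ for the distance of $(M,g)$. Steklov eigenvalues: for a smooth compact connected Riemannian manifold $(M,g)$ with nonempty boundary $\Sigma$, these are the real numbers $\sigma$ for which there is a non-zero function $f:M\to\mathbb{R}$, harmonic with respect to $g$, with $\partial_\nu f=\sigma f$ on $\Sigma$, where $\partial_\nu$ is the outward normal derivative. They form a discrete sequence, indexed from $1$ and repeated according to multiplicity, $0=\sigma_1<\sigma_2\le\sigma_3\le\cdots\nearrow\infty$, with $\sigma_k=\sigma_k(M,g)$. Equivalently, $$\sigma_k(M,g)=\min_{E}\max_{0\neq f\in E}\frac{\int_M|df|_g^2\,dv_g}{\int_\Sigma f^2\,dv_g},$$ where $E$ ranges over $k$-dimensional linear subspaces of $C^\infty(M)$, the integral over $\Sigma$ is with respect to the induced Riemannian measure, and the quotient is $+\infty$ if $f$ is nonzero and vanishes on $\Sigma$. *)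

theory Defs
  imports "HOL-Analysis.Analysis" "HOL-Library.Function_Algebras"
begin

section \<open>Smooth functions on half-space\<close>

text \<open>
  Coordinates live in \<open>real ^ 'n option\<close>, of dimension \<open>n + 1\<close> where \<open>n = CARD('n)\<close>. The component
  \<open>None\<close> is the one transverse to the boundary, and the components \<open>Some i\<close> are tangential.
\<close>

definition half_space :: "(real ^ ('n::finite) option) set" where
  "half_space = {x. 0 \<le> x $ None}"

text \<open>Only meant for open \<open>S\<close>.\<close>

primrec Ck_on :: "nat \<Rightarrow> 'a::real_normed_vector set \<Rightarrow> ('a \<Rightarrow> 'b::real_normed_vector) \<Rightarrow> bool" where
  "Ck_on 0 S f \<longleftrightarrow> continuous_on S f"
| "Ck_on (Suc k) S f \<longleftrightarrow> (\<forall>x\<in>S. f differentiable (at x)) \<and>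
     (\<forall>v. Ck_on k S (\<lambda>x. frechet_derivative f (at x) v))"

text \<open>
  For an arbitrary set \<open>S\<close> (here: relatively open in half-space), smooth means locally the
  restriction of a smooth function defined on an open set of the ambient space.
\<close>

definition smooth_in :: "'a::real_normed_vector set \<Rightarrow> ('a \<Rightarrow> 'b::real_normed_vector) \<Rightarrow> bool" where
  "smooth_in S f \<longleftrightarrow>
     (\<forall>x\<in>S. \<exists>U F. open U \<and> x \<in> U \<and> (\<forall>k. Ck_on k U F) \<and> (\<forall>y\<in>S \<inter> U. F y = f y))"

section \<open>Smooth manifolds with boundary\<close>

text \<open>
  The manifold is the whole type \<open>'a\<close>, with its topology. A chart is its domain together with its
  coordinate map, which is irrelevant outside the domain.
\<close>

type_synonym ('a, 'n) chart = "'a set \<times> ('a \<Rightarrow> real ^ 'n option)"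

abbreviation chart_dom :: "('a, 'n) chart \<Rightarrow> 'a set" where
  "chart_dom c \<equiv> fst c"

abbreviation chart_map :: "('a, 'n) chart \<Rightarrow> 'a \<Rightarrow> real ^ 'n option" where
  "chart_map c \<equiv> snd c"

definition chart_img :: "('a, 'n::finite) chart \<Rightarrow> (real ^ 'n option) set" where
  "chart_img c = chart_map c ` chart_dom c"

definition chart_inv :: "('a, 'n::finite) chart \<Rightarrow> real ^ 'n option \<Rightarrow> 'a" where
  "chart_inv c = inv_into (chart_dom c) (chart_map c)"

definition is_chart :: "('a::topological_space, 'n::finite) chart \<Rightarrow> bool" where
  "is_chart c \<longleftrightarrow> open (chart_dom c) \<and> openin (top_of_set half_space) (chart_img c) \<and>
     homeomorphism (chart_dom c) (chart_img c) (chart_map c) (chart_inv c)"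

definition smooth_atlas ::
  "('a::{t2_space, second_countable_topology}, 'n::finite) chart set \<Rightarrow> bool" where
  "smooth_atlas A \<longleftrightarrow>
     (\<forall>c\<in>A. is_chart c) \<and> (\<Union>c\<in>A. chart_dom c) = UNIV \<and>
     (\<forall>c\<in>A. \<forall>d\<in>A. smooth_in (chart_map c ` (chart_dom c \<inter> chart_dom d)) (chart_map d \<circ> chart_inv c))"

definition mfd_boundary :: "('a, 'n::finite) chart set \<Rightarrow> 'a set" where
  "mfd_boundary A = {p. \<exists>c\<in>A. p \<in> chart_dom c \<and> chart_map c p $ None = 0}"

definition smooth_functions :: "('a, 'n::finite) chart set \<Rightarrow> ('a \<Rightarrow> real) set" where
  "smooth_functions A = {f. \<forall>c\<in>A. smooth_in (chart_img c) (f \<circ> chart_inv c)}"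

text \<open>
  Pointwise quantities that do not depend on the chart are computed in some chart of the atlas.
\<close>

definition chart_at :: "('a, 'n) chart set \<Rightarrow> 'a \<Rightarrow> ('a, 'n) chart" where
  "chart_at A p = (SOME c. c \<in> A \<and> p \<in> chart_dom c)"

section \<open>Riemannian metrics\<close>

text \<open>
  A metric is given by its components: \<open>g c p\<close> is the matrix of the inner product on the tangent
  space at \<open>p\<close> in the coordinate basis of the chart \<open>c\<close>. Derivatives are taken within half-space so
  that they make sense at boundary points too; there, they are still uniquely determined.
\<close>

type_synonym ('a, 'n) metric = "('a, 'n) chart \<Rightarrow> 'a \<Rightarrow> real ^ 'n option ^ 'n option"

definition transition_jacobian ::
  "('a, 'n::finite) chart \<Rightarrow> ('a, 'n) chart \<Rightarrow> 'a \<Rightarrow> real ^ 'n option ^ 'n option" where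
  "transition_jacobian c d p =
     matrix (frechet_derivative (chart_map d \<circ> chart_inv c) (at (chart_map c p) within half_space))"

definition riemannian_metric :: "('a, 'n::finite) chart set \<Rightarrow> ('a, 'n) metric \<Rightarrow> bool" where
  "riemannian_metric A g \<longleftrightarrow>
     (\<forall>c\<in>A. smooth_in (chart_img c) (g c \<circ> chart_inv c)) \<and>
     (\<forall>c\<in>A. \<forall>p\<in>chart_dom c.
        transpose (g c p) = g c p \<and> (\<forall>v. v \<noteq> 0 \<longrightarrow> 0 < v \<bullet> (g c p *v v))) \<and>
     (\<forall>c\<in>A. \<forall>d\<in>A. \<forall>p\<in>chart_dom c \<inter> chart_dom d.
        g c p = transpose (transition_jacobian c d p) ** g d p ** transition_jacobian c d p)"

text \<open>The metric \<open>h\<^sup>2 g\<close>.\<close>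

definition conformal :: "('a \<Rightarrow> real) \<Rightarrow> ('a, 'n::finite) metric \<Rightarrow> ('a, 'n) metric" where
  "conformal h g = (\<lambda>c p. (h p)\<^sup>2 *\<^sub>R g c p)"

section \<open>Riemannian distance\<close>

definition C1_curve_on ::
  "('a::topological_space, 'n::finite) chart set \<Rightarrow> real \<Rightarrow> real \<Rightarrow> (real \<Rightarrow> 'a) \<Rightarrow> bool" where
  "C1_curve_on A a b \<gamma> \<longleftrightarrow> continuous_on {a..b} \<gamma> \<and>
     (\<forall>c\<in>A. \<exists>v. continuous_on {t \<in> {a..b}. \<gamma> t \<in> chart_dom c} v \<and>
        (\<forall>t\<in>{a..b}. \<gamma> t \<in> chart_dom c \<longrightarrow>
           ((\<lambda>s. chart_map c (\<gamma> s)) has_vector_derivative v t) (at t within {a..b})))"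

text \<open>\<open>S\<close> contains the break points of the curve.\<close>

definition piecewise_C1_curve ::
  "('a::topological_space, 'n::finite) chart set \<Rightarrow> (real \<Rightarrow> 'a) \<Rightarrow> bool" where
  "piecewise_C1_curve A \<gamma> \<longleftrightarrow> continuous_on {0..1} \<gamma> \<and>
     (\<exists>S. finite S \<and>
        (\<forall>a b. 0 \<le> a \<and> a < b \<and> b \<le> 1 \<and> S \<inter> {a<..<b} = {} \<longrightarrow> C1_curve_on A a b \<gamma>))"

definition speed ::
  "('a, 'n::finite) chart set \<Rightarrow> ('a, 'n) metric \<Rightarrow> (real \<Rightarrow> 'a) \<Rightarrow> real \<Rightarrow> real" where
  "speed A g \<gamma> t =
     (let c = chart_at A (\<gamma> t);
          v = vector_derivative (\<lambda>s. chart_map c (\<gamma> s)) (at t within {0..1})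
      in sqrt (v \<bullet> (g c (\<gamma> t) *v v)))"

definition curve_length ::
  "('a, 'n::finite) chart set \<Rightarrow> ('a, 'n) metric \<Rightarrow> (real \<Rightarrow> 'a) \<Rightarrow> real" where
  "curve_length A g \<gamma> = integral {0..1} (speed A g \<gamma>)"

definition riem_dist ::
  "('a::topological_space, 'n::finite) chart set \<Rightarrow> ('a, 'n) metric \<Rightarrow> 'a \<Rightarrow> 'a \<Rightarrow> real" where
  "riem_dist A g p q =
     Inf {curve_length A g \<gamma> | \<gamma>. piecewise_C1_curve A \<gamma> \<and> \<gamma> 0 = p \<and> \<gamma> 1 = q}"

definition riem_ball ::
  "('a::topological_space, 'n::finite) chart set \<Rightarrow> ('a, 'n) metric \<Rightarrow> 'a \<Rightarrow> real \<Rightarrow> 'a set" where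
  "riem_ball A g p r = {q. riem_dist A g p q < r}"

section \<open>Riemannian measures\<close>

text \<open>The unique Borel measure with density \<open>sqrt (det g)\<close> in every chart.\<close>

definition riem_measure ::
  "('a::topological_space, 'n::finite) chart set \<Rightarrow> ('a, 'n) metric \<Rightarrow> 'a measure" where
  "riem_measure A g = (THE \<mu>. sets \<mu> = sets borel \<and>
     (\<forall>c\<in>A. \<forall>B\<in>sets borel. B \<subseteq> chart_dom c \<longrightarrow>
        emeasure \<mu> B =
          (\<integral>\<^sup>+x. ennreal (sqrt (det (g c (chart_inv c x)))) * indicator (chart_map c ` B) x \<partial>lborel)))"

definition boundary_point :: "real ^ 'n::finite \<Rightarrow> real ^ 'n option" where
  "boundary_point y = (\<chi> i. case i of None \<Rightarrow> 0 | Some j \<Rightarrow> y $ j)"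

definition boundary_metric ::
  "('a, 'n::finite) metric \<Rightarrow> ('a, 'n) chart \<Rightarrow> 'a \<Rightarrow> real ^ 'n ^ 'n" where
  "boundary_metric g c q = (\<chi> i j. g c q $ Some i $ Some j)"

text \<open>
  The same for the boundary with the induced metric, whose charts are the restrictions of the
  charts of the manifold, with the tangential components as coordinates.
\<close>

definition boundary_measure ::
  "('a::topological_space, 'n::finite) chart set \<Rightarrow> ('a, 'n) metric \<Rightarrow> 'a measure" where
  "boundary_measure A g = (THE \<mu>. sets \<mu> = sets (restrict_space borel (mfd_boundary A)) \<and>
     (\<forall>c\<in>A. \<forall>B\<in>sets (restrict_space borel (mfd_boundary A)). B \<subseteq> chart_dom c \<longrightarrow>
        emeasure \<mu> B =
          (\<integral>\<^sup>+y. ennreal (sqrt (det (boundary_metric g c (chart_inv c (boundary_point y)))))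
             * indicator (chart_map c ` B) (boundary_point y) \<partial>lborel)))"

section \<open>Steklov eigenvalues\<close>

definition chart_gradient ::
  "('a, 'n::finite) chart \<Rightarrow> ('a \<Rightarrow> real) \<Rightarrow> 'a \<Rightarrow> real ^ 'n option" where
  "chart_gradient c f p =
     (\<chi> i. frechet_derivative (f \<circ> chart_inv c) (at (chart_map c p) within half_space) (axis i 1))"

text \<open>The squared norm of the covector \<open>df\<close>, hence the inverse matrix.\<close>

definition differential_norm2 ::
  "('a, 'n::finite) chart set \<Rightarrow> ('a, 'n) metric \<Rightarrow> ('a \<Rightarrow> real) \<Rightarrow> 'a \<Rightarrow> real" where
  "differential_norm2 A g f p =
     (let c = chart_at A p; d = chart_gradient c f p in d \<bullet> (matrix_inv (g c p) *v d))"

definition steklov_quotient ::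
  "('a::topological_space, 'n::finite) chart set \<Rightarrow> ('a, 'n) metric \<Rightarrow> ('a \<Rightarrow> real) \<Rightarrow> ereal" where
  "steklov_quotient A g f =
     (if \<forall>q\<in>mfd_boundary A. f q = 0 then \<infinity>
      else ereal ((\<integral>q. differential_norm2 A g f q \<partial>riem_measure A g) /
                  (\<integral>q. (f q)\<^sup>2 \<partial>boundary_measure A g)))"

definition fun_scale :: "real \<Rightarrow> ('a \<Rightarrow> real) \<Rightarrow> 'a \<Rightarrow> real" where
  "fun_scale r f = (\<lambda>x. r * f x)"

lemma vector_space_fun_scale: "vector_space (fun_scale :: real \<Rightarrow> ('a \<Rightarrow> real) \<Rightarrow> 'a \<Rightarrow> real)"
  by unfold_locales (simp_all add: fun_scale_def fun_eq_iff algebra_simps)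

text \<open>
  The \<open>k\<close>-th Steklov eigenvalue, indexed from \<open>1\<close> and repeated according to multiplicity, by its
  min-max formula. For \<open>k \<ge> 1\<close>, the condition on \<open>vector_space.dim\<close> forces \<open>E\<close> to be
  finite-dimensional, since that constant is \<open>0\<close> on infinite-dimensional spaces.
\<close>

definition steklov_eigenvalue ::
  "('a::topological_space, 'n::finite) chart set \<Rightarrow> ('a, 'n) metric \<Rightarrow> nat \<Rightarrow> ereal" where
  "steklov_eigenvalue A g k =
     (INF E \<in> {E. module.subspace fun_scale E \<and> vector_space.dim fun_scale E = k \<and>
                  E \<subseteq> smooth_functions A}.
        SUP f \<in> E - {0}. steklov_quotient A g f)"

end

theory Submission
  imports Defs
begin

text \<open>
  Under the conformal factor \<open>h\<^sup>2\<close>, the Dirichlet energy density in dimension \<open>n + 1\<close> is multiplied by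
  \<open>h\<^sup>n\<^sup>-\<^sup>1\<close>, while the boundary measure does not change if \<open>h = 1\<close> on the boundary. In a chart around
  \<open>p\<close> with transverse coordinate \<open>t\<close> take \<open>h = 1 / (1 + m b t\<^sup>2)\<close>, where \<open>b\<close> is a bump function. Since
  \<open>n \<ge> 2\<close> and \<open>h \<le> 1\<close>, the factor \<open>h\<^sup>n\<^sup>-\<^sup>1\<close> tends to \<open>0\<close> almost everywhere on the support of \<open>b\<close> and
  is at most \<open>1\<close>, so by dominated convergence the energy of any fixed function with support there
  tends to \<open>0\<close>. Taking the span of \<open>k\<close> bump functions with disjoint supports centred on the boundary
  as the test space of the min-max formula bounds the \<open>k\<close>-th eigenvalue by a multiple of that energy.
\<close>

text \<open>The exponent arises because \<open>|df|\<^sup>2\<close> scales by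
  \<open>h\<^sup>-\<^sup>2\<close> and the volume by \<open>h\<^sup>n\<^sup>+\<^sup>1\<close>; as h
  \<le> 1 and n \<ge> 2, the product is at most h itself, and this bound suffices. Neither the test
  functions nor their boundary norms depend on m, so everything reduces to the integral of h over
  one coordinate ball. That integral does not involve k, which enters only through a multiplicative
  constant; hence a single sequence serves all eigenvalues at once. The bump b lives on a larger
  ball than the test functions, because it has to be positive wherever they are supported. Most of
  the labour lies in the measures. Volume and boundary measure are definite descriptions, so nothing
  can be integrated before a measure with the prescribed chart densities is shown to exist and to be
  unique. Compactness supplies a finite cover by charts from which it is assembled, and the change
  of variables formula makes the pieces agree on overlaps.\<close>

section \<open>Change of variables over arbitrary finite index types\<close>

text \<open>
  The change of variables formula of HOL-Analysis requires a well-ordered index type, so every finite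
  type is given a copy with an arbitrary well-order.
\<close>

datatype 'n ocopy = OCopy (of_ocopy: 'n)

lemma range_OCopy: "range OCopy = UNIV"
  by (metis ocopy.exhaust surjI)

lemma bij_of_ocopy: "bij of_ocopy"
  by (metis bijI' ocopy.exhaust_sel ocopy.sel)

lemma all_ocopy: "(\<forall>i. P i) \<longleftrightarrow> (\<forall>j. P (OCopy j))"
  by (metis ocopy.exhaust)

instance ocopy :: (finite) finite
  by standard (metis range_OCopy finite finite_imageI)

instantiation ocopy :: (finite) wellorder
begin

definition ocopy_rank :: "'a ocopy \<Rightarrow> nat" where
  "ocopy_rank = (SOME f. inj f)"

definition "x \<le> y \<longleftrightarrow> ocopy_rank x \<le> ocopy_rank y"
definition "x < y \<longleftrightarrow> ocopy_rank x < ocopy_rank y"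

lemma inj_ocopy_rank: "inj (ocopy_rank :: 'a::finite ocopy \<Rightarrow> nat)"
proof -
  have "\<exists>f :: 'a ocopy \<Rightarrow> nat. inj f"
    using finite_imp_inj_to_nat_seg[OF finite[of "UNIV :: 'a ocopy set"]] by blast
  then show ?thesis
    unfolding ocopy_rank_def by (rule someI_ex)
qed

instance
proof
  fix P :: "'a ocopy \<Rightarrow> bool" and a
  assume "\<And>x. (\<And>y. y < x \<Longrightarrow> P y) \<Longrightarrow> P x"
  then show "P a"
    unfolding less_ocopy_def by (rule measure_induct_rule[of ocopy_rank])
qed (auto simp: less_eq_ocopy_def less_ocopy_def intro: injD[OF inj_ocopy_rank])

end

text \<open>Conjugation by \<open>f\<close> is a sign-preserving bijection between the permutations
  of the two index types, and it matches the two Leibniz sums term by term.\<close>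

lemma det_reindex:
  fixes M :: "'a::comm_ring_1^'n^'n" and f :: "'m::finite \<Rightarrow> 'n"
  assumes f: "bij f"
  shows "det (\<chi> i j. M $ f i $ f j) = det M"
proof -
  have inj: "inj f" "inj (inv f)" and surj: "surj f" "surj (inv f)"
    using f bij_imp_bij_inv[OF f] by (auto simp: bij_def)
  have mp: "map_permutation UNIV f p = f \<circ> p \<circ> inv f" for p :: "'m \<Rightarrow> 'm"
    using surj by (simp add: map_permutation_def restrict_id_def fun_eq_iff)
  have perm: "f \<circ> p \<circ> inv f permutes UNIV" if "p permutes UNIV" for p
    using map_permutation_permutes[of f UNIV UNIV p] f that by (simp add: mp)
  have perm': "inv f \<circ> q \<circ> f permutes UNIV" if "q permutes UNIV" for q
    using that f by (metis bij_comp bij_imp_bij_inv bij_imp_permutes permutes_bij UNIV_I)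
  show ?thesis
    unfolding det_def
  proof (rule sum.reindex_bij_witness[where i = "\<lambda>q. inv f \<circ> q \<circ> f" and j = "\<lambda>p. f \<circ> p \<circ> inv f"])
    fix p :: "'m \<Rightarrow> 'm" assume "p \<in> {p. p permutes UNIV}"
    then have p: "p permutes UNIV" by simp
    have "sign (f \<circ> p \<circ> inv f) = sign p"
      using sign_map_permutation[OF inj(1) p] by (simp add: mp)
    moreover have "(\<Prod>i\<in>UNIV. M $ i $ (f \<circ> p \<circ> inv f) i) = (\<Prod>i\<in>UNIV. M $ f i $ (f \<circ> p \<circ> inv f) (f i))"
      by (rule prod.reindex_bij_betw[symmetric]) (use f in simp)
    ultimately show "of_int (sign (f \<circ> p \<circ> inv f)) * (\<Prod>i\<in>UNIV. M $ i $ (f \<circ> p \<circ> inv f) i) =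
      of_int (sign p) * (\<Prod>i\<in>UNIV. (\<chi> i j. M $ f i $ f j) $ i $ p i)"
      using inj by simp
  qed (use inj surj perm perm' in \<open>auto simp: fun_eq_iff surj_f_inv_f\<close>)
qed

definition to_ocopy :: "real^'n \<Rightarrow> real^'n ocopy" where
  "to_ocopy x = (\<chi> i. x $ of_ocopy i)"

definition from_ocopy :: "real^'n ocopy \<Rightarrow> real^'n" where
  "from_ocopy y = (\<chi> i. y $ OCopy i)"

lemma from_to_ocopy [simp]: "from_ocopy (to_ocopy x) = x"
  by (simp add: from_ocopy_def to_ocopy_def vec_eq_iff)

lemma to_from_ocopy [simp]: "to_ocopy (from_ocopy x) = x"
  by (simp add: from_ocopy_def to_ocopy_def vec_eq_iff)

lemma bounded_linear_to_ocopy: "bounded_linear (to_ocopy :: real^'n::finite \<Rightarrow> _)"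
  by (intro linear_conv_bounded_linear[THEN iffD1] linearI) (simp_all add: to_ocopy_def vec_eq_iff)

lemma bounded_linear_from_ocopy: "bounded_linear (from_ocopy :: _ \<Rightarrow> real^'n::finite)"
  by (intro linear_conv_bounded_linear[THEN iffD1] linearI) (simp_all add: from_ocopy_def vec_eq_iff)

lemma borel_measurable_from_ocopy [measurable]: "from_ocopy \<in> borel_measurable (borel :: (real^'n::finite ocopy) measure)"
  by (intro borel_measurable_continuous_onI linear_continuous_on bounded_linear_from_ocopy)

lemma emeasure_lborel_box_cart:
  fixes l u :: "real^'n"
  assumes "\<And>i. l $ i \<le> u $ i"
  shows "emeasure lborel (box l u) = (\<Prod>i\<in>UNIV. u $ i - l $ i)"
proof -
  have "(\<Prod>b\<in>Basis. (u - l) \<bullet> b) = (\<Prod>i\<in>UNIV. u $ i - l $ i)"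
    by (simp add: Basis_vec_def UNION_singleton_eq_range prod.reindex inj_on_def axis_eq_axis inner_axis)
  then show ?thesis
    using assms by (subst emeasure_lborel_box) (auto simp: Basis_vec_def inner_axis)
qed

text \<open>Lebesgue measure is determined by the volumes of boxes, and relabelling coordinates only
  permutes the factors of such a volume.\<close>

lemma lborel_distr_from_ocopy: "distr lborel borel from_ocopy = (lborel :: (real^'n::finite) measure)"
proof (rule lborel_eqI[symmetric])
  fix l u :: "real^'n"
  assume le: "\<And>b. b \<in> Basis \<Longrightarrow> l \<bullet> b \<le> u \<bullet> b"
  have le': "l $ i \<le> u $ i" for i
    using le[of "axis i 1"] by (simp add: inner_axis axis_in_Basis_iff)
  have "from_ocopy -` box l u = box (to_ocopy l) (to_ocopy u)"
    by (auto simp: mem_box_cart from_ocopy_def to_ocopy_def all_ocopy)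
  then have "emeasure (distr lborel borel from_ocopy) (box l u) = emeasure lborel (box (to_ocopy l) (to_ocopy u))"
    by (simp add: emeasure_distr)
  also have "\<dots> = (\<Prod>i\<in>UNIV. u $ of_ocopy i - l $ of_ocopy i)"
    using le' by (subst emeasure_lborel_box_cart) (auto simp: to_ocopy_def)
  also have "\<dots> = (\<Prod>i\<in>UNIV. u $ i - l $ i)"
    by (rule arg_cong[where f = ennreal], rule prod.reindex_bij_betw) (rule bij_of_ocopy)
  also have "\<dots> = emeasure lborel (box l u)"
    using le' by (simp add: emeasure_lborel_box_cart)
  also have "\<dots> = (\<Prod>b\<in>Basis. (u - l) \<bullet> b)"
    using le by (rule emeasure_lborel_box)
  finally show "emeasure (distr lborel borel from_ocopy) (box l u) = (\<Prod>b\<in>Basis. (u - l) \<bullet> b)" .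
qed simp

lemma det_matrix_ocopy:
  fixes L :: "real^'n::finite \<Rightarrow> real^'n"
  shows "det (matrix (to_ocopy \<circ> L \<circ> from_ocopy)) = det (matrix L)"
proof -
  have eq: "from_ocopy (axis i (1::real)) = axis (of_ocopy i) 1" for i :: "'n ocopy"
    by (auto simp: from_ocopy_def axis_def vec_eq_iff)
  have "matrix (to_ocopy \<circ> L \<circ> from_ocopy) = (\<chi> i j. matrix L $ of_ocopy i $ of_ocopy j)"
    by (subst vec_eq_iff) (simp add: matrix_def to_ocopy_def eq)
  then show ?thesis
    by (simp add: det_reindex[OF bij_of_ocopy])
qed

text \<open>The classical formula says that one side is absolutely integrable with integral
  \<open>b\<close> iff the other is. For nonnegative functions failure of integrability means an
  infinite integral, so the equality persists in the extended reals with no finiteness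
  assumption.\<close>

lemma nn_integral_change_of_variables_wellorder:
  fixes T :: "real^'m::{finite,wellorder} \<Rightarrow> real^'m::_" and v w :: "real^'m::_ \<Rightarrow> real"
  assumes S: "S \<in> sets borel" "T ` S \<in> sets borel"
    and der: "\<And>x. x \<in> S \<Longrightarrow> (T has_derivative T' x) (at x within S)"
    and inj: "inj_on T S"
    and w0: "\<And>y. y \<in> T ` S \<Longrightarrow> 0 \<le> w y"
    and v: "\<And>x. x \<in> S \<Longrightarrow> v x = \<bar>det (matrix (T' x))\<bar> * w (T x)"
    and mv: "(\<lambda>x. v x * indicator S x) \<in> borel_measurable borel"
    and mw: "(\<lambda>y. w y * indicator (T ` S) y) \<in> borel_measurable borel"
  shows "(\<integral>\<^sup>+y. ennreal (w y) * indicator (T ` S) y \<partial>lborel) = (\<integral>\<^sup>+x. ennreal (v x) * indicator S x \<partial>lborel)"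
proof -
  have v0: "0 \<le> v x" if "x \<in> S" for x
    using v[OF that] w0 that by simp
  \<comment> \<open>The formula is available for vector-valued functions, so real values are
    embedded into \<open>real^1\<close>.\<close>
  have cv: "v absolutely_integrable_on S \<and> integral S v = b \<longleftrightarrow>
    w absolutely_integrable_on (T ` S) \<and> integral (T ` S) w = b" for b
  proof -
    have "(\<lambda>x. \<bar>det (matrix (T' x))\<bar> *\<^sub>R w (T x)) absolutely_integrable_on S \<longleftrightarrow> v absolutely_integrable_on S"
      by (intro set_integrable_cong) (auto simp: v)
    moreover have "integral S (\<lambda>x. \<bar>det (matrix (T' x))\<bar> *\<^sub>R w (T x)) = integral S v"
      by (intro Henstock_Kurzweil_Integration.integral_cong) (auto simp: v)
    ultimately show ?thesis
      using has_absolute_integral_change_of_variables[where f = "\<lambda>x. vec (w x) :: real^1" and g = T and S = S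
          and g' = T' and b = "vec b"] S der inj
      by (simp add: absolutely_integrable_on_1_iff integral_on_1_eq vec_eq_iff)
  qed
  \<comment> \<open>This fact and its converse \<open>**\<close> translate between a finite extended
    integral and absolute integrability, for measurable nonnegative functions.\<close>
  have *: "(\<integral>\<^sup>+x. ennreal (f x) * indicator B x \<partial>lborel) = ennreal (integral B f)" 
      "f absolutely_integrable_on B"
    if fin: "(\<integral>\<^sup>+x. ennreal (f x) * indicator B x \<partial>lborel) < \<infinity>" and B: "B \<in> sets borel"
      and m: "(\<lambda>x. f x * indicator B x) \<in> borel_measurable borel" and pos: "\<And>x. x \<in> B \<Longrightarrow> 0 \<le> f x"
    for f :: "real^'m::_ \<Rightarrow> real" and B
  proof -
    have eq: "ennreal (f x) * indicator B x = ennreal (f x * indicator B x)" for x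
      by (simp add: indicator_def)
    have int: "integrable lborel (\<lambda>x. f x * indicator B x)"
    proof -
      have "(\<integral>\<^sup>+x. ennreal (norm (f x * indicator B x)) \<partial>lborel) = (\<integral>\<^sup>+x. ennreal (f x) * indicator B x \<partial>lborel)"
        by (intro nn_integral_cong) (auto simp: indicator_def pos)
      then show ?thesis
        using fin m by (simp add: integrable_iff_bounded)
    qed
    then have "set_integrable lborel B f"
      by (simp add: set_integrable_def mult.commute)
    then show "f absolutely_integrable_on B"
      using B by (auto simp: set_integrable_def integrable_completion)
    have "(\<integral>\<^sup>+x. ennreal (f x) * indicator B x \<partial>lborel) = ennreal (\<integral>x. f x * indicator B x \<partial>lborel)"
      unfolding eq by (rule nn_integral_eq_integral[OF int]) (auto simp: indicator_def pos)
    also have "(\<integral>x. f x * indicator B x \<partial>lborel) = integral B f"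
      using set_borel_integral_eq_integral(2)[OF \<open>set_integrable lborel B f\<close>]
      by (simp add: set_lebesgue_integral_def mult.commute)
    finally show "(\<integral>\<^sup>+x. ennreal (f x) * indicator B x \<partial>lborel) = ennreal (integral B f)" .
  qed
  have **: "(\<integral>\<^sup>+x. ennreal (f x) * indicator B x \<partial>lborel) < \<infinity>" 
    if ai: "f absolutely_integrable_on B" and B: "B \<in> sets borel"
      and m: "(\<lambda>x. f x * indicator B x) \<in> borel_measurable borel" and pos: "\<And>x. x \<in> B \<Longrightarrow> 0 \<le> f x"
    for f :: "real^'m::_ \<Rightarrow> real" and B
  proof -
    have "integrable lebesgue (\<lambda>x. f x * indicator B x)"
      using ai by (simp add: set_integrable_def mult.commute)
    then have "integrable lborel (\<lambda>x. f x * indicator B x)"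
      using m by (simp add: integrable_completion)
    then have "(\<integral>\<^sup>+x. ennreal (norm (f x * indicator B x)) \<partial>lborel) < \<infinity>"
      by (simp add: integrable_iff_bounded)
    also have "(\<integral>\<^sup>+x. ennreal (norm (f x * indicator B x)) \<partial>lborel) = (\<integral>\<^sup>+x. ennreal (f x) * indicator B x \<partial>lborel)"
      by (intro nn_integral_cong) (auto simp: indicator_def pos)
    finally show ?thesis .
  qed
  show ?thesis
  proof (cases "v absolutely_integrable_on S")
    case True
    then have w: "w absolutely_integrable_on (T ` S)" "integral (T ` S) w = integral S v"
      using cv by blast+
    show ?thesis
      using *(1)[OF **[OF True S(1) mv v0] S(1) mv v0] *(1)[OF **[OF w(1) S(2) mw w0] S(2) mw w0] w(2)
      by simp
  next
    case False
    then have w: "\<not> w absolutely_integrable_on (T ` S)"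
      using cv by blast
    have "\<not> (\<integral>\<^sup>+x. ennreal (v x) * indicator S x \<partial>lborel) < \<infinity>"
      using *(2)[OF _ S(1) mv v0] False by blast
    moreover have "\<not> (\<integral>\<^sup>+y. ennreal (w y) * indicator (T ` S) y \<partial>lborel) < \<infinity>"
      using *(2)[OF _ S(2) mw w0] w by blast
    ultimately show ?thesis
      by (simp add: less_top[symmetric])
  qed
qed

text \<open>Both integrals are moved to the well-ordered copy of the index type, a relabelling that
  preserves Lebesgue measure as well as the Jacobian determinant.\<close>

lemma nn_integral_change_of_variables:
  fixes T :: "real^'m::finite \<Rightarrow> real^'m::_" and v w :: "real^'m::_ \<Rightarrow> real"
  assumes S: "S \<in> sets borel" "T ` S \<in> sets borel"
    and der: "\<And>x. x \<in> S \<Longrightarrow> (T has_derivative T' x) (at x within S)"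
    and inj: "inj_on T S"
    and w0: "\<And>y. y \<in> T ` S \<Longrightarrow> 0 \<le> w y"
    and v: "\<And>x. x \<in> S \<Longrightarrow> v x = \<bar>det (matrix (T' x))\<bar> * w (T x)"
    and mv: "(\<lambda>x. v x * indicator S x) \<in> borel_measurable borel"
    and mw: "(\<lambda>y. w y * indicator (T ` S) y) \<in> borel_measurable borel"
  shows "(\<integral>\<^sup>+y. ennreal (w y) * indicator (T ` S) y \<partial>lborel) = (\<integral>\<^sup>+x. ennreal (v x) * indicator S x \<partial>lborel)"
proof -
  let ?T = "to_ocopy \<circ> T \<circ> from_ocopy" and ?S = "to_ocopy ` S"
  have im: "to_ocopy ` B = from_ocopy -` B" for B :: "(real^'m) set"
    by (auto simp: image_iff) (metis to_from_ocopy)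
  have TS: "?T ` ?S = to_ocopy ` (T ` S)"
    by (auto simp: image_iff)
  have ind: "indicator (to_ocopy ` B) x = indicator B (from_ocopy x)" for B :: "(real^'m) set" and x
    by (auto simp: im indicator_def)
  have meas: "(\<lambda>x. ennreal (u x) * indicator B x) \<in> borel_measurable borel"
    if "(\<lambda>x. u x * indicator B x) \<in> borel_measurable borel" for u :: "real^'m \<Rightarrow> real" and B
  proof -
    have "(\<lambda>x. ennreal (u x) * indicator B x) = (\<lambda>x. ennreal (u x * indicator B x))"
      by (auto simp: indicator_def)
    then show ?thesis
      using that by simp
  qed
  have push: "(\<integral>\<^sup>+x. ennreal (u x) * indicator B x \<partial>lborel) =
      (\<integral>\<^sup>+x. ennreal (u (from_ocopy x)) * indicator (to_ocopy ` B) x \<partial>lborel)"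
    if "(\<lambda>x. u x * indicator B x) \<in> borel_measurable borel" for u :: "real^'m \<Rightarrow> real" and B
    unfolding ind
    by (subst lborel_distr_from_ocopy[symmetric], subst nn_integral_distr) (use meas[OF that] in auto)
  have "(\<integral>\<^sup>+y. ennreal (w (from_ocopy y)) * indicator (?T ` ?S) y \<partial>lborel) =
      (\<integral>\<^sup>+x. ennreal (v (from_ocopy x)) * indicator ?S x \<partial>lborel)"
  proof (rule nn_integral_change_of_variables_wellorder[where T' = "\<lambda>x. to_ocopy \<circ> T' (from_ocopy x) \<circ> from_ocopy"])
    show "?S \<in> sets borel"
      unfolding im using S measurable_sets[OF borel_measurable_from_ocopy, of S] by simp
    show "?T ` ?S \<in> sets borel"
      using S measurable_sets[OF borel_measurable_from_ocopy, of "T ` S"] by (subst TS, subst im) simp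
    show "(?T has_derivative to_ocopy \<circ> T' (from_ocopy x) \<circ> from_ocopy) (at x within ?S)" if x: "x \<in> ?S" for x
    proof -
      have "from_ocopy ` ?S = S" by (auto simp: image_iff)
      moreover have "(T has_derivative T' (from_ocopy x)) (at (from_ocopy x) within S)"
        using der x by auto
      ultimately have "(T \<circ> from_ocopy has_derivative T' (from_ocopy x) \<circ> from_ocopy) (at x within ?S)"
        by (intro diff_chain_within bounded_linear_imp_has_derivative bounded_linear_from_ocopy) auto
      then show ?thesis
        using diff_chain_within[OF _ bounded_linear_imp_has_derivative[OF bounded_linear_to_ocopy]]
        by (metis comp_assoc)
    qed
    show "inj_on ?T ?S"
      using inj by (auto simp: inj_on_def) (metis from_to_ocopy)
    show "v (from_ocopy x) = \<bar>det (matrix (to_ocopy \<circ> T' (from_ocopy x) \<circ> from_ocopy))\<bar> * w (from_ocopy (?T x))"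
      if "x \<in> ?S" for x
      using that v by (auto simp: det_matrix_ocopy)
    show "(\<lambda>x. v (from_ocopy x) * indicator ?S x) \<in> borel_measurable borel"
      unfolding ind using measurable_compose[OF borel_measurable_from_ocopy mv] by simp
    show "(\<lambda>x. w (from_ocopy x) * indicator (?T ` ?S) x) \<in> borel_measurable borel"
      unfolding ind TS using measurable_compose[OF borel_measurable_from_ocopy mw] by simp
  qed (use w0 in auto)
  then show ?thesis
    unfolding push[OF mv] push[OF mw] by (simp only: TS)
qed

section \<open>Smooth functions\<close>

lemma Ck_on_cong_imp:
  assumes "open S" "\<And>x. x \<in> S \<Longrightarrow> f x = g x" "Ck_on k S f"
  shows "Ck_on k S g"
  using assms(2,3)
proof (induction k arbitrary: f g)
  case 0
  then show ?case by (simp cong: continuous_on_cong)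
next
  case (Suc k)
  have der: "(g has_derivative frechet_derivative f (at x)) (at x)" if "x \<in> S" for x
    by (rule has_derivative_transform_within_open[where f = f, OF _ assms(1) that])
      (use Suc.prems that in \<open>auto simp: frechet_derivative_works\<close>)
  have eq: "frechet_derivative f (at x) = frechet_derivative g (at x)" if "x \<in> S" for x
    using frechet_derivative_at[OF der[OF that]] .
  have "Ck_on k S (\<lambda>x. frechet_derivative g (at x) v)" for v
    by (rule Suc.IH[where f = "\<lambda>x. frechet_derivative f (at x) v"]) (use Suc.prems eq in auto)
  then show ?case
    using der by (auto simp: differentiable_def)
qed

text \<open>On an open set derivatives are unique, so any explicit formula for the derivative may
  stand in for \<open>frechet_derivative\<close>. The closure properties below are all proved in
  this form.\<close>

lemma Ck_on_Suc_intro: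
  assumes "open S" and der: "\<And>x. x \<in> S \<Longrightarrow> (f has_derivative f' x) (at x)"
    and C: "\<And>v. Ck_on k S (\<lambda>x. f' x v)"
  shows "Ck_on (Suc k) S f"
proof -
  have eq: "f' x = frechet_derivative f (at x)" if "x \<in> S" for x
    using frechet_derivative_at[OF der[OF that]] .
  have "Ck_on k S (\<lambda>x. frechet_derivative f (at x) v)" for v
    by (rule Ck_on_cong_imp[OF assms(1) _ C[of v]]) (simp add: eq)
  then show ?thesis
    using der by (auto simp: differentiable_def)
qed

lemma Ck_on_Suc_has_derivative:
  assumes "Ck_on (Suc k) S f" "x \<in> S"
  shows "(f has_derivative frechet_derivative f (at x)) (at x)"
  using assms by (auto simp: frechet_derivative_works)

lemma Ck_on_Suc_imp: "Ck_on (Suc k) S f \<Longrightarrow> Ck_on k S f"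
proof (induction k arbitrary: f)
  case 0
  then show ?case
    by (auto intro!: differentiable_imp_continuous_on simp: differentiable_on_def differentiable_at_withinI)
next
  case (Suc k)
  then show ?case by (metis Ck_on.simps(2))
qed

lemma Ck_on_imp_continuous_on: "Ck_on k S f \<Longrightarrow> continuous_on S f"
  by (induction k) (auto dest: Ck_on_Suc_imp simp del: Ck_on.simps(2))

lemma Ck_on_subset: "Ck_on k S f \<Longrightarrow> T \<subseteq> S \<Longrightarrow> Ck_on k T f"
  by (induction k arbitrary: f) (auto intro: continuous_on_subset)

lemma Ck_on_const: "open S \<Longrightarrow> Ck_on k S (\<lambda>x. c)"
  by (induction k arbitrary: c) (auto intro!: Ck_on_Suc_intro[where f' = "\<lambda>x v. 0"] simp del: Ck_on.simps(2))

lemma Ck_on_bounded_linear: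
  assumes "open S" "bounded_linear L" "Ck_on k S f"
  shows "Ck_on k S (\<lambda>x. L (f x))"
  using assms(3)
proof (induction k arbitrary: f)
  case 0
  then show ?case
    using assms(2) by (simp add: bounded_linear.continuous_on)
next
  case (Suc k)
  show ?case
    by (rule Ck_on_Suc_intro[OF assms(1) bounded_linear.has_derivative[OF assms(2) Ck_on_Suc_has_derivative[OF Suc.prems]]])
      (use Suc in auto)
qed

lemma Ck_on_linear:
  assumes "open S" "bounded_linear L"
  shows "Ck_on k S L"
proof (cases k)
  case 0
  then show ?thesis using assms(2) by (simp add: linear_continuous_on)
next
  case (Suc k)
  have "Ck_on (Suc k) S L"
    by (rule Ck_on_Suc_intro[OF assms(1) bounded_linear_imp_has_derivative[OF assms(2)]])
      (auto intro: Ck_on_const assms)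
  then show ?thesis using Suc by simp
qed

lemma Ck_on_id: "open S \<Longrightarrow> Ck_on k S (\<lambda>x. x)"
  by (rule Ck_on_linear) (auto intro: bounded_linear_ident)

lemma Ck_on_add:
  assumes "open S" "Ck_on k S f" "Ck_on k S g"
  shows "Ck_on k S (\<lambda>x. f x + g x)"
  using assms(2,3)
proof (induction k arbitrary: f g)
  case 0
  then show ?case by (simp add: continuous_on_add)
next
  case (Suc k)
  show ?case
    by (rule Ck_on_Suc_intro[OF assms(1) has_derivative_add[OF Ck_on_Suc_has_derivative[OF Suc.prems(1)] Ck_on_Suc_has_derivative[OF Suc.prems(2)]]])
      (use Suc in auto)
qed

lemma Ck_on_sum:
  assumes "open S" "\<And>i. i \<in> I \<Longrightarrow> Ck_on k S (f i)"
  shows "Ck_on k S (\<lambda>x. \<Sum>i\<in>I. f i x)"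
  using assms(2) by (induction I rule: infinite_finite_induct) (auto intro: Ck_on_const Ck_on_add assms(1))

text \<open>The induction runs over all \<open>f\<close> and \<open>g\<close> at once, since the
  product rule pairs each function with a derivative of the other.\<close>

lemma Ck_on_bilinear:
  assumes "open S" "bounded_bilinear h" "Ck_on k S f" "Ck_on k S g"
  shows "Ck_on k S (\<lambda>x. h (f x) (g x))"
  using assms(3,4)
proof (induction k arbitrary: f g)
  case 0
  then show ?case using assms(2) by (simp add: bounded_bilinear.continuous_on)
next
  case (Suc k)
  show ?case
  proof (rule Ck_on_Suc_intro[OF assms(1) bounded_bilinear.FDERIV[OF assms(2)
          Ck_on_Suc_has_derivative[OF Suc.prems(1)] Ck_on_Suc_has_derivative[OF Suc.prems(2)]]])
    fix v
    have "Ck_on k S (\<lambda>x. h (f x) (frechet_derivative g (at x) v))"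
      using Suc by (intro Suc.IH Ck_on_Suc_imp[OF Suc.prems(1)]) auto
    moreover have "Ck_on k S (\<lambda>x. h (frechet_derivative f (at x) v) (g x))"
      using Suc by (intro Suc.IH Ck_on_Suc_imp[OF Suc.prems(2)]) auto
    ultimately show "Ck_on k S (\<lambda>x. h (f x) (frechet_derivative g (at x) v) + h (frechet_derivative f (at x) v) (g x))"
      by (rule Ck_on_add[OF assms(1)])
  qed
qed

lemmas Ck_on_mult = Ck_on_bilinear[OF _ bounded_bilinear_mult]
lemmas Ck_on_scaleR = Ck_on_bilinear[OF _ bounded_bilinear_scaleR]
lemmas Ck_on_inner = Ck_on_bilinear[OF _ bounded_bilinear_inner]

lemma Ck_on_inverse:
  fixes f :: "'a::real_normed_vector \<Rightarrow> 'b::real_normed_field"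
  assumes "open S" "Ck_on k S f" and nz: "\<And>x. x \<in> S \<Longrightarrow> f x \<noteq> 0"
  shows "Ck_on k S (\<lambda>x. inverse (f x))"
  using assms(2)
proof (induction k)
  case 0
  then show ?case using nz by (simp add: continuous_on_inverse)
next
  case (Suc k)
  show ?case
  proof (rule Ck_on_Suc_intro[OF assms(1) Deriv.has_derivative_inverse[OF nz Ck_on_Suc_has_derivative[OF Suc.prems]]])
    fix v
    have i: "Ck_on k S (\<lambda>x. inverse (f x))"
      by (rule Suc.IH[OF Ck_on_Suc_imp[OF Suc.prems]])
    have d: "Ck_on k S (\<lambda>x. frechet_derivative f (at x) v)"
      using Suc.prems by auto
    show "Ck_on k S (\<lambda>x. - (inverse (f x) * frechet_derivative f (at x) v * inverse (f x)))"
      by (intro Ck_on_bounded_linear[OF assms(1) bounded_linear_minus[OF bounded_linear_ident]] Ck_on_mult[OF assms(1)] i d)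
  qed auto
qed

text \<open>In the chain rule both the linear map and the vector it is applied to vary with
  \<open>x\<close>. Expanding the vector in the basis leaves products of a coordinate with a
  derivative of \<open>f\<close> in a fixed direction, to which the induction hypothesis
  applies.\<close>

lemma Ck_on_compose:
  fixes g :: "'a::real_normed_vector \<Rightarrow> 'b::euclidean_space" and f :: "'b \<Rightarrow> 'c::real_normed_vector"
  assumes "open S" "open T" "g ` S \<subseteq> T" "Ck_on k T f" "Ck_on k S g"
  shows "Ck_on k S (\<lambda>x. f (g x))"
  using assms(4,5)
proof (induction k arbitrary: f)
  case 0
  then show ?case using assms(3) continuous_on_compose2 by (metis Ck_on.simps(1))
next
  case (Suc k)
  let ?f = "\<lambda>x. frechet_derivative f (at x)" and ?g = "\<lambda>x. frechet_derivative g (at x)"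
  have f: "(f has_derivative ?f (g x)) (at (g x))" if "x \<in> S" for x
    using Ck_on_Suc_has_derivative[OF Suc.prems(1)] that assms(3) by blast
  have g: "(g has_derivative ?g x) (at x)" if "x \<in> S" for x
    using Ck_on_Suc_has_derivative[OF Suc.prems(2)] that by blast
  have expand: "?f (g x) w = (\<Sum>b\<in>Basis. (w \<bullet> b) *\<^sub>R ?f (g x) b)" if "x \<in> S" for x w
  proof -
    interpret bounded_linear "?f (g x)"
      using f[OF that] by (rule has_derivative_bounded_linear)
    have "?f (g x) w = ?f (g x) (\<Sum>b\<in>Basis. (w \<bullet> b) *\<^sub>R b)"
      by (simp add: euclidean_representation)
    also have "\<dots> = (\<Sum>b\<in>Basis. (w \<bullet> b) *\<^sub>R ?f (g x) b)"
      by (simp only: sum scaleR)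
    finally show ?thesis .
  qed
  show ?case
  proof (rule Ck_on_Suc_intro[OF assms(1)])
    show "((\<lambda>x. f (g x)) has_derivative (\<lambda>v. \<Sum>b\<in>Basis. (?g x v \<bullet> b) *\<^sub>R ?f (g x) b)) (at x)" if "x \<in> S" for x
      using diff_chain_at[OF g[OF that] f[OF that]] unfolding expand[OF that, symmetric] o_def .
    fix v
    show "Ck_on k S (\<lambda>x. \<Sum>b\<in>Basis. (?g x v \<bullet> b) *\<^sub>R ?f (g x) b)"
    proof (intro Ck_on_sum[OF assms(1)] Ck_on_scaleR[OF assms(1)])
      fix b :: 'b
      show "Ck_on k S (\<lambda>x. ?g x v \<bullet> b)"
        using Suc.prems(2) by (intro Ck_on_inner assms(1) Ck_on_const) auto
      show "Ck_on k S (\<lambda>x. ?f (g x) b)"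
        by (rule Suc.IH[OF _ Ck_on_Suc_imp[OF Suc.prems(2)]]) (use Suc.prems(1) in auto)
    qed
  qed
qed

text \<open>
  The functions \<open>p (1 / t) exp (- 1 / t)\<close> with \<open>p\<close> a polynomial, extended by \<open>0\<close>, are closed under
  differentiation, which makes them smooth at \<open>0\<close>.
\<close>

definition flat_poly :: "real poly \<Rightarrow> real \<Rightarrow> real" where
  "flat_poly p t = (if t \<le> 0 then 0 else poly p (1 / t) * exp (- (1 / t)))"

lemma poly_times_exp_minus_tendsto_0: "((\<lambda>s::real. poly p s * exp (- s)) \<longlongrightarrow> 0) at_top"
proof -
  have "((\<lambda>s::real. \<Sum>i\<le>degree p. coeff p i * (s ^ i / exp s)) \<longlongrightarrow> (\<Sum>i\<le>degree p. coeff p i * 0)) at_top"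
    by (intro tendsto_intros tendsto_power_div_exp_0)
  then show ?thesis
    by (simp add: poly_altdef sum_divide_distrib exp_minus divide_inverse mult.assoc sum_distrib_right)
qed

text \<open>With s = 1 / t one has ds/dt = - s^2, so differentiating p(s) exp(- s) gives s^2 (p -
  p')(s) exp(- s); the factor s^2 is \<open>[:0, 0, 1:]\<close>.\<close>

lemma has_real_derivative_flat_poly:
  "(flat_poly p has_real_derivative flat_poly ([:0, 0, 1:] * (p - pderiv p)) t) (at t)"
proof -
  consider "t < 0" | "t > 0" | "t = 0" by linarith
  then show ?thesis
  proof cases
    case 1
    have "((\<lambda>_. 0) has_real_derivative 0) (at t)" by simp
    then show ?thesis
      using 1 by (subst DERIV_cong_ev[where g = "\<lambda>_. 0"])
        (auto simp: flat_poly_def eventually_nhds intro!: exI[of _ "{..<0}"])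
  next
    case 2
    have "((\<lambda>t. poly p (1 / t) * exp (- (1 / t))) has_real_derivative flat_poly ([:0, 0, 1:] * (p - pderiv p)) t) (at t)"
    proof -
      have i: "((\<lambda>t. 1 / t) has_real_derivative - (1 / t\<^sup>2)) (at t)"
        using 2 by (auto intro!: derivative_eq_intros simp: power2_eq_square)
      show ?thesis
        by (rule DERIV_cong[OF DERIV_mult[OF DERIV_chain2[OF poly_DERIV i] DERIV_chain2[OF DERIV_exp DERIV_minus[OF i]]]])
          (use 2 in \<open>simp add: flat_poly_def field_simps power2_eq_square\<close>)
    qed
    then show ?thesis
      using 2 by (subst DERIV_cong_ev[where g = "\<lambda>t. poly p (1 / t) * exp (- (1 / t))"])
        (auto simp: flat_poly_def eventually_nhds intro!: exI[of _ "{0<..}"])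
  next
    case 3
    \<comment> \<open>With s = 1 / h the difference quotient at 0 is s p(s) exp(- s), and
      \<open>pCons 0 p\<close> is the polynomial s p(s).\<close>
    have "((\<lambda>h. flat_poly p h / h) \<longlongrightarrow> 0) (at_right 0)"
    proof (rule Lim_transform_eventually)
      show "((\<lambda>h. poly (pCons 0 p) (inverse h) * exp (- inverse h)) \<longlongrightarrow> 0) (at_right (0::real))"
        by (rule filterlim_compose[OF poly_times_exp_minus_tendsto_0 filterlim_inverse_at_top_right])
      show "\<forall>\<^sub>F h in at_right 0. poly (pCons 0 p) (inverse h) * exp (- inverse h) = flat_poly p h / h"
        by (auto simp: eventually_at_right_field flat_poly_def field_simps intro!: exI[of _ 1])
    qed
    moreover have "((\<lambda>h. flat_poly p h / h) \<longlongrightarrow> 0) (at_left 0)"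
      by (rule tendsto_eventually) (auto simp: eventually_at_left_field flat_poly_def intro!: exI[of _ "-1"])
    ultimately have "((\<lambda>h. flat_poly p h / h) \<longlongrightarrow> 0) (at 0)"
      by (simp add: filterlim_split_at)
    then show ?thesis
      using 3 by (simp add: DERIV_def flat_poly_def)
  qed
qed

lemma Ck_on_flat_poly: "Ck_on k UNIV (flat_poly p)"
proof (induction k arbitrary: p)
  case 0
  then show ?case
    using has_real_derivative_flat_poly by (auto intro!: DERIV_continuous_on continuous_at_imp_continuous_on DERIV_isCont)
next
  case (Suc k)
  show ?case
    by (rule Ck_on_Suc_intro[OF open_UNIV has_real_derivative_flat_poly[THEN has_field_derivative_imp_has_derivative]])
      (intro Ck_on_mult Ck_on_const Suc.IH open_UNIV)
qed

text \<open>\<open>flat_poly 1\<close> is exp(- 1 / t) for positive t. The squared distance, unlike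
  the distance, is smooth at the centre too.\<close>

definition bump :: "'a::euclidean_space \<Rightarrow> real \<Rightarrow> 'a \<Rightarrow> real" where
  "bump a r x = flat_poly 1 (r\<^sup>2 - (x - a) \<bullet> (x - a))"

lemma Ck_on_bump: "open S \<Longrightarrow> Ck_on k S (bump a r)"
proof -
  assume S: "open S"
  have "Ck_on k S (\<lambda>x. x - a)"
    using Ck_on_add[OF S Ck_on_id[OF S] Ck_on_const[OF S, where c = "- a"]] by simp
  then have "Ck_on k S (\<lambda>x. r\<^sup>2 + - ((x - a) \<bullet> (x - a)))"
    by (intro Ck_on_add Ck_on_const S Ck_on_inner Ck_on_bounded_linear[OF S bounded_linear_minus[OF bounded_linear_ident]])
  then have "Ck_on k S (\<lambda>x. flat_poly 1 (r\<^sup>2 + - ((x - a) \<bullet> (x - a))))"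
    by (rule Ck_on_compose[OF S open_UNIV _ Ck_on_flat_poly, rotated]) simp
  then show "Ck_on k S (bump a r)"
    by (simp add: bump_def[abs_def])
qed

lemma bump_nonneg: "0 \<le> bump a r x"
  by (simp add: bump_def flat_poly_def)

lemma bump_pos_iff: "0 < r \<Longrightarrow> 0 < bump a r x \<longleftrightarrow> x \<in> ball a r"
proof -
  assume r: "0 < r"
  have "(x - a) \<bullet> (x - a) < r\<^sup>2 \<longleftrightarrow> norm (x - a) < r"
    unfolding norm_eq_sqrt_inner using r real_sqrt_less_iff[of "(x - a) \<bullet> (x - a)" "r\<^sup>2"] by simp
  then show ?thesis
    by (auto simp: bump_def flat_poly_def dist_norm norm_minus_commute)
qed

lemma bump_eq_0_iff: "0 < r \<Longrightarrow> bump a r x = 0 \<longleftrightarrow> x \<notin> ball a r"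
  using bump_pos_iff[of r a x] bump_nonneg[of a r x] by linarith

lemma smooth_in_continuous_on: "smooth_in S f \<Longrightarrow> continuous_on S f"
  unfolding continuous_on_eq_continuous_within
proof
  fix x assume "smooth_in S f" "x \<in> S"
  then obtain U F where U: "open U" "x \<in> U" "Ck_on 0 U F" "\<forall>y\<in>S \<inter> U. F y = f y"
    unfolding smooth_in_def by blast
  then have "isCont F x"
    by (simp add: continuous_on_eq_continuous_at)
  then have "continuous (at x within S) F"
    by (rule continuous_at_imp_continuous_at_within)
  moreover obtain d where "0 < d" "ball x d \<subseteq> U"
    using U open_contains_ball by blast
  ultimately show "continuous (at x within S) f"
    using U \<open>x \<in> S\<close>
    by (intro continuous_transform_within[of x S F d f]) (auto simp: subset_iff dist_commute)
qed

section \<open>Positive definite matrices, charts and boundary\<close>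

definition posdef :: "real^'n^'n \<Rightarrow> bool" where
  "posdef G \<longleftrightarrow> (\<forall>v. v \<noteq> 0 \<longrightarrow> 0 < v \<bullet> (G *v v))"

lemma posdef_nonneg: "posdef G \<Longrightarrow> 0 \<le> v \<bullet> (G *v v)"
  by (cases "v = 0") (auto simp: posdef_def less_imp_le)

lemma posdef_det_nonzero: "posdef G \<Longrightarrow> det G \<noteq> 0"
proof
  assume G: "posdef G" and "det G = 0"
  then obtain v where "v \<noteq> 0" "G *v v = 0"
    using invertible_det_nz[of G] invertible_left_inverse[of G] matrix_left_invertible_ker[of G] by auto
  with G show False by (metis posdef_def inner_zero_right less_irrefl)
qed

text \<open>The segment from the identity to \<open>G\<close> stays positive definite, so its determinant keeps its sign.\<close>

lemma posdef_det_pos: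
  fixes G :: "real^'n^'n"
  assumes "posdef G"
  shows "0 < det G"
proof (rule ccontr)
  assume neg: "\<not> 0 < det G"
  define H where "H t = (1 - t) *\<^sub>R mat 1 + t *\<^sub>R G" for t :: real
  have "continuous_on {0..1} (\<lambda>t. det (H t))"
    unfolding det_def H_def by (auto intro!: continuous_intros)
  moreover have "det (H 0) = 1" "det (H 1) = det G"
    by (simp_all add: H_def)
  ultimately obtain t where t: "0 \<le> t" "t \<le> 1" "det (H t) = 0"
    using IVT2'[of "\<lambda>t. det (H t)" 1 0 0] neg by auto
  have "posdef (H t)"
    unfolding posdef_def
  proof (intro allI impI)
    fix v :: "real^'n" assume v: "v \<noteq> 0"
    have "v \<bullet> (H t *v v) = (1 - t) * (v \<bullet> v) + t * (v \<bullet> (G *v v))"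
      by (simp add: H_def matrix_vector_mult_add_rdistrib scaleR_matrix_vector_assoc[symmetric] inner_add_right)
    moreover have "0 < v \<bullet> v" "0 < v \<bullet> (G *v v)"
      using assms v by (auto simp: posdef_def)
    ultimately show "0 < v \<bullet> (H t *v v)"
      using t(1,2) by (cases "t = 0") (auto intro: add_nonneg_pos)
  qed
  then show False
    using posdef_det_nonzero t(3) by blast
qed

lemma posdef_inverse:
  assumes "posdef G"
  shows "G *v (matrix_inv G *v d) = d"
proof -
  have "invertible G"
    using posdef_det_nonzero[OF assms] invertible_det_nz by blast
  then have "G ** matrix_inv G = mat 1"
    unfolding invertible_def matrix_inv_def by (rule someI2_ex) blast
  then show ?thesis
    by (simp add: matrix_vector_mul_assoc)
qed

lemma posdef_inverse_unique:
  assumes "posdef G" "G *v w = d"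
  shows "matrix_inv G *v d = w"
proof -
  have "G *v (matrix_inv G *v d - w) = 0"
    using assms by (simp add: matrix_vector_mult_diff_distrib posdef_inverse)
  then show ?thesis
    using assms(1) unfolding posdef_def by (metis eq_iff_diff_eq_0 inner_zero_right less_irrefl)
qed

lemma posdef_inverse_nonneg: "posdef G \<Longrightarrow> 0 \<le> d \<bullet> (matrix_inv G *v d)"
  using posdef_nonneg[of G "matrix_inv G *v d"] by (simp add: posdef_inverse inner_commute)

text \<open>For w = \<open>matrix_inv G *v d\<close> the form equals d . w, and l |w|^2 \<le> d . w
  \<le> |d| |w| forces |w| \<le> |d| / l.\<close>

lemma posdef_inverse_upper_bound:
  assumes G: "posdef G" and lower: "\<And>v. l * (norm v)\<^sup>2 \<le> v \<bullet> (G *v v)" and l: "0 < l"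
  shows "d \<bullet> (matrix_inv G *v d) \<le> (norm d)\<^sup>2 / l"
proof -
  define w where "w = matrix_inv G *v d"
  have Gw: "G *v w = d" by (simp add: w_def posdef_inverse G)
  have dw: "d \<bullet> w \<le> norm d * norm w" by (rule norm_cauchy_schwarz)
  have lw: "l * (norm w)\<^sup>2 \<le> d \<bullet> w" using lower[of w] by (simp add: Gw inner_commute)
  have "norm w \<le> norm d / l"
  proof (cases "w = 0")
    case False
    have "norm w * (l * norm w) \<le> norm w * norm d"
      using dw lw by (simp add: power2_eq_square algebra_simps)
    then show ?thesis
      using False l by (simp add: field_simps)
  qed (use l in simp)
  then have "norm d * norm w \<le> norm d * (norm d / l)"
    by (intro mult_left_mono) auto
  then show ?thesis
    using dw by (simp add: w_def power2_eq_square)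
qed

lemma inner_transpose: "(transpose J *v d) \<bullet> w = d \<bullet> (J *v w)" for J :: "real^'n^'m"
  by (simp add: dot_lmul_matrix[symmetric] vector_transpose_matrix)

lemma inner_matrix_congruence:
  fixes J :: "real^'n^'n"
  assumes "G = transpose J ** H ** J"
  shows "v \<bullet> (G *v v) = (J *v v) \<bullet> (H *v (J *v v))"
proof -
  have "v \<bullet> (G *v v) = v \<bullet> (transpose J *v (H *v (J *v v)))"
    by (simp only: assms matrix_vector_mul_assoc matrix_mul_assoc)
  also have "\<dots> = (H *v (J *v v)) \<bullet> (J *v v)"
    by (simp only: inner_commute[of v] inner_transpose)
  finally show ?thesis
    by (simp only: inner_commute)
qed

lemma det_congruence:
  fixes J :: "real^'n^'n"
  assumes "G = transpose J ** H ** J"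
  shows "det G = (det J)\<^sup>2 * det H"
  unfolding assms by (simp add: det_mul power2_eq_square)

lemma posdef_congruence_det_nonzero:
  fixes J :: "real^'n^'n"
  assumes "G = transpose J ** H ** J" "posdef G"
  shows "det J \<noteq> 0"
  using det_congruence[OF assms(1)] posdef_det_nonzero[OF assms(2)] by auto

text \<open>For \<open>J\<close> the Jacobian of a transition map, this is the transformation rule
  of Riemannian volume densities.\<close>

lemma sqrt_det_congruence:
  fixes J :: "real^'n^'n"
  assumes "G = transpose J ** H ** J"
  shows "sqrt (det G) = \<bar>det J\<bar> * sqrt (det H)"
  by (simp add: det_congruence[OF assms] real_sqrt_mult)

text \<open>This makes the squared norm of a covector chart independent. If G w is the pulled-back
  covector, then injectivity of the transpose of \<open>J\<close> gives H (J w) = d, so the two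
  pairings agree.\<close>

lemma inner_inverse_congruence:
  fixes J :: "real^'n^'n"
  assumes eq: "G = transpose J ** H ** J" and pos: "posdef G" "posdef H"
  shows "(transpose J *v d) \<bullet> (matrix_inv G *v (transpose J *v d)) = d \<bullet> (matrix_inv H *v d)"
proof -
  define w where "w = matrix_inv G *v (transpose J *v d)"
  have "transpose J *v (H *v (J *v w)) = G *v w"
    by (simp add: eq matrix_vector_mul_assoc matrix_mul_assoc)
  also have "\<dots> = transpose J *v d"
    by (simp add: w_def posdef_inverse pos)
  finally have "transpose J *v (H *v (J *v w) - d) = 0"
    by (simp add: matrix_vector_mult_diff_distrib)
  moreover have "det (transpose J) \<noteq> 0"
    using posdef_congruence_det_nonzero[OF eq pos(1)] by simp
  ultimately have "H *v (J *v w) = d"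
    using invertible_det_nz[of "transpose J"] invertible_left_inverse[of "transpose J"]
      matrix_left_invertible_ker[of "transpose J"] by auto
  then have "matrix_inv H *v d = J *v w"
    by (rule posdef_inverse_unique[OF pos(2)])
  moreover have "(transpose J *v d) \<bullet> w = d \<bullet> (J *v w)"
    by (rule inner_transpose)
  ultimately show ?thesis
    by (simp add: w_def)
qed

lemma continuous_on_quadratic_form:
  fixes G :: "'a::metric_space \<Rightarrow> real^'n^'n"
  assumes "continuous_on K G"
  shows "continuous_on (K \<times> T) (\<lambda>(x, v). v \<bullet> (G x *v v))"
proof -
  have "continuous_on (K \<times> T) (\<lambda>z. G (fst z))"
    by (rule continuous_on_compose2[OF assms continuous_on_fst[OF continuous_on_id]]) auto
  then show ?thesis
    unfolding case_prod_beta inner_vec_def matrix_vector_mult_def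
    by (auto intro!: continuous_intros)
qed

text \<open>The quadratic form attains a positive minimum and a maximum on the compact product of
  \<open>K\<close> with the unit sphere; homogeneity extends the bounds to all vectors.\<close>

lemma posdef_uniform_bounds:
  fixes G :: "'a::metric_space \<Rightarrow> real^'n^'n"
  assumes K: "compact K" "continuous_on K G" and pos: "\<And>x. x \<in> K \<Longrightarrow> posdef (G x)"
  obtains l u where "0 < l" "0 < u"
    "\<And>x v. x \<in> K \<Longrightarrow> l * (norm v)\<^sup>2 \<le> v \<bullet> (G x *v v)"
    "\<And>x v. x \<in> K \<Longrightarrow> v \<bullet> (G x *v v) \<le> u * (norm v)\<^sup>2"
proof (cases "K = {}")
  case False
  define S where "S = sphere (0 :: real^'n) 1"
  have "axis undefined 1 \<in> S"
    by (simp add: S_def)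
  then have ne: "K \<times> S \<noteq> {}" using False by auto
  have cpt: "compact (K \<times> S)"
    by (simp add: K(1) compact_Times S_def)
  have cont: "continuous_on (K \<times> S) (\<lambda>(x, v). v \<bullet> (G x *v v))"
    by (rule continuous_on_quadratic_form[OF K(2)])
  obtain x0 v0 where m0: "x0 \<in> K" "v0 \<in> S" "\<And>x v. x \<in> K \<Longrightarrow> v \<in> S \<Longrightarrow> v0 \<bullet> (G x0 *v v0) \<le> v \<bullet> (G x *v v)"
    using continuous_attains_inf[OF cpt ne cont] by auto
  obtain x1 v1 where m1: "x1 \<in> K" "v1 \<in> S" "\<And>x v. x \<in> K \<Longrightarrow> v \<in> S \<Longrightarrow> v \<bullet> (G x *v v) \<le> v1 \<bullet> (G x1 *v v1)"
    using continuous_attains_sup[OF cpt ne cont] by auto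
  have scale: "v \<bullet> (G x *v v) = (norm v)\<^sup>2 * ((v /\<^sub>R norm v) \<bullet> (G x *v (v /\<^sub>R norm v)))" if "v \<noteq> 0" for x v
    using that by (simp add: matrix_vector_mult_scaleR power2_eq_square field_simps)
  have S: "v /\<^sub>R norm v \<in> S" if "v \<noteq> 0" for v
    using that by (simp add: S_def)
  have pos': "0 < v \<bullet> (G x *v v)" if "x \<in> K" "v \<in> S" for x v
  proof -
    have "v \<noteq> 0" using that(2) by (auto simp: S_def)
    then show ?thesis using pos[OF that(1)] by (simp add: posdef_def)
  qed
  show ?thesis
  proof (rule that)
    show "0 < v0 \<bullet> (G x0 *v v0)" "0 < v1 \<bullet> (G x1 *v v1)"
      using pos' m0 m1 by auto
    fix x v assume x: "x \<in> K"
    show "v0 \<bullet> (G x0 *v v0) * (norm v)\<^sup>2 \<le> v \<bullet> (G x *v v)"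
    proof (cases "v = 0")
      case False
      show ?thesis
        using mult_left_mono[OF m0(3)[OF x S[OF False]] zero_le_power2[of "norm v"]]
        unfolding scale[OF False, of x, symmetric] by (simp only: mult.commute)
    qed simp
    show "v \<bullet> (G x *v v) \<le> v1 \<bullet> (G x1 *v v1) * (norm v)\<^sup>2"
    proof (cases "v = 0")
      case False
      show ?thesis
        using mult_left_mono[OF m1(3)[OF x S[OF False]] zero_le_power2[of "norm v"]]
        unfolding scale[OF False, of x, symmetric] by (simp only: mult.commute)
    qed simp
  qed
qed (use that[of 1 1] in auto)

section \<open>Differentiation within the half-space\<close>

lemma closed_half_space: "closed half_space"
  unfolding half_space_def by (intro closed_Collect_le continuous_intros)

lemma convex_half_space: "convex half_space"
  by (auto simp: convex_def half_space_def)

text \<open>From every point of the half-space, boundary included, a small positive step along each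
  basis vector stays inside, which pins the derivative down on a basis.\<close>

lemma has_derivative_unique_half_space:
  fixes f :: "real ^ ('n::finite) option \<Rightarrow> 'b::real_normed_vector"
  assumes "x \<in> half_space" "(f has_derivative f') (at x within half_space)"
    "(f has_derivative f'') (at x within half_space)"
  shows "f' = f''"
proof (rule frechet_derivative_unique_within[OF assms(2,3)])
  fix i :: "real ^ 'n option" and e :: real
  assume i: "i \<in> Basis" "0 < e"
  have "x + (e / 2) *\<^sub>R i \<in> half_space"
    using assms(1) i by (auto simp: half_space_def Basis_vec_def axis_def)
  then show "\<exists>d. 0 < \<bar>d\<bar> \<and> \<bar>d\<bar> < e \<and> x + d *\<^sub>R i \<in> half_space"
    using i(2) by (intro exI[of _ "e / 2"]) auto
qed

lemma frechet_derivative_half_space: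
  fixes f :: "real ^ ('n::finite) option \<Rightarrow> 'b::real_normed_vector"
  assumes "x \<in> half_space" "(f has_derivative f') (at x within half_space)"
  shows "frechet_derivative f (at x within half_space) = f'"
proof -
  have "f differentiable (at x within half_space)"
    using assms(2) by (auto simp: differentiable_def)
  then show ?thesis
    using has_derivative_unique_half_space[OF assms(1) _ assms(2)] by (simp add: frechet_derivative_works)
qed

text \<open>Smoothness is given through ambient extensions \<open>F\<close>. This passes their
  two-sided derivative on to a function prescribed only on the half-space.\<close>

lemma has_derivative_half_space_local:
  assumes "(F has_derivative F') (at x)" "open U" "x \<in> U" "x \<in> half_space"
    and "\<And>y. y \<in> U \<inter> half_space \<Longrightarrow> F y = f y"
  shows "(f has_derivative F') (at x within half_space)"
proof -
  obtain d where d: "0 < d" "ball x d \<subseteq> U"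
    using assms(2,3) open_contains_ball by blast
  show ?thesis
    by (rule has_derivative_transform_within[OF has_derivative_at_withinI[OF assms(1)] d(1) assms(4)])
      (use d(2) assms(5) in \<open>auto simp: subset_iff dist_commute\<close>)
qed

section \<open>Charts and transition maps\<close>

locale smooth_mfd =
  fixes A :: "('a::{t2_space, second_countable_topology}, 'n::finite) chart set"
  assumes atlas: "smooth_atlas A"
begin

lemma chart:
  assumes "c \<in> A"
  shows "open (chart_dom c)" "openin (top_of_set half_space) (chart_img c)"
    "homeomorphism (chart_dom c) (chart_img c) (chart_map c) (chart_inv c)"
    "continuous_on (chart_dom c) (chart_map c)" "continuous_on (chart_img c) (chart_inv c)"
    "chart_img c \<subseteq> half_space"
proof -
  have "is_chart c"
    using assms atlas by (auto simp: smooth_atlas_def)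
  then show "open (chart_dom c)" "openin (top_of_set half_space) (chart_img c)"
    "homeomorphism (chart_dom c) (chart_img c) (chart_map c) (chart_inv c)"
    "continuous_on (chart_dom c) (chart_map c)" "continuous_on (chart_img c) (chart_inv c)"
    by (auto simp: is_chart_def homeomorphism_def)
  then show "chart_img c \<subseteq> half_space"
    using openin_imp_subset by blast
qed

lemma chart_inv_map [simp]: "c \<in> A \<Longrightarrow> q \<in> chart_dom c \<Longrightarrow> chart_inv c (chart_map c q) = q"
  using chart(3) by (auto simp: homeomorphism_def)

lemma chart_map_inv [simp]: "c \<in> A \<Longrightarrow> x \<in> chart_img c \<Longrightarrow> chart_map c (chart_inv c x) = x"
  using chart(3) by (auto simp: homeomorphism_def)

lemma chart_map_in: "q \<in> chart_dom c \<Longrightarrow> chart_map c q \<in> chart_img c"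
  by (auto simp: chart_img_def)

lemma chart_inv_in: "c \<in> A \<Longrightarrow> x \<in> chart_img c \<Longrightarrow> chart_inv c x \<in> chart_dom c"
  by (auto simp: chart_img_def)

lemma chart_map_half_space: "c \<in> A \<Longrightarrow> q \<in> chart_dom c \<Longrightarrow> chart_map c q \<in> half_space"
  using chart(6)[of c] chart_map_in[of q c] by auto

lemma chart_at: "chart_at A q \<in> A" "q \<in> chart_dom (chart_at A q)"
proof -
  have "\<exists>c. c \<in> A \<and> q \<in> chart_dom c"
    using atlas unfolding smooth_atlas_def by blast
  from someI_ex[OF this] show "chart_at A q \<in> A" "q \<in> chart_dom (chart_at A q)"
    by (auto simp: chart_at_def)
qed

lemma chart_image_open:
  assumes "c \<in> A" "open U"
  obtains V where "open V" "chart_map c ` (chart_dom c \<inter> U) = V \<inter> half_space"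
proof -
  have "openin (top_of_set (chart_dom c)) (chart_dom c \<inter> U)"
    using assms by auto
  then have "openin (top_of_set (chart_img c)) (chart_map c ` (chart_dom c \<inter> U))"
    using homeomorphism_imp_open_map[OF chart(3)[OF assms(1)]] by blast
  then have "openin (top_of_set half_space) (chart_map c ` (chart_dom c \<inter> U))"
    using chart(2)[OF assms(1)] openin_trans by blast
  then show ?thesis
    using that by (auto simp: openin_open)
qed

lemma chart_img_open:
  assumes "c \<in> A"
  obtains V where "open V" "chart_img c = V \<inter> half_space"
  using chart(2)[OF assms] by (auto simp: openin_open)

text \<open>The neighbourhood is shrunk until all of its half-space points come from the overlap of
  the two charts, so that later arguments carry no further domain conditions.\<close>

lemma transition_extension:
  assumes "c \<in> A" "d \<in> A" "p \<in> chart_dom c" "p \<in> chart_dom d"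
  obtains U F where "open U" "chart_map c p \<in> U" "\<And>k. Ck_on k U F"
    "\<And>y. y \<in> U \<inter> half_space \<Longrightarrow> y \<in> chart_img c \<and> chart_inv c y \<in> chart_dom d \<and> F y = chart_map d (chart_inv c y)"
proof -
  let ?W = "chart_map c ` (chart_dom c \<inter> chart_dom d)"
  have "smooth_in ?W (chart_map d \<circ> chart_inv c)"
    using atlas assms by (auto simp: smooth_atlas_def)
  moreover have "chart_map c p \<in> ?W"
    using assms by auto
  ultimately have "\<exists>U F. open U \<and> chart_map c p \<in> U \<and> (\<forall>k. Ck_on k U F) \<and>
      (\<forall>y\<in>?W \<inter> U. F y = (chart_map d \<circ> chart_inv c) y)"
    unfolding smooth_in_def by (rule bspec)
  then obtain U F where U: "open U" "chart_map c p \<in> U" "\<And>k. Ck_on k U F" 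
      "\<And>y. y \<in> ?W \<inter> U \<Longrightarrow> F y = (chart_map d \<circ> chart_inv c) y"
    by blast
  obtain V where V: "open V" "?W = V \<inter> half_space"
    using chart_image_open[OF assms(1) chart(1)[OF assms(2)]] .
  have W: "y \<in> chart_img c \<and> chart_inv c y \<in> chart_dom d" if "y \<in> ?W" for y
    using that assms(1) by (auto simp: chart_map_in)
  show ?thesis
  proof (rule that)
    show "open (U \<inter> V)" using U V by auto
    show "chart_map c p \<in> U \<inter> V"
      using U V \<open>chart_map c p \<in> ?W\<close> by auto
    show "Ck_on k (U \<inter> V) F" for k
      using U(3) by (rule Ck_on_subset) auto
    fix y assume "y \<in> U \<inter> V \<inter> half_space"
    then have "y \<in> ?W \<inter> U" using V by auto
    then show "y \<in> chart_img c \<and> chart_inv c y \<in> chart_dom d \<and> F y = chart_map d (chart_inv c y)"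
      using U(4) W by auto
  qed
qed

lemma transition_has_derivative:
  assumes "c \<in> A" "d \<in> A" "p \<in> chart_dom c" "p \<in> chart_dom d"
  shows "(chart_map d \<circ> chart_inv c has_derivative (\<lambda>v. transition_jacobian c d p *v v)) (at (chart_map c p) within half_space)"
proof -
  obtain U F where U: "open U" "chart_map c p \<in> U" "\<And>k. Ck_on k U F"
    "\<And>y. y \<in> U \<inter> half_space \<Longrightarrow> y \<in> chart_img c \<and> chart_inv c y \<in> chart_dom d \<and> F y = chart_map d (chart_inv c y)"
    using transition_extension[OF assms] by metis
  have "(F has_derivative frechet_derivative F (at (chart_map c p))) (at (chart_map c p))"
    using Ck_on_Suc_has_derivative[OF U(3) U(2)] .
  then have "(chart_map d \<circ> chart_inv c has_derivative frechet_derivative F (at (chart_map c p))) (at (chart_map c p) within half_space)"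
    using U chart_map_half_space[OF assms(1,3)] by (auto intro: has_derivative_half_space_local)
  then have "(chart_map d \<circ> chart_inv c has_derivative
      frechet_derivative (chart_map d \<circ> chart_inv c) (at (chart_map c p) within half_space)) (at (chart_map c p) within half_space)"
    by (metis differentiable_def frechet_derivative_works)
  moreover have "(*v) (transition_jacobian c d p) = frechet_derivative (chart_map d \<circ> chart_inv c) (at (chart_map c p) within half_space)"
    unfolding transition_jacobian_def
    using matrix_vector_mul(2)[OF has_derivative_linear[OF calculation]] by simp
  ultimately show ?thesis
    by simp
qed

text \<open>An extension is arbitrary off the half-space, yet uniqueness of derivatives within the
  half-space forces its full derivative at half-space points. The chain rule then applies to
  \<open>F\<close> without one-sided limits.\<close>

lemma transition_extension_has_derivative:
  assumes "c \<in> A" "d \<in> A" "open U" "\<And>k. Ck_on k U F"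
    "\<And>y. y \<in> U \<inter> half_space \<Longrightarrow> y \<in> chart_img c \<and> chart_inv c y \<in> chart_dom d \<and> F y = chart_map d (chart_inv c y)"
    and x: "x \<in> U" "x \<in> half_space"
  shows "(F has_derivative (\<lambda>v. transition_jacobian c d (chart_inv c x) *v v)) (at x)"
proof -
  have F: "(F has_derivative frechet_derivative F (at x)) (at x)"
    using Ck_on_Suc_has_derivative[OF assms(4) x(1)] .
  then have "(chart_map d \<circ> chart_inv c has_derivative frechet_derivative F (at x)) (at x within half_space)"
    by (rule has_derivative_half_space_local[OF _ assms(3) x]) (use assms(5) in auto)
  moreover have "(chart_map d \<circ> chart_inv c has_derivative (\<lambda>v. transition_jacobian c d (chart_inv c x) *v v)) (at x within half_space)"
    using transition_has_derivative[OF assms(1,2), of "chart_inv c x"] assms(1,5) x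
    by (auto simp: chart_inv_in)
  ultimately show ?thesis
    using has_derivative_unique_half_space[OF x(2)] F by metis
qed

end

text \<open>Continuity suffices below, and it is stable under conformal changes by positive continuous factors.\<close>

locale mfd_metric = smooth_mfd A
  for A :: "('a::{t2_space, second_countable_topology}, 'n::finite) chart set" +
  fixes g :: "('a, 'n) metric"
  assumes metric_continuous: "\<And>c. c \<in> A \<Longrightarrow> continuous_on (chart_img c) (g c \<circ> chart_inv c)"
    and metric_posdef: "\<And>c q. c \<in> A \<Longrightarrow> q \<in> chart_dom c \<Longrightarrow> posdef (g c q)"
    and metric_transform: "\<And>c d q. c \<in> A \<Longrightarrow> d \<in> A \<Longrightarrow> q \<in> chart_dom c \<Longrightarrow> q \<in> chart_dom d \<Longrightarrow>
      g c q = transpose (transition_jacobian c d q) ** g d q ** transition_jacobian c d q"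
begin

text \<open>The transformation rule of the metric forces invertibility: a singular Jacobian would
  make the pulled-back positive definite matrix singular.\<close>

lemma jacobian_det_nonzero:
  assumes "c \<in> A" "d \<in> A" "q \<in> chart_dom c" "q \<in> chart_dom d"
  shows "det (transition_jacobian c d q) \<noteq> 0"
  using posdef_congruence_det_nonzero[OF metric_transform[OF assms] metric_posdef[OF assms(1,3)]] .

text \<open>
  Otherwise a transition map would send an interior point to the boundary, so its transverse
  component would have a local minimum there, contradicting the invertibility of its derivative.
\<close>

lemma boundary_chart_independent:
  assumes "c \<in> A" "d \<in> A" "q \<in> chart_dom c" "q \<in> chart_dom d" "chart_map c q $ None = 0"
  shows "chart_map d q $ None = 0"
proof (rule ccontr)
  assume "chart_map d q $ None \<noteq> 0"
  then have y: "0 < chart_map d q $ None"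
    using chart_map_half_space[OF assms(2,4)] by (simp add: half_space_def)
  let ?y = "chart_map d q" and ?J = "transition_jacobian d c q"
  obtain U F where U: "open U" "?y \<in> U" "\<And>k. Ck_on k U F"
    "\<And>y. y \<in> U \<inter> half_space \<Longrightarrow> y \<in> chart_img d \<and> chart_inv d y \<in> chart_dom c \<and> F y = chart_map c (chart_inv d y)"
    using transition_extension[OF assms(2,1,4,3)] by metis
  let ?S = "U \<inter> {x. 0 < x $ None}"
  have S: "open ?S" "?y \<in> ?S"
    using U(1,2) y by (auto intro!: open_Int open_Collect_less continuous_intros)
  have sub: "?S \<subseteq> U \<inter> half_space"
    by (auto simp: half_space_def)
  have "(F has_derivative (\<lambda>v. ?J *v v)) (at ?y)"
    using transition_extension_has_derivative[OF assms(2,1) U(1,3,4) U(2) chart_map_half_space[OF assms(2,4)]] assms(2,4)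
    by simp
  then have "((\<lambda>x. F x $ None) has_derivative (\<lambda>v. (?J *v v) $ None)) (at ?y)"
    by (rule bounded_linear.has_derivative[OF bounded_linear_vec_nth])
  then have zero: "(\<lambda>v. (?J *v v) $ None) = (\<lambda>v. 0)"
  proof (rule differential_zero_maxmin[OF S(2,1)])
    have "F ?y $ None = 0"
      using U(4)[of ?y] sub S(2) assms by auto
    moreover have "0 \<le> F y $ None" if "y \<in> ?S" for y
      using U(4)[of y] sub that chart_map_half_space[OF assms(1)] by (auto simp: half_space_def)
    ultimately show "(\<forall>y\<in>?S. F y $ None \<le> F ?y $ None) \<or> (\<forall>y\<in>?S. F ?y $ None \<le> F y $ None)"
      by auto
  qed
  obtain B where "?J ** B = mat 1"
    using jacobian_det_nonzero[OF assms(2,1,4,3)] invertible_det_nz[of ?J] invertible_def by blast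
  then have "?J *v (B *v axis None 1) = axis None 1"
    by (simp add: matrix_vector_mul_assoc)
  then show False
    using fun_cong[OF zero, of "B *v axis None 1"] by (simp add: axis_def)
qed

lemma mfd_boundary_iff:
  "c \<in> A \<Longrightarrow> q \<in> chart_dom c \<Longrightarrow> q \<in> mfd_boundary A \<longleftrightarrow> chart_map c q $ None = 0"
proof
  assume "c \<in> A" "q \<in> chart_dom c" "q \<in> mfd_boundary A"
  then show "chart_map c q $ None = 0"
    using boundary_chart_independent unfolding mfd_boundary_def by blast
qed (auto simp: mfd_boundary_def)

end

section \<open>Measures given by densities in charts\<close>

text \<open>
  The common core of the volume measure and of the boundary measure: \<open>\<psi> c\<close> is a chart with domain
  \<open>dom c\<close>, inverse \<open>\<phi> c\<close> and density \<open>w c\<close>.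
\<close>

locale chart_measures =
  fixes M :: "'a measure" and I :: "'c set" and dom :: "'c \<Rightarrow> 'a set"
    and img :: "'c \<Rightarrow> (real^'m::finite) set" and \<psi> :: "'c \<Rightarrow> 'a \<Rightarrow> real^'m" and \<phi> :: "'c \<Rightarrow> real^'m \<Rightarrow> 'a"
    and w :: "'c \<Rightarrow> real^'m \<Rightarrow> real"
  assumes space_nonempty: "space M \<noteq> {}"
    and dom_sets: "\<And>c. c \<in> I \<Longrightarrow> dom c \<in> sets M"
    and img_sets: "\<And>c. c \<in> I \<Longrightarrow> img c \<in> sets borel"
    and \<psi>_dom: "\<And>c. c \<in> I \<Longrightarrow> \<psi> c ` dom c = img c"
    and \<phi>_\<psi>: "\<And>c q. c \<in> I \<Longrightarrow> q \<in> dom c \<Longrightarrow> \<phi> c (\<psi> c q) = q"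
    and \<phi>_measurable: "\<And>c. c \<in> I \<Longrightarrow> \<phi> c \<in> restrict_space borel (img c) \<rightarrow>\<^sub>M M"
    and w_measurable: "\<And>c. c \<in> I \<Longrightarrow> (\<lambda>x. w c x * indicator (img c) x) \<in> borel_measurable borel"
    and w_nonneg: "\<And>c x. c \<in> I \<Longrightarrow> x \<in> img c \<Longrightarrow> 0 \<le> w c x"
    and transition: "\<And>c d q. c \<in> I \<Longrightarrow> d \<in> I \<Longrightarrow> q \<in> dom c \<Longrightarrow> q \<in> dom d \<Longrightarrow>
      \<exists>T'. (\<psi> d \<circ> \<phi> c has_derivative T') (at (\<psi> c q) within \<psi> c ` (dom c \<inter> dom d)) \<and>
        w c (\<psi> c q) = \<bar>det (matrix T')\<bar> * w d (\<psi> d q)"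
    and finite_cover: "\<exists>C. finite C \<and> C \<subseteq> I \<and> (\<Union>c\<in>C. dom c) = space M"
begin

lemma image_eq:
  assumes "c \<in> I" "B \<subseteq> dom c"
  shows "\<psi> c ` B = img c \<inter> \<phi> c -` B"
  using assms \<psi>_dom[OF assms(1)] \<phi>_\<psi>[OF assms(1)] by (fastforce simp: image_iff)

lemma image_sets:
  assumes "c \<in> I" "B \<in> sets M" "B \<subseteq> dom c"
  shows "\<psi> c ` B \<in> sets borel"
proof -
  have "\<phi> c -` B \<inter> space (restrict_space borel (img c)) \<in> sets (restrict_space borel (img c))"
    using measurable_sets[OF \<phi>_measurable[OF assms(1)] assms(2)] .
  then show ?thesis
    using img_sets[OF assms(1)] image_eq[OF assms(1,3)]
    by (simp add: sets_restrict_space_iff space_restrict_space Int_commute)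
qed

text \<open>A push-forward requires a total measurable map, hence the arbitrary point of the space
  as value outside \<open>img c\<close>, where the density vanishes.\<close>

definition chart_measure :: "'c \<Rightarrow> 'a measure" where
  "chart_measure c = distr (density lborel (\<lambda>x. ennreal (w c x) * indicator (img c) x)) M
     (\<lambda>x. if x \<in> img c then \<phi> c x else (SOME a. a \<in> space M))"

lemma sets_chart_measure [simp]: "sets (chart_measure c) = sets M"
  by (simp add: chart_measure_def)

lemma density_measurable:
  assumes "c \<in> I"
  shows "(\<lambda>x. ennreal (w c x) * indicator (img c) x) \<in> borel_measurable borel"
proof -
  have "(\<lambda>x. ennreal (w c x) * indicator (img c) x) = (\<lambda>x. ennreal (w c x * indicator (img c) x))"
    by (auto simp: indicator_def)
  then show ?thesis
    using w_measurable[OF assms] by simp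
qed

lemma extended_\<phi>_measurable:
  assumes "c \<in> I"
  shows "(\<lambda>x. if x \<in> img c then \<phi> c x else (SOME a. a \<in> space M)) \<in> borel \<rightarrow>\<^sub>M M"
proof -
  have "(\<lambda>x. SOME a. a \<in> space M) \<in> restrict_space borel (- img c) \<rightarrow>\<^sub>M M"
    using space_nonempty by (intro measurable_const) (simp add: some_in_eq)
  then show ?thesis
    using \<phi>_measurable[OF assms] img_sets[OF assms] measurable_If_restrict_space_iff[of borel "\<lambda>x. x \<in> img c" "\<phi> c"]
    by (simp add: Compl_eq)
qed

lemma nn_integral_chart_measure:
  assumes c: "c \<in> I" and F: "F \<in> borel_measurable M"
  shows "(\<integral>\<^sup>+q. F q \<partial>chart_measure c) = (\<integral>\<^sup>+x. ennreal (w c x) * indicator (img c) x * F (\<phi> c x) \<partial>lborel)"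
proof -
  let ?e = "\<lambda>x. if x \<in> img c then \<phi> c x else (SOME a. a \<in> space M)"
  have e: "?e \<in> lborel \<rightarrow>\<^sub>M M" using extended_\<phi>_measurable[OF c] by simp
  have "(\<integral>\<^sup>+q. F q \<partial>chart_measure c) = (\<integral>\<^sup>+x. F (?e x) \<partial>density lborel (\<lambda>x. ennreal (w c x) * indicator (img c) x))"
    unfolding chart_measure_def using e F by (subst nn_integral_distr) auto
  also have "\<dots> = (\<integral>\<^sup>+x. ennreal (w c x) * indicator (img c) x * F (?e x) \<partial>lborel)"
    using density_measurable[OF c] measurable_compose[OF e F] by (subst nn_integral_density) auto
  also have "\<dots> = (\<integral>\<^sup>+x. ennreal (w c x) * indicator (img c) x * F (\<phi> c x) \<partial>lborel)"
    by (intro nn_integral_cong) (simp add: indicator_def)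
  finally show ?thesis .
qed

lemma emeasure_chart_measure:
  assumes c: "c \<in> I" and B: "B \<in> sets M"
  shows "emeasure (chart_measure c) B = (\<integral>\<^sup>+x. ennreal (w c x) * indicator (img c \<inter> \<phi> c -` B) x \<partial>lborel)"
proof -
  have "emeasure (chart_measure c) B = (\<integral>\<^sup>+q. indicator B q \<partial>chart_measure c)"
    using B by simp
  also have "\<dots> = (\<integral>\<^sup>+x. ennreal (w c x) * indicator (img c) x * indicator B (\<phi> c x) \<partial>lborel)"
    using B by (intro nn_integral_chart_measure[OF c]) auto
  also have "\<dots> = (\<integral>\<^sup>+x. ennreal (w c x) * indicator (img c \<inter> \<phi> c -` B) x \<partial>lborel)"
    by (intro nn_integral_cong) (simp add: indicator_def)
  finally show ?thesis .
qed

text \<open>The chart measure is concentrated on the domain of its chart, because the inverse chart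
  maps \<open>img c\<close> into it.\<close>

lemma emeasure_chart_measure_Int:
  assumes "c \<in> I" "B \<in> sets M"
  shows "emeasure (chart_measure c) (B \<inter> dom c) = emeasure (chart_measure c) B"
proof -
  have "img c \<inter> \<phi> c -` (B \<inter> dom c) = img c \<inter> \<phi> c -` B"
    using \<psi>_dom[OF assms(1)] \<phi>_\<psi>[OF assms(1)] by force
  then show ?thesis
    using assms dom_sets by (simp add: emeasure_chart_measure sets.Int)
qed

text \<open>The transition map carries one coordinate image of \<open>B\<close> bijectively onto the
  other, and the density rule in \<open>transition\<close> is exactly what the change of variables
  formula asks for.\<close>

lemma chart_measure_compat:
  assumes c: "c \<in> I" and d: "d \<in> I" and B: "B \<in> sets M" "B \<subseteq> dom c" "B \<subseteq> dom d"
  shows "emeasure (chart_measure c) B = emeasure (chart_measure d) B"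
proof -
  let ?S = "\<psi> c ` B" and ?T = "\<psi> d \<circ> \<phi> c"
  have TS: "?T ` ?S = \<psi> d ` B"
    using B \<phi>_\<psi>[OF c] by (force simp: image_iff)
  obtain T' where T': "\<And>q. q \<in> dom c \<Longrightarrow> q \<in> dom d \<Longrightarrow>
      (?T has_derivative T' q) (at (\<psi> c q) within \<psi> c ` (dom c \<inter> dom d)) \<and>
        w c (\<psi> c q) = \<bar>det (matrix (T' q))\<bar> * w d (\<psi> d q)"
    using transition[OF c d] by metis
  have m: "(\<lambda>x. w e x * indicator (\<psi> e ` B) x) \<in> borel_measurable borel" if "e \<in> I" "B \<subseteq> dom e" for e
  proof -
    have "(\<lambda>x. w e x * indicator (\<psi> e ` B) x) = (\<lambda>x. (w e x * indicator (img e) x) * indicator (\<psi> e ` B) x)"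
      using that \<psi>_dom[OF that(1)] by (auto simp: indicator_def fun_eq_iff)
    then show ?thesis
      using w_measurable[OF that(1)] image_sets[OF that(1) B(1) that(2)] by simp
  qed
  have "(\<integral>\<^sup>+y. ennreal (w d y) * indicator (?T ` ?S) y \<partial>lborel) = (\<integral>\<^sup>+x. ennreal (w c x) * indicator ?S x \<partial>lborel)"
  proof (rule nn_integral_change_of_variables[where T' = "\<lambda>x. T' (\<phi> c x)"])
    show "?S \<in> sets borel" "?T ` ?S \<in> sets borel"
      unfolding TS using image_sets c d B by auto
    show "(?T has_derivative T' (\<phi> c x)) (at x within ?S)" if x: "x \<in> ?S" for x
    proof -
      from x obtain q where q: "q \<in> B" "x = \<psi> c q" by (elim imageE)
      have "(?T has_derivative T' q) (at (\<psi> c q) within \<psi> c ` (dom c \<inter> dom d))"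
        using T'[OF subsetD[OF B(2) q(1)] subsetD[OF B(3) q(1)]] by (rule conjunct1)
      then have "(?T has_derivative T' q) (at (\<psi> c q) within ?S)"
        by (rule has_derivative_subset) (use B in blast)
      moreover have "\<phi> c x = q"
        using \<phi>_\<psi>[OF c subsetD[OF B(2) q(1)]] q(2) by simp
      ultimately show ?thesis
        using q(2) by simp
    qed
    show "inj_on ?T ?S"
    proof (rule inj_onI)
      fix x y assume "x \<in> ?S" "y \<in> ?S" and eq: "?T x = ?T y"
      then obtain p q where pq: "p \<in> B" "x = \<psi> c p" "q \<in> B" "y = \<psi> c q" by (elim imageE)
      have inv: "\<phi> c (\<psi> c z) = z" "\<phi> d (\<psi> d z) = z" if "z \<in> B" for z
        using that B \<phi>_\<psi>[OF c, of z] \<phi>_\<psi>[OF d, of z] by blast+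
      have "\<psi> d p = \<psi> d q" using eq inv pq by simp
      then have "p = q" using inv(2) pq(1,3) by metis
      then show "x = y" using pq by simp
    qed
    show "0 \<le> w d y" if "y \<in> ?T ` ?S" for y
      using that w_nonneg[OF d] B \<psi>_dom[OF d] unfolding TS by blast
    show "w c x = \<bar>det (matrix (T' (\<phi> c x)))\<bar> * w d (?T x)" if "x \<in> ?S" for x
    proof -
      from that obtain q where q: "q \<in> B" "x = \<psi> c q" by (elim imageE)
      have "q \<in> dom c" "q \<in> dom d" using q(1) B by blast+
      then show ?thesis
        using T'[of q] \<phi>_\<psi>[OF c, of q] q(2) by simp
    qed
    show "(\<lambda>x. w c x * indicator ?S x) \<in> borel_measurable borel"
      "(\<lambda>y. w d y * indicator (?T ` ?S) y) \<in> borel_measurable borel"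
      unfolding TS using m c d B by auto
  qed
  then show ?thesis
    unfolding TS using B c d by (simp add: emeasure_chart_measure image_eq)
qed

text \<open>The property singled out by the definite descriptions of both the volume and the
  boundary measure.\<close>

definition is_glued :: "'a measure \<Rightarrow> bool" where
  "is_glued \<mu> \<longleftrightarrow> sets \<mu> = sets M \<and> (\<forall>c\<in>I. \<forall>B\<in>sets M. B \<subseteq> dom c \<longrightarrow>
     emeasure \<mu> B = (\<integral>\<^sup>+x. ennreal (w c x) * indicator (\<psi> c ` B) x \<partial>lborel))"

lemma is_glued_iff:
  "is_glued \<mu> \<longleftrightarrow> sets \<mu> = sets M \<and>
     (\<forall>c\<in>I. \<forall>B\<in>sets M. B \<subseteq> dom c \<longrightarrow> emeasure \<mu> B = emeasure (chart_measure c) B)"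
  by (auto simp: is_glued_def emeasure_chart_measure image_eq)

text \<open>Removing the earlier domains from each member of a finite chart cover leaves disjoint
  measurable pieces, each inside a single chart.\<close>

lemma disjoint_cover:
  obtains e :: "nat \<Rightarrow> 'c" and n D where "\<And>i. i < n \<Longrightarrow> e i \<in> I" "\<And>i. i < n \<Longrightarrow> D i \<subseteq> dom (e i)"
    "\<And>i. i < n \<Longrightarrow> D i \<in> sets M" "disjoint_family_on D {..<n}" "(\<Union>i<n. D i) = space M"
proof -
  obtain C where C: "finite C" "C \<subseteq> I" "(\<Union>c\<in>C. dom c) = space M"
    using finite_cover by blast
  obtain e and n :: nat where e: "C = e ` {..<n}"
    using finite_imp_nat_seg_image_inj_on[OF C(1)] by (auto simp: lessThan_def)
  show ?thesis
  proof (rule that[of n e "disjointed (\<lambda>i. dom (e i))"])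
    show "e i \<in> I" if "i < n" for i using that C e by auto
    show "disjointed (\<lambda>i. dom (e i)) i \<subseteq> dom (e i)" if "i < n" for i
      by (rule disjointed_subset)
    show "disjointed (\<lambda>i. dom (e i)) i \<in> sets M" if "i < n" for i
      unfolding disjointed_def using that C e by (auto intro!: sets.Diff sets.finite_UN dom_sets)
    show "disjoint_family_on (disjointed (\<lambda>i. dom (e i))) {..<n}"
      using disjoint_family_disjointed by (rule disjoint_family_on_mono[rotated]) auto
    show "(\<Union>i<n. disjointed (\<lambda>i. dom (e i)) i) = space M"
      using finite_UN_disjointed_eq[of "\<lambda>i. dom (e i)" n] C e by (simp add: atLeast0LessThan)
  qed
qed

text \<open>For existence, the chart measures of the disjoint pieces are added up; on a subset of
  any other chart domain the result agrees with that chart by compatibility on overlaps. Uniqueness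
  holds because the condition fixes a glued measure on every piece.\<close>

lemma glued_ex1: "\<exists>!\<mu>. is_glued \<mu>"
proof -
  obtain e :: "nat \<Rightarrow> 'c" and n D where e: "\<And>i. i < n \<Longrightarrow> e i \<in> I" "\<And>i. i < n \<Longrightarrow> D i \<subseteq> dom (e i)"
    and D: "\<And>i. i < n \<Longrightarrow> D i \<in> sets M" "disjoint_family_on D {..<n}" "(\<Union>i<n. D i) = space M"
    using disjoint_cover by metis
  define F where "F B = (\<Sum>i<n. emeasure (chart_measure (e i)) (B \<inter> D i))" for B
  have split: "emeasure N B = (\<Sum>i<n. emeasure N (B \<inter> D i))" if N: "sets N = sets M" and B: "B \<in> sets M" for N B
  proof -
    have "(\<Sum>i<n. emeasure N (B \<inter> D i)) = emeasure N (\<Union>i<n. B \<inter> D i)"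
    proof (rule sum_emeasure)
      show "(\<lambda>i. B \<inter> D i) ` {..<n} \<subseteq> sets N"
        using N B D(1) by (simp add: image_subset_iff sets.Int)
      show "disjoint_family_on (\<lambda>i. B \<inter> D i) {..<n}"
        using D(2) unfolding disjoint_family_on_def by blast
    qed simp
    also have "(\<Union>i<n. B \<inter> D i) = B"
      using D(3) sets.sets_into_space[OF B] by blast
    finally show ?thesis by simp
  qed
  have ca: "countably_additive (sets M) F"
  proof (rule countably_additiveI)
    fix B :: "nat \<Rightarrow> 'a set"
    assume B: "range B \<subseteq> sets M" "disjoint_family B"
    have "(\<Sum>k. emeasure (chart_measure (e i)) (B k \<inter> D i)) = emeasure (chart_measure (e i)) ((\<Union>k. B k) \<inter> D i)"
      if "i < n" for i
      using B D(1)[OF that] suminf_emeasure[of "\<lambda>k. B k \<inter> D i" "chart_measure (e i)"]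
      by (auto simp: disjoint_family_on_def sets.Int)
    then show "(\<Sum>k. F (B k)) = F (\<Union>k. B k)"
      unfolding F_def by (subst suminf_sum) auto
  qed
  define \<mu> where "\<mu> = measure_of (space M) (sets M) F"
  have \<mu>: "sets \<mu> = sets M" "emeasure \<mu> B = F B" if "B \<in> sets M" for B
    using that ca emeasure_measure_of[of \<mu> "space M" "sets M" F B] sets.space_closed[of M]
    by (auto simp: \<mu>_def positive_def F_def)
  have sets_\<mu>: "sets \<mu> = sets M" by (simp add: \<mu>_def)
  show ?thesis
  proof (rule ex1I[of _ \<mu>])
    show "is_glued \<mu>"
      unfolding is_glued_iff
    proof (intro conjI ballI impI sets_\<mu>)
      fix c B assume c: "c \<in> I" and B: "B \<in> sets M" "B \<subseteq> dom c"
      have "F B = (\<Sum>i<n. emeasure (chart_measure c) (B \<inter> D i))"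
        unfolding F_def
        by (intro sum.cong refl chart_measure_compat) (use e D B c in auto)
      then show "emeasure \<mu> B = emeasure (chart_measure c) B"
        using \<mu>(2)[OF B(1)] split[of "chart_measure c" B] B by simp
    qed
    fix \<nu> assume \<nu>: "is_glued \<nu>"
    show "\<nu> = \<mu>"
    proof (rule measure_eqI)
      show "sets \<nu> = sets \<mu>" using \<nu> sets_\<mu> by (simp add: is_glued_def)
      fix B assume "B \<in> sets \<nu>"
      then have B: "B \<in> sets M" using \<nu> by (simp add: is_glued_def)
      have "emeasure \<nu> B = (\<Sum>i<n. emeasure \<nu> (B \<inter> D i))"
        using \<nu> B by (intro split) (simp add: is_glued_def)
      also have "\<dots> = F B"
        unfolding F_def using \<nu> B D(1) e by (intro sum.cong refl) (auto simp: is_glued_iff sets.Int le_infI2)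
      finally show "emeasure \<nu> B = emeasure \<mu> B"
        by (simp add: \<mu>(2)[OF B])
    qed
  qed
qed

text \<open>Cutting the glued measure down to \<open>dom c\<close> by an indicator density yields
  the chart measure, which reduces the claim to the integral of a push-forward.\<close>

lemma nn_integral_glued:
  assumes \<mu>: "is_glued \<mu>" and c: "c \<in> I" and F: "F \<in> borel_measurable M"
  shows "(\<integral>\<^sup>+q. F q * indicator (dom c) q \<partial>\<mu>) =
    (\<integral>\<^sup>+x. ennreal (w c x) * indicator (img c) x * F (\<phi> c x) \<partial>lborel)"
proof -
  have sets: "sets \<mu> = sets M" using \<mu> by (simp add: is_glued_def)
  have F': "F \<in> borel_measurable \<mu>" using F sets by (simp cong: measurable_cong_sets)
  have dom: "dom c \<in> sets \<mu>" using dom_sets[OF c] sets by simp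
  have "density \<mu> (indicator (dom c)) = chart_measure c"
  proof (rule measure_eqI)
    show "sets (density \<mu> (indicator (dom c))) = sets (chart_measure c)"
      by (simp add: sets)
    fix B assume "B \<in> sets (density \<mu> (indicator (dom c)))"
    then have B: "B \<in> sets M" "B \<in> sets \<mu>" by (auto simp: sets)
    have "emeasure (density \<mu> (indicator (dom c))) B = (\<integral>\<^sup>+x. indicator (B \<inter> dom c) x \<partial>\<mu>)"
    proof -
      have "emeasure (density \<mu> (indicator (dom c))) B = (\<integral>\<^sup>+x. indicator (dom c) x * indicator B x \<partial>\<mu>)"
        using B dom by (intro emeasure_density) auto
      also have "\<dots> = (\<integral>\<^sup>+x. indicator (B \<inter> dom c) x \<partial>\<mu>)"
        by (intro nn_integral_cong) (auto simp: indicator_def)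
      finally show ?thesis .
    qed
    also have "\<dots> = emeasure \<mu> (B \<inter> dom c)"
      using B dom by (simp add: sets.Int)
    also have "\<dots> = emeasure (chart_measure c) B"
      using \<mu> c B dom_sets[OF c] by (simp add: is_glued_iff sets.Int emeasure_chart_measure_Int)
    finally show "emeasure (density \<mu> (indicator (dom c))) B = emeasure (chart_measure c) B" .
  qed
  moreover have "(\<integral>\<^sup>+q. F q * indicator (dom c) q \<partial>\<mu>) = (\<integral>\<^sup>+q. F q \<partial>density \<mu> (indicator (dom c)))"
    using dom F' by (subst nn_integral_density) (auto simp: mult.commute)
  ultimately show ?thesis
    using nn_integral_chart_measure[OF c F] by simp
qed

end

section \<open>Volume and boundary measure of a Riemannian manifold\<close>

definition tangential :: "real ^ ('n::finite) option \<Rightarrow> real ^ 'n" where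
  "tangential x = (\<chi> j. x $ Some j)"

lemma tangential_boundary_point [simp]: "tangential (boundary_point y) = y"
  by (simp add: tangential_def boundary_point_def vec_eq_iff)

lemma boundary_point_tangential: "x $ None = 0 \<Longrightarrow> boundary_point (tangential x) = x"
  by (simp add: tangential_def boundary_point_def vec_eq_iff split: option.split)

lemma boundary_point_None [simp]: "boundary_point y $ None = 0"
  by (simp add: boundary_point_def)

lemma boundary_point_half_space [simp]: "boundary_point y \<in> half_space"
  by (simp add: half_space_def)

lemma bounded_linear_tangential: "bounded_linear tangential"
  by (intro linear_conv_bounded_linear[THEN iffD1] linearI) (simp_all add: tangential_def vec_eq_iff)

lemma bounded_linear_boundary_point: "bounded_linear boundary_point"
  by (intro linear_conv_bounded_linear[THEN iffD1] linearI)
    (simp_all add: boundary_point_def vec_eq_iff split: option.split)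

lemma continuous_on_boundary_point: "continuous_on S boundary_point"
  by (rule linear_continuous_on[OF bounded_linear_boundary_point])

lemma boundary_point_measurable [measurable]: "boundary_point \<in> borel_measurable borel"
  by (intro borel_measurable_continuous_onI continuous_on_boundary_point)

lemma sum_option: "(\<Sum>i\<in>UNIV. f i) = f None + (\<Sum>j\<in>UNIV. f (Some j))" for f :: "'n::finite option \<Rightarrow> 'b::comm_monoid_add"
  by (simp add: UNIV_option_conv sum.reindex)

lemma continuous_on_det:
  fixes G :: "'a::topological_space \<Rightarrow> real^'n^'n"
  assumes "continuous_on S G"
  shows "continuous_on S (\<lambda>x. det (G x))"
  unfolding det_def using assms by (auto intro!: continuous_intros)

lemma borel_measurable_continuous_times_indicator:
  fixes f :: "'a::topological_space \<Rightarrow> real"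
  assumes "S \<in> sets borel" "continuous_on S f"
  shows "(\<lambda>x. f x * indicator S x) \<in> borel_measurable borel"
  using borel_measurable_continuous_on_indicator[OF assms] by (simp add: mult.commute)

context smooth_mfd begin

lemma chart_img_borel: "c \<in> A \<Longrightarrow> chart_img c \<in> sets borel"
  by (metis chart_img_open borel_open borel_closed closed_half_space sets.Int)

lemma chart_inv_measurable: "c \<in> A \<Longrightarrow> chart_inv c \<in> restrict_space borel (chart_img c) \<rightarrow>\<^sub>M borel"
  by (rule borel_measurable_continuous_on_restrict) (rule chart)

end

locale compact_mfd_metric = mfd_metric A g
  for A :: "('a::{t2_space, second_countable_topology}, 'n::finite) chart set" and g :: "('a, 'n) metric" +
  assumes compact_UNIV: "compact (UNIV :: 'a set)"
    and boundary_nonempty: "mfd_boundary A \<noteq> {}"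
begin

lemma finite_chart_cover: "\<exists>C. finite C \<and> C \<subseteq> A \<and> (\<Union>c\<in>C. chart_dom c) = UNIV"
proof -
  have "UNIV \<subseteq> (\<Union>c\<in>A. chart_dom c)"
    using atlas by (auto simp: smooth_atlas_def)
  then show ?thesis
    using compactE_image[OF compact_UNIV, of A chart_dom] chart(1) by (metis top.extremum_uniqueI)
qed

lemma continuous_on_volume_density:
  "c \<in> A \<Longrightarrow> continuous_on (chart_img c) (\<lambda>x. sqrt (det (g c (chart_inv c x))))"
  using continuous_on_det[OF metric_continuous[of c]] by (auto simp: o_def intro!: continuous_intros)

lemma chart_measures_riem:
  "chart_measures (borel :: 'a measure) A chart_dom chart_img chart_map chart_inv
     (\<lambda>c x. sqrt (det (g c (chart_inv c x))))"
proof
  fix c d :: "('a, 'n) chart" assume c: "c \<in> A"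
  show "chart_dom c \<in> sets borel" using chart(1)[OF c] by simp
  show "chart_img c \<in> sets borel" by (rule chart_img_borel[OF c])
  show "chart_map c ` chart_dom c = chart_img c" by (simp add: chart_img_def)
  show "chart_inv c (chart_map c q) = q" if "q \<in> chart_dom c" for q using that c by simp
  show "chart_inv c \<in> restrict_space borel (chart_img c) \<rightarrow>\<^sub>M borel" by (rule chart_inv_measurable[OF c])
  show "(\<lambda>x. sqrt (det (g c (chart_inv c x))) * indicator (chart_img c) x) \<in> borel_measurable borel"
    by (intro borel_measurable_continuous_times_indicator chart_img_borel continuous_on_volume_density c)
  show "0 \<le> sqrt (det (g c (chart_inv c x)))" if "x \<in> chart_img c" for x
    using posdef_det_pos[OF metric_posdef[OF c chart_inv_in[OF c that]]] by simp
  fix q assume d: "d \<in> A" and q: "q \<in> chart_dom c" "q \<in> chart_dom d"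
  have "chart_map c ` (chart_dom c \<inter> chart_dom d) \<subseteq> half_space"
    using chart_map_half_space[OF c] by blast
  then have "(chart_map d \<circ> chart_inv c has_derivative (\<lambda>v. transition_jacobian c d q *v v))
      (at (chart_map c q) within chart_map c ` (chart_dom c \<inter> chart_dom d))"
    by (rule has_derivative_subset[OF transition_has_derivative[OF c d q]])
  moreover have "sqrt (det (g c q)) = \<bar>det (transition_jacobian c d q)\<bar> * sqrt (det (g d q))"
    by (rule sqrt_det_congruence[OF metric_transform[OF c d q]])
  ultimately show "\<exists>T'. (chart_map d \<circ> chart_inv c has_derivative T')
        (at (chart_map c q) within chart_map c ` (chart_dom c \<inter> chart_dom d)) \<and>
      sqrt (det (g c (chart_inv c (chart_map c q)))) =
        \<bar>det (matrix T')\<bar> * sqrt (det (g d (chart_inv d (chart_map d q))))"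
    using c d q by (intro exI[of _ "\<lambda>v. transition_jacobian c d q *v v"]) simp
qed (use finite_chart_cover in auto)

sublocale riem: chart_measures "borel :: 'a measure" A chart_dom chart_img chart_map chart_inv
    "\<lambda>c x. sqrt (det (g c (chart_inv c x)))"
  by (rule chart_measures_riem)

lemma riem_measure_glued: "riem.is_glued (riem_measure A g)"
  unfolding riem_measure_def riem.is_glued_def[symmetric] by (rule theI'[OF riem.glued_ex1])

lemma sets_riem_measure: "sets (riem_measure A g) = sets borel"
  using riem_measure_glued by (simp add: riem.is_glued_def)

text \<open>Transition maps preserve the boundary, so their derivatives preserve its tangent space.\<close>

lemma jacobian_None_Some:
  assumes c: "c \<in> A" and d: "d \<in> A" and q: "q \<in> chart_dom c" "q \<in> chart_dom d" "q \<in> mfd_boundary A"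
  shows "transition_jacobian c d q $ None $ Some j = 0"
proof -
  let ?x = "chart_map c q" and ?J = "transition_jacobian c d q"
  define e where "e = (axis (Some j) 1 :: real ^ 'n option)"
  obtain U F where U: "open U" "?x \<in> U" "\<And>k. Ck_on k U F"
    "\<And>y. y \<in> U \<inter> half_space \<Longrightarrow> y \<in> chart_img c \<and> chart_inv c y \<in> chart_dom d \<and> F y = chart_map d (chart_inv c y)"
    using transition_extension[OF c d q(1,2)] by metis
  have x0: "?x $ None = 0"
    using mfd_boundary_iff[OF c q(1)] q(3) by simp
  have "(F has_derivative (\<lambda>v. ?J *v v)) (at ?x)"
    using transition_extension_has_derivative[OF c d U(1,3,4) U(2) chart_map_half_space[OF c q(1)]] c q by simp
  then have "((\<lambda>x. F x $ None) has_derivative (\<lambda>v. (?J *v v) $ None)) (at ?x)"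
    by (rule bounded_linear.has_derivative[OF bounded_linear_vec_nth])
  then have "((\<lambda>x. F x $ None) has_derivative (\<lambda>v. (?J *v v) $ None)) (at (?x + 0 *\<^sub>R e))"
    by simp
  moreover have "((\<lambda>t. ?x + t *\<^sub>R e) has_derivative (\<lambda>t. t *\<^sub>R e)) (at 0)"
    by (auto intro!: derivative_eq_intros)
  ultimately have "((\<lambda>t. F (?x + t *\<^sub>R e) $ None) has_derivative (\<lambda>t. (?J *v (t *\<^sub>R e)) $ None)) (at 0)"
    using diff_chain_at[of "\<lambda>t. ?x + t *\<^sub>R e" "\<lambda>t. t *\<^sub>R e" 0 "\<lambda>x. F x $ None"] by (simp add: o_def)
  moreover have "((\<lambda>t. F (?x + t *\<^sub>R e) $ None) has_derivative (\<lambda>t. 0)) (at 0)"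
  proof (rule has_derivative_transform_within_open)
    show "((\<lambda>t. 0) has_derivative (\<lambda>t. 0)) (at (0::real))" by simp
    show "open ((\<lambda>t. ?x + t *\<^sub>R e) -` U)" "0 \<in> (\<lambda>t. ?x + t *\<^sub>R e) -` U"
      using U(1,2) by (auto intro!: open_vimage continuous_intros)
    fix t assume t: "t \<in> (\<lambda>t. ?x + t *\<^sub>R e) -` U"
    let ?y = "?x + t *\<^sub>R e"
    have y0: "?y $ None = 0" using x0 by (simp add: e_def axis_def)
    then have y: "?y \<in> chart_img c" "chart_inv c ?y \<in> chart_dom d" "F ?y = chart_map d (chart_inv c ?y)"
      using U(4)[of ?y] t by (auto simp: half_space_def)
    show "0 = F ?y $ None"
      using boundary_chart_independent[OF c d chart_inv_in[OF c y(1)] y(2)] y y0 c by simp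
  qed
  ultimately have "(\<lambda>t. (?J *v (t *\<^sub>R e)) $ None) = (\<lambda>t::real. 0)"
    by (rule has_derivative_unique)
  then have "(?J *v e) $ None = 0"
    by (metis scaleR_one)
  then show ?thesis
    by (simp add: e_def matrix_vector_mul_component inner_axis)
qed

text \<open>The entries of \<open>J\<close> from tangential to transverse directions vanish on the
  boundary, so the tangential block of the congruence involves only tangential blocks.\<close>

lemma boundary_metric_transform:
  assumes c: "c \<in> A" and d: "d \<in> A" and q: "q \<in> chart_dom c" "q \<in> chart_dom d" "q \<in> mfd_boundary A"
  defines "J \<equiv> transition_jacobian c d q"
  defines "J' \<equiv> (\<chi> i j. J $ Some i $ Some j) :: real^'n^'n"
  shows "boundary_metric g c q = transpose J' ** boundary_metric g d q ** J'"
  unfolding vec_eq_iff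
proof (intro allI)
  fix i j
  have "J $ None $ Some i = 0" for i
    using jacobian_None_Some[OF c d q] by (simp add: J_def)
  then show "boundary_metric g c q $ i $ j = (transpose J' ** boundary_metric g d q ** J') $ i $ j"
    using metric_transform[OF c d q(1,2)]
    by (simp add: boundary_metric_def matrix_matrix_mult_def transpose_def sum_option J'_def J_def)
qed

lemma boundary_metric_posdef:
  assumes "c \<in> A" "q \<in> chart_dom c"
  shows "posdef (boundary_metric g c q)"
  unfolding posdef_def
proof (intro allI impI)
  fix v :: "real^'n" assume v: "v \<noteq> 0"
  have "v \<bullet> (boundary_metric g c q *v v) = boundary_point v \<bullet> (g c q *v boundary_point v)"
    by (simp add: boundary_metric_def inner_vec_def matrix_vector_mult_def sum_option boundary_point_def)
  moreover have "boundary_point v \<noteq> 0"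
    using v tangential_boundary_point[of v] linear_0[OF bounded_linear.linear[OF bounded_linear_tangential]] by metis
  ultimately show "0 < v \<bullet> (boundary_metric g c q *v v)"
    using metric_posdef[OF assms] by (simp add: posdef_def)
qed

lemma continuous_on_boundary_density:
  assumes c: "c \<in> A"
  shows "continuous_on {y. boundary_point y \<in> chart_img c}
    (\<lambda>y. sqrt (det (boundary_metric g c (chart_inv c (boundary_point y)))))"
proof -
  have "continuous_on {y. boundary_point y \<in> chart_img c} (\<lambda>y. g c (chart_inv c (boundary_point y)))"
    by (rule continuous_on_compose2[OF metric_continuous[OF c, unfolded o_def] continuous_on_boundary_point]) auto
  then show ?thesis
    unfolding boundary_metric_def by (intro continuous_on_real_sqrt continuous_on_det) (auto intro!: continuous_intros)
qed

lemma boundary_img_borel: "c \<in> A \<Longrightarrow> {y. boundary_point y \<in> chart_img c} \<in> sets borel"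
  using measurable_sets[OF boundary_point_measurable chart_img_borel] by (simp add: vimage_def)

lemma chart_measures_boundary:
  "chart_measures (restrict_space borel (mfd_boundary A)) A (\<lambda>c. chart_dom c \<inter> mfd_boundary A)
     (\<lambda>c. {y. boundary_point y \<in> chart_img c}) (\<lambda>c q. tangential (chart_map c q))
     (\<lambda>c y. chart_inv c (boundary_point y))
     (\<lambda>c y. sqrt (det (boundary_metric g c (chart_inv c (boundary_point y)))))"
proof
  let ?\<Sigma> = "mfd_boundary A"
  show "space (restrict_space borel ?\<Sigma>) \<noteq> {}"
    using boundary_nonempty by (simp add: space_restrict_space)
  show "\<exists>C. finite C \<and> C \<subseteq> A \<and> (\<Union>c\<in>C. chart_dom c \<inter> ?\<Sigma>) = space (restrict_space borel ?\<Sigma>)"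
    using finite_chart_cover by (fastforce simp: space_restrict_space)
  fix c d :: "('a, 'n) chart" assume c: "c \<in> A"
  have bp: "boundary_point (tangential (chart_map c q)) = chart_map c q" if "c \<in> A" "q \<in> chart_dom c" "q \<in> ?\<Sigma>" for c q
    using that mfd_boundary_iff[of c q] by (simp add: boundary_point_tangential)
  have inv: "chart_inv c (boundary_point y) \<in> chart_dom c \<inter> ?\<Sigma>" if "boundary_point y \<in> chart_img c" for y
    using mfd_boundary_iff[OF c chart_inv_in[OF c that]] chart_inv_in[OF c that] chart_map_inv[OF c that] by simp
  show "chart_dom c \<inter> ?\<Sigma> \<in> sets (restrict_space borel ?\<Sigma>)"
    using chart(1)[OF c] unfolding sets_restrict_space by (intro image_eqI[of _ _ "chart_dom c"]) auto
  show "{y. boundary_point y \<in> chart_img c} \<in> sets borel" by (rule boundary_img_borel[OF c])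
  show "(\<lambda>q. tangential (chart_map c q)) ` (chart_dom c \<inter> ?\<Sigma>) = {y. boundary_point y \<in> chart_img c}"
  proof (intro equalityI subsetI)
    fix y assume "y \<in> {y. boundary_point y \<in> chart_img c}"
    then show "y \<in> (\<lambda>q. tangential (chart_map c q)) ` (chart_dom c \<inter> ?\<Sigma>)"
      using inv[of y] c by (intro image_eqI[of _ _ "chart_inv c (boundary_point y)"]) auto
  qed (use bp[OF c] c in \<open>auto simp: chart_map_in\<close>)
  show "chart_inv c (boundary_point (tangential (chart_map c q))) = q" if "q \<in> chart_dom c \<inter> ?\<Sigma>" for q
    using that bp[OF c, of q] c by simp
  show "(\<lambda>y. chart_inv c (boundary_point y)) \<in>
      restrict_space borel {y. boundary_point y \<in> chart_img c} \<rightarrow>\<^sub>M restrict_space borel ?\<Sigma>"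
  proof (rule measurable_restrict_space2)
    show "(\<lambda>y. chart_inv c (boundary_point y)) \<in> space (restrict_space borel {y. boundary_point y \<in> chart_img c}) \<rightarrow> ?\<Sigma>"
      using inv by (auto simp: space_restrict_space)
    show "(\<lambda>y. chart_inv c (boundary_point y)) \<in> restrict_space borel {y. boundary_point y \<in> chart_img c} \<rightarrow>\<^sub>M borel"
      by (intro borel_measurable_continuous_on_restrict continuous_on_compose2[OF chart(5)[OF c] continuous_on_boundary_point]) auto
  qed
  show "(\<lambda>y. sqrt (det (boundary_metric g c (chart_inv c (boundary_point y)))) *
      indicator {y. boundary_point y \<in> chart_img c} y) \<in> borel_measurable borel"
    by (intro borel_measurable_continuous_times_indicator boundary_img_borel continuous_on_boundary_density c)
  show "0 \<le> sqrt (det (boundary_metric g c (chart_inv c (boundary_point y))))"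
    if "y \<in> {y. boundary_point y \<in> chart_img c}" for y
    using posdef_det_pos[OF boundary_metric_posdef[OF c, of "chart_inv c (boundary_point y)"]] inv that by simp
  fix q assume d: "d \<in> A" and "q \<in> chart_dom c \<inter> ?\<Sigma>" "q \<in> chart_dom d \<inter> ?\<Sigma>"
  then have q: "q \<in> chart_dom c" "q \<in> chart_dom d" "q \<in> ?\<Sigma>" by auto
  let ?S = "(\<lambda>q. tangential (chart_map c q)) ` (chart_dom c \<inter> ?\<Sigma> \<inter> (chart_dom d \<inter> ?\<Sigma>))"
  let ?J = "transition_jacobian c d q"
  \<comment> \<open>The boundary transition map includes the hyperplane, applies the transition map
    and drops the transverse coordinate. Its derivative is therefore the tangential block of the
    Jacobian.\<close>
  let ?T' = "tangential \<circ> ((\<lambda>v. ?J *v v) \<circ> boundary_point)"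
  have "(chart_map d \<circ> chart_inv c has_derivative (\<lambda>v. ?J *v v)) (at (boundary_point (tangential (chart_map c q))) within boundary_point ` ?S)"
    unfolding bp[OF c q(1,3)]
    by (rule has_derivative_subset[OF transition_has_derivative[OF c d q(1,2)]])
      (auto simp: image_subset_iff)
  then have "((chart_map d \<circ> chart_inv c) \<circ> boundary_point has_derivative (\<lambda>v. ?J *v v) \<circ> boundary_point) (at (tangential (chart_map c q)) within ?S)"
    by (rule diff_chain_within[OF bounded_linear_imp_has_derivative[OF bounded_linear_boundary_point]])
  then have "(tangential \<circ> ((chart_map d \<circ> chart_inv c) \<circ> boundary_point) has_derivative ?T') (at (tangential (chart_map c q)) within ?S)"
    by (rule diff_chain_within[OF _ bounded_linear_imp_has_derivative[OF bounded_linear_tangential]])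
  moreover have "matrix ?T' = (\<chi> i j. ?J $ Some i $ Some j)"
  proof -
    have bp_axis: "boundary_point (axis j 1) = axis (Some j) 1" for j :: 'n
      by (simp add: boundary_point_def axis_def vec_eq_iff split: option.split)
    then show ?thesis
      by (subst vec_eq_iff) (simp add: matrix_def bp_axis tangential_def matrix_vector_mul_component inner_axis)
  qed
  ultimately show "\<exists>T'. ((\<lambda>q. tangential (chart_map d q)) \<circ> (\<lambda>y. chart_inv c (boundary_point y)) has_derivative T')
        (at (tangential (chart_map c q)) within ?S) \<and>
      sqrt (det (boundary_metric g c (chart_inv c (boundary_point (tangential (chart_map c q)))))) =
        \<bar>det (matrix T')\<bar> * sqrt (det (boundary_metric g d (chart_inv d (boundary_point (tangential (chart_map d q))))))"
    using sqrt_det_congruence[OF boundary_metric_transform[OF c d q]] bp[OF c q(1,3)] bp[OF d q(2,3)] c d q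
    by (intro exI[of _ ?T']) (simp add: o_def)
qed

sublocale bnd: chart_measures "restrict_space borel (mfd_boundary A)" A "\<lambda>c. chart_dom c \<inter> mfd_boundary A"
    "\<lambda>c. {y. boundary_point y \<in> chart_img c}" "\<lambda>c q. tangential (chart_map c q)"
    "\<lambda>c y. chart_inv c (boundary_point y)"
    "\<lambda>c y. sqrt (det (boundary_metric g c (chart_inv c (boundary_point y))))"
  by (rule chart_measures_boundary)

text \<open>The definition tests membership of \<open>boundary_point y\<close> in a chart image,
  whereas \<open>is_glued\<close> uses the tangential image. The two agree because sets in the
  boundary have transverse coordinate 0.\<close>

lemma boundary_measure_glued: "bnd.is_glued (boundary_measure A g)"
proof -
  have "(\<integral>\<^sup>+y. ennreal (sqrt (det (boundary_metric g c (chart_inv c (boundary_point y)))))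
             * indicator (chart_map c ` B) (boundary_point y) \<partial>lborel) =
    (\<integral>\<^sup>+y. ennreal (sqrt (det (boundary_metric g c (chart_inv c (boundary_point y)))))
             * indicator ((\<lambda>q. tangential (chart_map c q)) ` B) y \<partial>lborel)"
    if "c \<in> A" "B \<subseteq> chart_dom c" "B \<subseteq> mfd_boundary A" for c B
  proof (intro nn_integral_cong arg_cong2[where f = "(*)"] refl)
    fix y
    have "chart_map c q = boundary_point (tangential (chart_map c q))" if "q \<in> B" for q
      using that \<open>c \<in> A\<close> \<open>B \<subseteq> chart_dom c\<close> \<open>B \<subseteq> mfd_boundary A\<close> mfd_boundary_iff[of c q]
      by (subst boundary_point_tangential) auto
    then have "boundary_point y \<in> chart_map c ` B \<longleftrightarrow> y \<in> (\<lambda>q. tangential (chart_map c q)) ` B"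
      by (metis (no_types, lifting) image_iff tangential_boundary_point)
    then show "indicator (chart_map c ` B) (boundary_point y) = (indicator ((\<lambda>q. tangential (chart_map c q)) ` B) y :: ennreal)"
      by (simp add: indicator_def)
  qed
  moreover have "B \<subseteq> mfd_boundary A" if "B \<in> sets (restrict_space borel (mfd_boundary A))" for B
    using sets.sets_into_space[OF that] by (simp add: space_restrict_space)
  ultimately have "(sets \<mu> = sets (restrict_space borel (mfd_boundary A)) \<and>
     (\<forall>c\<in>A. \<forall>B\<in>sets (restrict_space borel (mfd_boundary A)). B \<subseteq> chart_dom c \<longrightarrow>
        emeasure \<mu> B =
          (\<integral>\<^sup>+y. ennreal (sqrt (det (boundary_metric g c (chart_inv c (boundary_point y)))))
             * indicator (chart_map c ` B) (boundary_point y) \<partial>lborel))) \<longleftrightarrow> bnd.is_glued \<mu>" for \<mu>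
    unfolding bnd.is_glued_def by (intro conj_cong ball_cong refl) auto
  then show ?thesis
    unfolding boundary_measure_def using theI'[OF bnd.glued_ex1] by simp
qed

lemma sets_boundary_measure: "sets (boundary_measure A g) = sets (restrict_space borel (mfd_boundary A))"
  using boundary_measure_glued by (simp add: bnd.is_glued_def)

end

section \<open>Gradients, curves and functions supported in a chart\<close>

context smooth_mfd begin

lemma chart_change_has_derivative:
  assumes c: "c \<in> A" and d: "d \<in> A" and q: "q \<in> chart_dom c" "q \<in> chart_dom d"
    and D: "(f \<circ> chart_inv c has_derivative D) (at (chart_map c q) within half_space)"
  shows "(f \<circ> chart_inv d has_derivative (\<lambda>v. D (transition_jacobian d c q *v v))) (at (chart_map d q) within half_space)"
proof -
  let ?W = "chart_map d ` (chart_dom d \<inter> chart_dom c)" and ?T = "chart_map c \<circ> chart_inv d"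
  obtain V where V: "open V" "?W = V \<inter> half_space"
    using chart_image_open[OF d chart(1)[OF c]] .
  have qW: "chart_map d q \<in> ?W" using q by blast
  have T: "(?T has_derivative (\<lambda>v. transition_jacobian d c q *v v)) (at (chart_map d q) within ?W)"
    by (rule has_derivative_subset[OF transition_has_derivative[OF d c q(2,1)]]) (use V in auto)
  have TW: "?T ` ?W \<subseteq> half_space"
    using d chart_map_half_space[OF c] by auto
  have Tq: "?T (chart_map d q) = chart_map c q" using d q by simp
  have "(f \<circ> chart_inv c has_derivative D) (at (?T (chart_map d q)) within ?T ` ?W)"
    unfolding Tq by (rule has_derivative_subset[OF D TW])
  then have "((f \<circ> chart_inv c) \<circ> ?T has_derivative D \<circ> (\<lambda>v. transition_jacobian d c q *v v)) (at (chart_map d q) within ?W)"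
    by (rule diff_chain_within[OF T])
  then have "(f \<circ> chart_inv d has_derivative D \<circ> (\<lambda>v. transition_jacobian d c q *v v)) (at (chart_map d q) within ?W)"
    by (rule has_derivative_transform_within[OF _ zero_less_one qW]) (use c d in auto)
  \<comment> \<open>The coordinate image of the overlap is the trace of an open set on the
    half-space, so both sets give the same limits at this point.\<close>
  moreover have "at (chart_map d q) within ?W = at (chart_map d q) within half_space"
    by (rule at_within_nhd[of _ V]) (use V qW in auto)
  ultimately show ?thesis
    by (simp add: o_def)
qed

text \<open>The coordinate gradient is the component vector of a covector, hence it transforms by
  the transposed Jacobian.\<close>

lemma chart_gradient_change:
  assumes c: "c \<in> A" and d: "d \<in> A" and q: "q \<in> chart_dom c" "q \<in> chart_dom d"
    and D: "(f \<circ> chart_inv c) differentiable (at (chart_map c q) within half_space)"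
  shows "chart_gradient d f q = transpose (transition_jacobian d c q) *v chart_gradient c f q"
proof -
  let ?D = "frechet_derivative (f \<circ> chart_inv c) (at (chart_map c q) within half_space)"
  have D': "(f \<circ> chart_inv c has_derivative ?D) (at (chart_map c q) within half_space)"
    using D frechet_derivative_works by blast
  have grad: "?D v = chart_gradient c f q \<bullet> v" for v
  proof -
    have lin: "linear ?D" using D' by (rule has_derivative_linear)
    have "?D v = ?D (\<Sum>i\<in>UNIV. v $ i *\<^sub>R axis i 1)"
      using basis_expansion[of v] by (simp add: scalar_mult_eq_scaleR)
    also have "\<dots> = chart_gradient c f q \<bullet> v"
      by (simp add: linear_sum[OF lin] linear_cmul[OF lin] chart_gradient_def inner_vec_def mult.commute)
    finally show ?thesis .
  qed
  have "frechet_derivative (f \<circ> chart_inv d) (at (chart_map d q) within half_space) =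
      (\<lambda>v. ?D (transition_jacobian d c q *v v))"
    by (rule frechet_derivative_half_space[OF chart_map_half_space[OF d q(2)] chart_change_has_derivative[OF c d q D']])
  then have "chart_gradient d f q $ i = chart_gradient c f q \<bullet> (transition_jacobian d c q *v axis i 1)" for i
    by (simp add: chart_gradient_def[of d] grad)
  then show ?thesis
    by (simp add: vec_eq_iff inner_transpose[symmetric] inner_axis)
qed

end

context mfd_metric begin

text \<open>The definition evaluates in an unspecified chart. The rules for gradient and metric
  cancel, so any chart in which differentiability is known may be used.\<close>

lemma differential_norm2_chart:
  assumes c: "c \<in> A" and q: "q \<in> chart_dom c"
    and D: "(f \<circ> chart_inv c) differentiable (at (chart_map c q) within half_space)"
  shows "differential_norm2 A g f q = chart_gradient c f q \<bullet> (matrix_inv (g c q) *v chart_gradient c f q)"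
  unfolding differential_norm2_def Let_def
    chart_gradient_change[OF c chart_at(1) q chart_at(2) D]
  by (rule inner_inverse_congruence[OF metric_transform[OF chart_at(1) c chart_at(2) q]
        metric_posdef[OF chart_at] metric_posdef[OF c q]])

lemma differential_norm2_nonneg: "0 \<le> differential_norm2 A g f q"
  unfolding differential_norm2_def Let_def by (rule posdef_inverse_nonneg[OF metric_posdef[OF chart_at]])

section \<open>Speed, length and distance\<close>

lemma speed_nonneg: "0 \<le> speed A g \<gamma> t"
  unfolding speed_def Let_def using posdef_nonneg[OF metric_posdef[OF chart_at]] by simp

lemma curve_length_nonneg: "0 \<le> curve_length A g \<gamma>"
  unfolding curve_length_def
  by (cases "speed A g \<gamma> integrable_on {0..1}")
    (auto intro: Henstock_Kurzweil_Integration.integral_nonneg speed_nonneg simp: not_integrable_integral)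

lemma riem_dist_le_curve_length:
  assumes "piecewise_C1_curve A \<gamma>"
  shows "riem_dist A g (\<gamma> 0) (\<gamma> 1) \<le> curve_length A g \<gamma>"
  unfolding riem_dist_def
  by (rule cInf_lower) (use assms curve_length_nonneg in \<open>auto intro!: bdd_belowI[of _ 0]\<close>)

text \<open>For a non-integrable speed the integral has default value 0, and \<open>L\<close> is
  nonnegative as it bounds a nonnegative speed. A pointwise speed bound therefore suffices in both
  cases.\<close>

lemma curve_length_le:
  assumes "\<And>t. t \<in> {0..1} \<Longrightarrow> speed A g \<gamma> t \<le> L"
  shows "curve_length A g \<gamma> \<le> L"
proof (cases "speed A g \<gamma> integrable_on {0..1}")
  case True
  then show ?thesis
    unfolding curve_length_def using integral_le[OF True integrable_const_ivl[of L 0 1]] assms by auto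
next
  case False
  have "0 \<le> L" using order_trans[OF speed_nonneg assms[of 0]] by simp
  with False show ?thesis
    by (simp add: curve_length_def not_integrable_integral)
qed

end

context smooth_mfd begin

text \<open>The curve is straight in chart \<open>c\<close>; near \<open>t\<close>, chart
  \<open>d\<close> sees it as a smooth extension composed with an affine map. The set
  \<open>T\<close> is left free to serve both subintervals, for the C1 condition, and the whole unit
  interval, for the speed.\<close>

lemma segment_curve_has_vector_derivative:
  fixes x w :: "real ^ 'n option" and c :: "('a, 'n) chart"
  defines "\<gamma> \<equiv> \<lambda>t. chart_inv c (x + t *\<^sub>R w)"
  assumes c: "c \<in> A" and d: "d \<in> A"
    and seg: "\<And>s. s \<in> {0..1} \<Longrightarrow> x + s *\<^sub>R w \<in> chart_img c"
    and t: "t \<in> T" "T \<subseteq> {0..1}" "\<gamma> t \<in> chart_dom d"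
  shows "((\<lambda>s. chart_map d (\<gamma> s)) has_vector_derivative transition_jacobian c d (\<gamma> t) *v w) (at t within T)"
    and "continuous (at t within {s \<in> T. \<gamma> s \<in> chart_dom d}) (\<lambda>s. transition_jacobian c d (\<gamma> s) *v w)"
proof -
  let ?z = "\<lambda>s. x + s *\<^sub>R w"
  have zt: "?z t \<in> chart_img c" using seg t by auto
  have \<gamma>t: "\<gamma> t \<in> chart_dom c" "chart_map c (\<gamma> t) = ?z t"
    using zt c by (simp_all add: \<gamma>_def chart_inv_in)
  obtain U F where U: "open U" "?z t \<in> U" "\<And>k. Ck_on k U F"
    "\<And>y. y \<in> U \<inter> half_space \<Longrightarrow> y \<in> chart_img c \<and> chart_inv c y \<in> chart_dom d \<and> F y = chart_map d (chart_inv c y)"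
    using transition_extension[OF c d \<gamma>t(1) t(3)] unfolding \<gamma>t(2) by metis
  have hs: "?z s \<in> half_space" if "s \<in> {0..1}" for s
    using seg[OF that] chart(6)[OF c] by blast
  have "open (?z -` U)"
    using U(1) by (auto intro!: open_vimage continuous_intros)
  then obtain e where e: "0 < e" "ball t e \<subseteq> ?z -` U"
    using U(2) by (metis open_contains_ball vimageI)
  have F': "(F has_derivative (\<lambda>v. transition_jacobian c d (\<gamma> s) *v v)) (at (?z s))" if "s \<in> {0..1}" "?z s \<in> U" for s
    using transition_extension_has_derivative[OF c d U(1,3,4) that(2) hs[OF that(1)]] by (simp add: \<gamma>_def)
  have "(?z has_derivative (\<lambda>s. s *\<^sub>R w)) (at t)"
    by (auto intro!: derivative_eq_intros)
  then have "(F \<circ> ?z has_derivative (\<lambda>v. transition_jacobian c d (\<gamma> t) *v v) \<circ> (\<lambda>s. s *\<^sub>R w)) (at t)"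
    by (rule diff_chain_at) (use F' t U(2) in auto)
  then have "(F \<circ> ?z has_vector_derivative transition_jacobian c d (\<gamma> t) *v w) (at t within T)"
    by (auto simp: has_vector_derivative_def o_def matrix_vector_mult_scaleR intro: has_derivative_at_withinI)
  then show "((\<lambda>s. chart_map d (\<gamma> s)) has_vector_derivative transition_jacobian c d (\<gamma> t) *v w) (at t within T)"
  proof (rule has_vector_derivative_transform_within[OF _ e(1) t(1)])
    fix s assume s: "s \<in> T" "dist s t < e"
    then have "?z s \<in> U \<inter> half_space"
      using e(2) hs t(2) by (auto simp: dist_commute subset_iff)
    then show "(F \<circ> ?z) s = chart_map d (\<gamma> s)"
      using U(4) by (simp add: \<gamma>_def)
  qed
  have "continuous_on U (\<lambda>y. frechet_derivative F (at y) w)"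
    using U(3)[of 1] by simp
  then have "isCont (\<lambda>y. frechet_derivative F (at y) w) (?z t)"
    using U(1,2) by (simp add: continuous_on_eq_continuous_at)
  moreover have "isCont ?z t"
    by (intro continuous_intros)
  ultimately have "isCont (\<lambda>s. frechet_derivative F (at (?z s)) w) t"
    by (rule isCont_o2[rotated])
  then have "continuous (at t within {s \<in> T. \<gamma> s \<in> chart_dom d}) (\<lambda>s. frechet_derivative F (at (?z s)) w)"
    by (rule continuous_at_imp_continuous_at_within)
  then show "continuous (at t within {s \<in> T. \<gamma> s \<in> chart_dom d}) (\<lambda>s. transition_jacobian c d (\<gamma> s) *v w)"
  proof (rule continuous_transform_within[OF _ e(1)])
    fix s assume s: "s \<in> {s \<in> T. \<gamma> s \<in> chart_dom d}" "dist s t < e"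
    then have "?z s \<in> U" "s \<in> {0..1}"
      using e(2) t(2) by (auto simp: dist_commute subset_iff)
    from frechet_derivative_at[OF F'[OF this(2,1)]]
    show "frechet_derivative F (at (?z s)) w = transition_jacobian c d (\<gamma> s) *v w"
      by metis
  qed (use t in auto)
qed

lemma segment_curve_piecewise_C1:
  fixes x w :: "real ^ 'n option"
  assumes c: "c \<in> A" and seg: "\<And>s. s \<in> {0..1} \<Longrightarrow> x + s *\<^sub>R w \<in> chart_img c"
  shows "piecewise_C1_curve A (\<lambda>t. chart_inv c (x + t *\<^sub>R w))"
proof -
  let ?\<gamma> = "\<lambda>t. chart_inv c (x + t *\<^sub>R w)"
  have cont: "continuous_on {0..1} ?\<gamma>"
    by (rule continuous_on_compose2[OF chart(5)[OF c]]) (use seg in \<open>auto intro!: continuous_intros\<close>)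
  have "C1_curve_on A a b ?\<gamma>" if "0 \<le> a" "a < b" "b \<le> 1" for a b
    unfolding C1_curve_on_def
  proof (intro conjI ballI)
    have sub: "{a..b} \<subseteq> {0..1}" using that by auto
    show "continuous_on {a..b} ?\<gamma>" using cont sub by (rule continuous_on_subset)
    fix d assume d: "d \<in> A"
    show "\<exists>v. continuous_on {t \<in> {a..b}. ?\<gamma> t \<in> chart_dom d} v \<and>
        (\<forall>t\<in>{a..b}. ?\<gamma> t \<in> chart_dom d \<longrightarrow>
           ((\<lambda>s. chart_map d (?\<gamma> s)) has_vector_derivative v t) (at t within {a..b}))"
    proof (intro exI[of _ "\<lambda>t. transition_jacobian c d (?\<gamma> t) *v w"] conjI ballI impI)
      show "continuous_on {t \<in> {a..b}. ?\<gamma> t \<in> chart_dom d} (\<lambda>t. transition_jacobian c d (?\<gamma> t) *v w)"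
        unfolding continuous_on_eq_continuous_within
        using segment_curve_has_vector_derivative(2)[OF c d seg, of _ "{a..b}"] sub by auto
      show "((\<lambda>s. chart_map d (?\<gamma> s)) has_vector_derivative transition_jacobian c d (?\<gamma> t) *v w) (at t within {a..b})"
        if "t \<in> {a..b}" "?\<gamma> t \<in> chart_dom d" for t
        using segment_curve_has_vector_derivative(1)[OF c d seg that(1) sub that(2)] .
    qed
  qed
  with cont show ?thesis
    unfolding piecewise_C1_curve_def by (intro conjI exI[of _ "{}"]) auto
qed

end

context mfd_metric begin

text \<open>The speed is computed in whichever chart \<open>chart_at\<close> selects; congruence of
  the metrics brings it back to chart \<open>c\<close>, where the velocity is constantly
  \<open>w\<close>.\<close>

lemma riem_dist_segment_le:
  assumes c: "c \<in> A" and seg: "\<And>s. s \<in> {0..1} \<Longrightarrow> x + s *\<^sub>R w \<in> chart_img c"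
    and upper: "\<And>s. s \<in> {0..1} \<Longrightarrow> w \<bullet> (g c (chart_inv c (x + s *\<^sub>R w)) *v w) \<le> u * (norm w)\<^sup>2"
  shows "riem_dist A g (chart_inv c x) (chart_inv c (x + w)) \<le> sqrt u * norm w"
proof -
  let ?\<gamma> = "\<lambda>t. chart_inv c (x + t *\<^sub>R w)"
  have "speed A g ?\<gamma> t \<le> sqrt u * norm w" if t: "t \<in> {0..1}" for t
  proof -
    let ?d = "chart_at A (?\<gamma> t)"
    have "((\<lambda>s. chart_map ?d (?\<gamma> s)) has_vector_derivative transition_jacobian c ?d (?\<gamma> t) *v w) (at t within {0..1})"
      using segment_curve_has_vector_derivative(1)[OF c chart_at(1) seg t order_refl chart_at(2)] .
    then have vd: "vector_derivative (\<lambda>s. chart_map ?d (?\<gamma> s)) (at t within {0..1}) = transition_jacobian c ?d (?\<gamma> t) *v w"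
      using t by (intro vector_derivative_within_cbox[of 0 1, unfolded cbox_interval]) auto
    have "speed A g ?\<gamma> t = sqrt (w \<bullet> (g c (?\<gamma> t) *v w))"
      unfolding speed_def Let_def vd
      using inner_matrix_congruence[OF metric_transform[OF c chart_at(1) chart_inv_in[OF c seg[OF t]] chart_at(2)]]
      by simp
    also have "\<dots> \<le> sqrt (u * (norm w)\<^sup>2)"
      using upper[OF t] by simp
    finally show ?thesis
      by (simp add: real_sqrt_mult)
  qed
  then have "curve_length A g ?\<gamma> \<le> sqrt u * norm w"
    by (rule curve_length_le)
  with riem_dist_le_curve_length[OF segment_curve_piecewise_C1[OF c seg]] show ?thesis
    by simp
qed

text \<open>A half-ball is convex, so straight segments join its points to the centre, and an upper
  bound on the metric over a compact half-ball bounds their length.\<close>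

lemma chart_ball_in_riem_ball:
  assumes c: "c \<in> A" and p: "p \<in> chart_dom c" and "0 < \<epsilon>"
  obtains R where "0 < R" "cball (chart_map c p) R \<inter> half_space \<subseteq> chart_img c"
    "\<And>x. x \<in> cball (chart_map c p) R \<inter> half_space \<Longrightarrow> chart_inv c x \<in> riem_ball A g p \<epsilon>"
proof -
  let ?x = "chart_map c p"
  obtain V where V: "open V" "chart_img c = V \<inter> half_space"
    using chart_img_open[OF c] .
  have "?x \<in> V" using V chart_map_in[OF p] by auto
  then obtain r where r: "0 < r" "cball ?x r \<subseteq> V"
    using V(1) open_contains_cball by blast
  let ?K = "cball ?x r \<inter> half_space"
  have K: "compact ?K" "?K \<subseteq> chart_img c"
    using r V by (auto simp: closed_half_space)
  have "continuous_on ?K (\<lambda>x. g c (chart_inv c x))"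
    using continuous_on_subset[OF metric_continuous[OF c] K(2)] by (simp add: o_def)
  moreover have "posdef (g c (chart_inv c x))" if "x \<in> ?K" for x
    using metric_posdef[OF c chart_inv_in[OF c]] K(2) that by blast
  ultimately obtain l u where u: "0 < u" "\<And>x v. x \<in> ?K \<Longrightarrow> v \<bullet> (g c (chart_inv c x) *v v) \<le> u * (norm v)\<^sup>2"
    using posdef_uniform_bounds[OF K(1), of "\<lambda>x. g c (chart_inv c x)"] by metis
  \<comment> \<open>Segments of Euclidean length at most R have length at most \<epsilon> / 2; the
    factor 2 gives a strict inequality on the closed ball.\<close>
  define R where "R = min r (\<epsilon> / (2 * sqrt u))"
  show ?thesis
  proof (rule that[of R])
    show "0 < R" using r u assms by (simp add: R_def)
    have sub: "cball ?x R \<inter> half_space \<subseteq> ?K" by (auto simp: R_def)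
    then show "cball ?x R \<inter> half_space \<subseteq> chart_img c" using K by blast
    fix y assume y: "y \<in> cball ?x R \<inter> half_space"
    let ?w = "y - ?x"
    have seg: "?x + s *\<^sub>R ?w \<in> cball ?x R \<inter> half_space" if "s \<in> {0..1}" for s
    proof -
      have "convex (cball ?x R \<inter> half_space)"
        by (intro convex_Int convex_cball convex_half_space)
      moreover have "?x \<in> cball ?x R \<inter> half_space"
        using \<open>0 < R\<close> chart_map_half_space[OF c p] by simp
      ultimately have "(1 - s) *\<^sub>R ?x + s *\<^sub>R y \<in> cball ?x R \<inter> half_space"
        using y that by (intro convexD_alt) auto
      then show ?thesis by (simp add: algebra_simps)
    qed
    have "riem_dist A g (chart_inv c ?x) (chart_inv c (?x + ?w)) \<le> sqrt u * norm ?w"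
      by (rule riem_dist_segment_le[OF c]) (use seg sub K u in blast)+
    also have "\<dots> \<le> sqrt u * (\<epsilon> / (2 * sqrt u))"
      using y u(1) by (intro mult_left_mono) (auto simp: R_def dist_norm norm_minus_commute)
    also have "\<dots> < \<epsilon>"
      using u(1) assms by simp
    finally show "chart_inv c y \<in> riem_ball A g p \<epsilon>"
      using c p by (simp add: riem_ball_def)
  qed
qed

end

section \<open>Functions constant outside a coordinate ball\<close>

definition lift_chart :: "('a, 'n::finite) chart \<Rightarrow> real \<Rightarrow> (real ^ 'n option \<Rightarrow> real) \<Rightarrow> 'a \<Rightarrow> real" where
  "lift_chart c a \<Phi> q = (if q \<in> chart_dom c then \<Phi> (chart_map c q) else a)"

context smooth_mfd begin

lemma compact_chart_inv_image:
  assumes "c \<in> A" "cball z r \<inter> half_space \<subseteq> chart_img c"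
  shows "compact (chart_inv c ` (cball z r \<inter> half_space))"
  by (intro compact_continuous_image continuous_on_subset[OF chart(5)[OF assms(1)] assms(2)]
      compact_Int_closed compact_cball closed_half_space)

lemma lift_chart_outside:
  assumes "c \<in> A" "\<And>x. x \<notin> cball z r \<Longrightarrow> \<Phi> x = a" "q \<notin> chart_inv c ` (cball z r \<inter> half_space)"
  shows "lift_chart c a \<Phi> q = a"
proof (cases "q \<in> chart_dom c")
  case True
  then have "chart_map c q \<notin> cball z r"
    using assms(1,3) chart_map_half_space[OF assms(1) True] by (metis Int_iff chart_inv_map image_eqI)
  then show ?thesis using assms(2) True by (simp add: lift_chart_def)
qed (simp add: lift_chart_def)

text \<open>A point outside the chart domain lies off the image of the closed half-ball, which is
  compact, hence closed in a Hausdorff space; so the function is constant near that point. The value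
  \<open>a\<close> is 0 for test functions and 1 for conformal factors.\<close>

lemma lift_chart_smooth:
  assumes c: "c \<in> A" and img: "cball z r \<inter> half_space \<subseteq> chart_img c"
    and \<Phi>: "\<And>k. Ck_on k UNIV \<Phi>" "\<And>x. x \<notin> cball z r \<Longrightarrow> \<Phi> x = a"
  shows "lift_chart c a \<Phi> \<in> smooth_functions A"
  unfolding smooth_functions_def smooth_in_def
proof (intro CollectI ballI)
  fix d y assume d: "d \<in> A" and y: "y \<in> chart_img d"
  let ?q = "chart_inv d y" and ?K = "chart_inv c ` (cball z r \<inter> half_space)" and ?f = "lift_chart c a \<Phi> \<circ> chart_inv d"
  have qd: "?q \<in> chart_dom d" using chart_inv_in[OF d y] .
  show "\<exists>U F. open U \<and> y \<in> U \<and> (\<forall>k. Ck_on k U F) \<and> (\<forall>x\<in>chart_img d \<inter> U. F x = ?f x)"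
  proof (cases "?q \<in> chart_dom c")
    case True
    obtain U F where U: "open U" "chart_map d ?q \<in> U" "\<And>k. Ck_on k U F"
      "\<And>y. y \<in> U \<inter> half_space \<Longrightarrow> y \<in> chart_img d \<and> chart_inv d y \<in> chart_dom c \<and> F y = chart_map c (chart_inv d y)"
      using transition_extension[OF d c qd True] by metis
    have "Ck_on k U (\<lambda>x. \<Phi> (F x))" for k
      by (rule Ck_on_compose[OF U(1) open_UNIV _ \<Phi>(1) U(3)]) simp
    moreover have "\<forall>x\<in>chart_img d \<inter> U. \<Phi> (F x) = ?f x"
      using U(4) chart(6)[OF d] by (auto simp: lift_chart_def)
    ultimately show ?thesis
      using U(1,2) d y by (intro exI[of _ U] exI[of _ "\<lambda>x. \<Phi> (F x)"]) auto
  next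
    case False
    have "?K \<subseteq> chart_dom c" using img chart_inv_in[OF c] by blast
    then have qK: "?q \<in> - ?K" using False by blast
    have "open (- ?K)"
      using compact_chart_inv_image[OF c img] compact_imp_closed by blast
    then obtain V where V: "open V" "chart_map d ` (chart_dom d \<inter> - ?K) = V \<inter> half_space"
      using chart_image_open[OF d] by metis
    have "chart_map d ?q \<in> V"
      using V(2) qK qd by blast
    then have "y \<in> V" using d y by simp
    moreover have "\<forall>x\<in>chart_img d \<inter> V. a = ?f x"
    proof
      fix x assume x: "x \<in> chart_img d \<inter> V"
      then have "x \<in> chart_map d ` (chart_dom d \<inter> - ?K)"
        using V(2) chart(6)[OF d] by blast
      then have "chart_inv d x \<notin> ?K" using d by auto
      then show "a = ?f x"
        using lift_chart_outside[OF c \<Phi>(2)] by simp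
    qed
    ultimately show ?thesis
      using V(1) by (intro exI[of _ V] exI[of _ "\<lambda>x. a"]) (auto intro: Ck_on_const)
  qed
qed

lemma smooth_functions_continuous_chart:
  "f \<in> smooth_functions A \<Longrightarrow> c \<in> A \<Longrightarrow> continuous_on (chart_img c) (f \<circ> chart_inv c)"
  unfolding smooth_functions_def by (blast intro: smooth_in_continuous_on)

lemma smooth_functions_continuous:
  assumes f: "f \<in> smooth_functions A"
  shows "continuous_on UNIV f"
proof -
  have "isCont f q" for q
  proof -
    let ?c = "chart_at A q"
    have "continuous_on (chart_dom ?c) ((f \<circ> chart_inv ?c) \<circ> chart_map ?c)"
      by (rule continuous_on_compose[OF chart(4)[OF chart_at(1)]])
        (use smooth_functions_continuous_chart[OF f chart_at(1)] in \<open>simp add: chart_img_def\<close>)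
    then have "continuous_on (chart_dom ?c) f"
      by (rule continuous_on_eq) (simp add: chart_at)
    then show ?thesis
      using chart(1)[OF chart_at(1)] chart_at(2) by (metis continuous_on_eq_continuous_at)
  qed
  then show "continuous_on UNIV f"
    by (simp add: continuous_on_eq_continuous_at)
qed

end

section \<open>Energy and boundary norm under conformal changes\<close>

lemma det_scaleR: "det (r *\<^sub>R M) = r ^ CARD('n) * det M" for M :: "real^'n^'n"
proof -
  have "r *\<^sub>R M = (\<chi> i. r *s M $ i)"
    by (simp add: vec_eq_iff)
  then show ?thesis
    using det_rows_mul[of "\<lambda>i. r" "\<lambda>i. M $ i"] by simp
qed

lemma sum_square_orthogonal:
  fixes x :: "'i \<Rightarrow> real"
  assumes "finite I" "\<And>i j. i \<in> I \<Longrightarrow> j \<in> I \<Longrightarrow> i \<noteq> j \<Longrightarrow> x i * x j = 0"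
  shows "(\<Sum>i\<in>I. x i)\<^sup>2 = (\<Sum>i\<in>I. (x i)\<^sup>2)"
proof -
  have "(\<Sum>j\<in>I. x i * x j) = (x i)\<^sup>2" if "i \<in> I" for i
    using assms that by (subst sum.mono_neutral_right[of I "{i}"]) (auto simp: power2_eq_square)
  then show ?thesis
    by (simp add: power2_eq_square sum_product)
qed

text \<open>Meant for energy densities \<open>f\<close>, about which only a pointwise bound is
  known. If \<open>f\<close> is not integrable its Bochner integral is 0, still below that of the
  nonnegative majorant \<open>F\<close>.\<close>

lemma integral_le_of_nn_integral_bound:
  fixes f F :: "'a \<Rightarrow> real"
  assumes F: "F \<in> borel_measurable M" "\<And>x. x \<in> space M \<Longrightarrow> 0 \<le> F x" "\<And>x. x \<in> space M \<Longrightarrow> f x \<le> F x"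
    and r: "(\<integral>\<^sup>+x. ennreal (F x) \<partial>M) \<le> ennreal r" "0 \<le> r"
  shows "(\<integral>x. f x \<partial>M) \<le> r"
proof -
  have int: "integrable M F"
  proof (rule integrableI_bounded[OF F(1)])
    have "(\<integral>\<^sup>+x. ennreal (norm (F x)) \<partial>M) = (\<integral>\<^sup>+x. ennreal (F x) \<partial>M)"
      by (intro nn_integral_cong) (simp add: F(2))
    then show "(\<integral>\<^sup>+x. ennreal (norm (F x)) \<partial>M) < \<infinity>"
      using r(1) by (metis ennreal_less_top le_less_trans infinity_ennreal_def)
  qed
  have "(\<integral>x. f x \<partial>M) \<le> (\<integral>x. F x \<partial>M)"
    using int F(3,2) by (rule integral_mono')
  moreover have "ennreal (\<integral>x. F x \<partial>M) \<le> ennreal r"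
    using r(1) nn_integral_eq_integral[OF int] F(2) by simp
  ultimately show ?thesis
    using r(2) by (simp add: ennreal_le_iff)
qed

context smooth_mfd begin

lemma lift_chart_has_derivative:
  assumes c: "c \<in> A" and q: "q \<in> chart_dom c" and \<Psi>: "\<And>k. Ck_on k UNIV \<Psi>"
  shows "(lift_chart c a \<Psi> \<circ> chart_inv c has_derivative frechet_derivative \<Psi> (at (chart_map c q)))
    (at (chart_map c q) within half_space)"
proof -
  obtain V where V: "open V" "chart_img c = V \<inter> half_space"
    using chart_img_open[OF c] .
  show ?thesis
  proof (rule has_derivative_half_space_local[OF _ V(1)])
    show "(\<Psi> has_derivative frechet_derivative \<Psi> (at (chart_map c q))) (at (chart_map c q))"
      using Ck_on_Suc_has_derivative[OF \<Psi>] by simp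
    show "chart_map c q \<in> V" "chart_map c q \<in> half_space"
      using chart_map_in[OF q] V(2) by auto
    fix y assume "y \<in> V \<inter> half_space"
    then show "\<Psi> y = (lift_chart c a \<Psi> \<circ> chart_inv c) y"
      using V(2) c by (simp add: lift_chart_def chart_inv_in)
  qed
qed

lemma chart_gradient_lift_chart:
  assumes c: "c \<in> A" and q: "q \<in> chart_dom c" and \<Psi>: "\<And>k. Ck_on k UNIV \<Psi>"
  shows "chart_gradient c (lift_chart c a \<Psi>) q = (\<chi> i. frechet_derivative \<Psi> (at (chart_map c q)) (axis i 1))"
  unfolding chart_gradient_def
    frechet_derivative_half_space[OF chart_map_half_space[OF c q] lift_chart_has_derivative[OF c q \<Psi>]] ..

lemma differential_norm2_vanishing:
  assumes "open W" "q \<in> W" "\<And>p. p \<in> W \<Longrightarrow> f p = 0"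
  shows "differential_norm2 A g f q = 0"
proof -
  let ?d = "chart_at A q"
  obtain V where V: "open V" "chart_map ?d ` (chart_dom ?d \<inter> W) = V \<inter> half_space"
    using chart_image_open[OF chart_at(1) assms(1)] .
  have qV: "chart_map ?d q \<in> V \<inter> half_space"
    using V(2) chart_at(2) assms(2) by blast
  have "(f \<circ> chart_inv ?d has_derivative (\<lambda>v. 0)) (at (chart_map ?d q) within half_space)"
  proof (rule has_derivative_half_space_local[OF _ V(1)])
    fix y assume "y \<in> V \<inter> half_space"
    then obtain p where "p \<in> chart_dom ?d" "p \<in> W" "y = chart_map ?d p"
      using V(2) by blast
    then show "0 = (f \<circ> chart_inv ?d) y"
      using assms(3) by (simp add: chart_at)
  qed (use qV in auto)
  then have "frechet_derivative (f \<circ> chart_inv ?d) (at (chart_map ?d q) within half_space) = (\<lambda>v. 0)"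
    using qV by (intro frechet_derivative_half_space) auto
  then have "chart_gradient ?d f q = 0"
    by (simp add: chart_gradient_def vec_eq_iff)
  then show ?thesis
    by (simp add: differential_norm2_def)
qed

end

context compact_mfd_metric begin

text \<open>It makes everything proved for \<open>g\<close>, including existence of the measures,
  available for the deformed metric.\<close>

lemma compact_mfd_metric_conformal:
  assumes h: "h \<in> smooth_functions A" "\<And>q. 0 < h q"
  shows "compact_mfd_metric A (conformal h g)"
proof
  show "compact (UNIV :: 'a set)" by (rule compact_UNIV)
  show "mfd_boundary A \<noteq> {}" by (rule boundary_nonempty)
  fix c assume c: "c \<in> A"
  show "continuous_on (chart_img c) (conformal h g c \<circ> chart_inv c)"
    using smooth_functions_continuous_chart[OF h(1) c] metric_continuous[OF c]
    unfolding conformal_def o_def by (intro continuous_intros)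
  fix q assume q: "q \<in> chart_dom c"
  show "posdef (conformal h g c q)"
    using metric_posdef[OF c q] h(2)[of q]
    by (simp add: posdef_def conformal_def scaleR_matrix_vector_assoc[symmetric])
  fix d assume "d \<in> A" "q \<in> chart_dom d"
  then show "conformal h g c q = transpose (transition_jacobian c d q) ** conformal h g d q ** transition_jacobian c d q"
    using metric_transform[OF c _ q]
    by (simp add: conformal_def scalar_matrix_assoc matrix_scalar_ac matrix_mul_assoc)
qed

text \<open>Where h = 1 the boundary densities coincide, so the two definite descriptions have the
  same defining predicate.\<close>

lemma boundary_measure_conformal:
  assumes "\<And>q. q \<in> mfd_boundary A \<Longrightarrow> h q = 1"
  shows "boundary_measure A (conformal h g) = boundary_measure A g"
proof -
  have "(\<integral>\<^sup>+y. ennreal (sqrt (det (boundary_metric (conformal h g) c (chart_inv c (boundary_point y)))))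
             * indicator (chart_map c ` B) (boundary_point y) \<partial>lborel) =
    (\<integral>\<^sup>+y. ennreal (sqrt (det (boundary_metric g c (chart_inv c (boundary_point y)))))
             * indicator (chart_map c ` B) (boundary_point y) \<partial>lborel)"
    if "c \<in> A" "B \<subseteq> chart_dom c" "B \<subseteq> mfd_boundary A" for c B
  proof (intro nn_integral_cong)
    fix y
    have "h (chart_inv c (boundary_point y)) = 1" if y: "boundary_point y \<in> chart_map c ` B"
    proof -
      from y obtain q where "q \<in> B" "boundary_point y = chart_map c q" by blast
      then show ?thesis
        using assms \<open>c \<in> A\<close> \<open>B \<subseteq> chart_dom c\<close> \<open>B \<subseteq> mfd_boundary A\<close> by (auto simp: subset_iff)
    qed
    then show "ennreal (sqrt (det (boundary_metric (conformal h g) c (chart_inv c (boundary_point y)))))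
             * indicator (chart_map c ` B) (boundary_point y) =
      ennreal (sqrt (det (boundary_metric g c (chart_inv c (boundary_point y)))))
             * indicator (chart_map c ` B) (boundary_point y)"
      by (cases "boundary_point y \<in> chart_map c ` B") (simp_all add: boundary_metric_def conformal_def)
  qed
  moreover have "B \<subseteq> mfd_boundary A" if "B \<in> sets (restrict_space borel (mfd_boundary A))" for B
    using sets.sets_into_space[OF that] by (simp add: space_restrict_space)
  ultimately show ?thesis
    unfolding boundary_measure_def
    by (intro arg_cong[where f = The] ext conj_cong ball_cong refl) simp
qed

text \<open>On the half-ball the deformed metric is bounded below by \<open>l\<close> times the
  squared factor, and inversion puts this into the denominator. Off the half-ball the function
  vanishes on an open set.\<close>

lemma differential_norm2_conformal_le:
  assumes c: "c \<in> A" and img: "cball z r \<inter> half_space \<subseteq> chart_img c"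
    and h: "h \<in> smooth_functions A" "\<And>q. 0 < h q"
    and l: "0 < l" "\<And>x v. x \<in> cball z r \<inter> half_space \<Longrightarrow> l * (norm v)\<^sup>2 \<le> v \<bullet> (g c (chart_inv c x) *v v)"
    and \<Psi>: "\<And>k. Ck_on k UNIV \<Psi>" "\<And>x. x \<notin> cball z r \<Longrightarrow> \<Psi> x = 0"
    and C: "\<And>x. x \<in> cball z r \<Longrightarrow> (norm (\<chi> i. frechet_derivative \<Psi> (at x) (axis i 1)))\<^sup>2 \<le> C"
  shows "differential_norm2 A (conformal h g) (lift_chart c 0 \<Psi>) q \<le>
    indicator (chart_inv c ` (cball z r \<inter> half_space)) q * (C / (l * (h q)\<^sup>2))"
proof -
  interpret G: compact_mfd_metric A "conformal h g"
    using h by (rule compact_mfd_metric_conformal)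
  let ?K = "chart_inv c ` (cball z r \<inter> half_space)"
  show ?thesis
  proof (cases "q \<in> ?K")
    case True
    then obtain x where x: "x \<in> cball z r" "x \<in> half_space" "q = chart_inv c x" by blast
    then have xi: "x \<in> chart_img c" using img by blast
    then have q: "q \<in> chart_dom c" "chart_map c q = x" using c x by (auto simp: chart_inv_in)
    let ?D = "chart_gradient c (lift_chart c 0 \<Psi>) q"
    have D: "?D = (\<chi> i. frechet_derivative \<Psi> (at x) (axis i 1))"
      using chart_gradient_lift_chart[OF c q(1) \<Psi>(1)] q(2) by simp
    have "(lift_chart c 0 \<Psi> \<circ> chart_inv c) differentiable (at (chart_map c q) within half_space)"
      using lift_chart_has_derivative[OF c q(1) \<Psi>(1)] by (auto simp: differentiable_def)
    then have "differential_norm2 A (conformal h g) (lift_chart c 0 \<Psi>) q = ?D \<bullet> (matrix_inv (conformal h g c q) *v ?D)"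
      by (rule G.differential_norm2_chart[OF c q(1)])
    also have "\<dots> \<le> (norm ?D)\<^sup>2 / (l * (h q)\<^sup>2)"
    proof (rule posdef_inverse_upper_bound[OF G.metric_posdef[OF c q(1)]])
      show "0 < l * (h q)\<^sup>2" using l(1) h(2)[of q] by simp
      fix v
      have "(h q)\<^sup>2 * (l * (norm v)\<^sup>2) \<le> (h q)\<^sup>2 * (v \<bullet> (g c q *v v))"
        using l(2)[of x v] x by (intro mult_left_mono) auto
      then show "l * (h q)\<^sup>2 * (norm v)\<^sup>2 \<le> v \<bullet> (conformal h g c q *v v)"
        by (simp add: conformal_def scaleR_matrix_vector_assoc[symmetric] mult_ac)
    qed
    also have "\<dots> \<le> C / (l * (h q)\<^sup>2)"
      using C[OF x(1)] l(1) by (intro divide_right_mono) (auto simp: D)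
    finally show ?thesis using True by simp
  next
    case False
    have "open (- ?K)"
      using compact_chart_inv_image[OF c img] compact_imp_closed by blast
    then have "differential_norm2 A (conformal h g) (lift_chart c 0 \<Psi>) q = 0"
      using False lift_chart_outside[OF c \<Psi>(2)] by (intro differential_norm2_vanishing[of "- ?K"]) auto
    then show ?thesis using False by simp
  qed
qed

text \<open>\<open>\<eta>\<close> is the factor h read in coordinates, given on the whole coordinate
  space so that its integral over a full ball makes sense. The energy thus acquires a bound in which
  h appears only through that integral.\<close>

lemma energy_conformal_le:
  assumes n: "2 \<le> CARD('n)" and c: "c \<in> A" and img: "cball z r \<inter> half_space \<subseteq> chart_img c"
    and h: "h \<in> smooth_functions A" "\<And>q. 0 < h q" "\<And>q. h q \<le> 1"
    and l: "0 < l" "\<And>x v. x \<in> cball z r \<inter> half_space \<Longrightarrow> l * (norm v)\<^sup>2 \<le> v \<bullet> (g c (chart_inv c x) *v v)"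
    and \<Psi>: "\<And>k. Ck_on k UNIV \<Psi>" "\<And>x. x \<notin> cball z r \<Longrightarrow> \<Psi> x = 0"
    and C: "0 \<le> C" "\<And>x. x \<in> cball z r \<Longrightarrow> (norm (\<chi> i. frechet_derivative \<Psi> (at x) (axis i 1)))\<^sup>2 \<le> C"
    and S: "0 \<le> S" "\<And>x. x \<in> cball z r \<inter> half_space \<Longrightarrow> sqrt (det (g c (chart_inv c x))) \<le> S"
    and \<eta>: "\<eta> \<in> borel_measurable borel" "\<And>x. 0 \<le> \<eta> x" "\<And>x. \<eta> x \<le> 1" "\<And>x. x \<in> chart_img c \<Longrightarrow> h (chart_inv c x) = \<eta> x"
  shows "(\<integral>q. differential_norm2 A (conformal h g) (lift_chart c 0 \<Psi>) q \<partial>riem_measure A (conformal h g)) \<le>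
    C / l * S * (\<integral>x. \<eta> x * indicator (cball z r) x \<partial>lborel)"
proof -
  interpret G: compact_mfd_metric A "conformal h g"
    using h(1,2) by (rule compact_mfd_metric_conformal)
  let ?K = "chart_inv c ` (cball z r \<inter> half_space)" and ?\<mu> = "riem_measure A (conformal h g)"
  define F where "F q = indicator ?K q * (C / (l * (h q)\<^sup>2))" for q
  have "?K \<in> sets borel"
    using compact_chart_inv_image[OF c img] by (intro borel_closed compact_imp_closed)
  moreover have "h \<in> borel_measurable borel"
    by (rule borel_measurable_continuous_onI[OF smooth_functions_continuous[OF h(1)]])
  ultimately have F: "F \<in> borel_measurable borel"
    unfolding F_def by measurable
  have K: "?K \<subseteq> chart_dom c" using img chart_inv_in[OF c] by blast
  have int: "integrable lborel (\<lambda>x. \<eta> x * indicator (cball z r) x)"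
  proof (rule Bochner_Integration.integrable_bound)
    show "integrable lborel (indicator (cball z r) :: _ \<Rightarrow> real)"
      using emeasure_bounded_finite[OF bounded_cball, of z r] by (simp add: integrable_indicator_iff)
    show "(\<lambda>x. \<eta> x * indicator (cball z r) x) \<in> borel_measurable lborel"
      using \<eta>(1) by (auto intro!: borel_measurable_times borel_measurable_indicator)
    show "AE x in lborel. norm (\<eta> x * indicator (cball z r) x) \<le> norm (indicator (cball z r) x :: real)"
      using \<eta>(2,3) by (auto simp: indicator_def)
  qed
  have I0: "0 \<le> (\<integral>x. \<eta> x * indicator (cball z r) x \<partial>lborel)"
    using \<eta>(2) by (intro integral_nonneg_AE) (auto simp: indicator_def)
  show ?thesis
  proof (rule integral_le_of_nn_integral_bound)
    show "F \<in> borel_measurable ?\<mu>"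
      using F by (simp cong: measurable_cong_sets add: G.sets_riem_measure)
    show "0 \<le> F q" for q using C(1) l(1) by (simp add: F_def indicator_def)
    show "differential_norm2 A (conformal h g) (lift_chart c 0 \<Psi>) q \<le> F q" for q
      unfolding F_def by (rule differential_norm2_conformal_le[OF c img h(1,2) l \<Psi> C(2)])
    show "0 \<le> C / l * S * (\<integral>x. \<eta> x * indicator (cball z r) x \<partial>lborel)"
      using C(1) l(1) S(1) I0 by simp
    have "(\<integral>\<^sup>+q. ennreal (F q) \<partial>?\<mu>) = (\<integral>\<^sup>+q. ennreal (F q) * indicator (chart_dom c) q \<partial>?\<mu>)"
      using K by (intro nn_integral_cong) (auto simp: F_def indicator_def)
    also have "\<dots> = (\<integral>\<^sup>+x. ennreal (sqrt (det (conformal h g c (chart_inv c x)))) * indicator (chart_img c) x *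
        ennreal (F (chart_inv c x)) \<partial>lborel)"
      using F by (intro G.riem.nn_integral_glued[OF G.riem_measure_glued c]) simp
    also have "\<dots> \<le> (\<integral>\<^sup>+x. ennreal (C / l * S * (\<eta> x * indicator (cball z r) x)) \<partial>lborel)"
    proof (intro nn_integral_mono)
      fix x
      show "ennreal (sqrt (det (conformal h g c (chart_inv c x)))) * indicator (chart_img c) x * ennreal (F (chart_inv c x))
        \<le> ennreal (C / l * S * (\<eta> x * indicator (cball z r) x))"
      proof (cases "x \<in> chart_img c \<and> chart_inv c x \<in> ?K")
        case True
        then obtain y where y: "y \<in> cball z r" "y \<in> half_space" "chart_inv c x = chart_inv c y" by blast
        then have "x = y"
          using True img chart_map_inv[OF c] by (metis Int_iff subsetD)
        then have x: "x \<in> cball z r \<inter> half_space" using y by simp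
        let ?t = "\<eta> x"
        have t: "0 < ?t" "?t \<le> 1" "h (chart_inv c x) = ?t"
          using True \<eta> h(2)[of "chart_inv c x"] by auto
        have "sqrt (det (conformal h g c (chart_inv c x))) = ?t ^ CARD('n option) * sqrt (det (g c (chart_inv c x)))"
          using t by (simp add: conformal_def det_scaleR real_sqrt_mult real_sqrt_power)
        \<comment> \<open>The dimension hypothesis enters here: the exponent n + 1 is at least 3 and
          t \<le> 1. Dividing by the t^2 in \<open>F\<close> then leaves one factor t.\<close>
        also have "\<dots> \<le> ?t ^ 3 * S"
          using t(1,2) n S(2)[OF x]
          by (intro mult_mono power_decreasing) (auto intro: less_imp_le posdef_det_pos[OF metric_posdef[OF c chart_inv_in[OF c]]] True[THEN conjunct1])
        finally have "sqrt (det (conformal h g c (chart_inv c x))) * F (chart_inv c x) \<le> (?t ^ 3 * S) * F (chart_inv c x)"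
          using C(1) l(1) by (intro mult_right_mono) (auto simp: F_def indicator_def)
        also have "\<dots> = C / l * S * ?t"
          using True t by (simp add: F_def power2_eq_square power3_eq_cube field_simps)
        finally have "sqrt (det (conformal h g c (chart_inv c x))) * F (chart_inv c x) \<le> C / l * S * ?t" .
        moreover have "0 \<le> F (chart_inv c x)"
          using C(1) l(1) by (simp add: F_def indicator_def)
        ultimately show ?thesis
          using True x by (simp add: ennreal_mult''[symmetric] ennreal_leI)
      next
        case False
        then show ?thesis by (auto simp: F_def)
      qed
    qed
    also have "\<dots> = ennreal (\<integral>x. C / l * S * (\<eta> x * indicator (cball z r) x) \<partial>lborel)"
      using C(1) l(1) S(1) \<eta>(2)
      by (intro nn_integral_eq_integral integrable_mult_right int AE_I2) (auto simp: indicator_def)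
    finally show "(\<integral>\<^sup>+q. ennreal (F q) \<partial>?\<mu>) \<le> ennreal (C / l * S * (\<integral>x. \<eta> x * indicator (cball z r) x \<partial>lborel))"
      by simp
  qed
qed

text \<open>In boundary coordinates the integrand is continuous on a compact set and positive on an
  open neighbourhood of the centre, which lies on the boundary. A zero integral would make this
  nonempty open set negligible.\<close>

lemma boundary_bump_integral:
  assumes c: "c \<in> A" and z: "z \<in> chart_img c" "z $ None = 0" and s: "0 < s"
    and img: "cball z s \<inter> half_space \<subseteq> chart_img c"
  shows "integrable (boundary_measure A g) (\<lambda>q. (lift_chart c 0 (bump z s) q)\<^sup>2)"
    and "0 < (\<integral>q. (lift_chart c 0 (bump z s) q)\<^sup>2 \<partial>boundary_measure A g)"
proof -
  let ?\<nu> = "boundary_measure A g" and ?f = "lift_chart c 0 (bump z s)"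
  let ?w = "\<lambda>y. sqrt (det (boundary_metric g c (chart_inv c (boundary_point y))))"
  let ?Y = "{y. boundary_point y \<in> cball z s}" and ?O = "{y. boundary_point y \<in> ball z s}"
  let ?I = "\<lambda>y. ?w y * (bump z s (boundary_point y))\<^sup>2 * indicator ?Y y"
  have f: "?f \<in> smooth_functions A"
    by (rule lift_chart_smooth[OF c img Ck_on_bump[OF open_UNIV]]) (simp add: bump_eq_0_iff[OF s])
  have fm: "?f \<in> borel_measurable borel"
    by (rule borel_measurable_continuous_onI[OF smooth_functions_continuous[OF f]])
  have f2: "(\<lambda>q. (?f q)\<^sup>2) \<in> borel_measurable ?\<nu>"
    using fm by (simp cong: measurable_cong_sets add: sets_boundary_measure measurable_restrict_space1)
  have space: "space ?\<nu> = mfd_boundary A"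
    using sets_eq_imp_space_eq[OF sets_boundary_measure] by (simp add: space_restrict_space)
  have Yimg: "?Y \<subseteq> {y. boundary_point y \<in> chart_img c}"
    using img by (auto simp del: mem_cball)
  have Yimage: "?Y = tangential ` (cball z s \<inter> {x. x $ None = 0})"
  proof (intro equalityI subsetI)
    fix y assume "y \<in> ?Y"
    then show "y \<in> tangential ` (cball z s \<inter> {x. x $ None = 0})"
      by (intro image_eqI[of _ _ "boundary_point y"]) auto
  qed (auto simp: boundary_point_tangential)
  have Y: "compact ?Y"
    unfolding Yimage
    by (intro compact_continuous_image compact_Int_closed compact_cball linear_continuous_on bounded_linear_tangential
        closed_Collect_eq continuous_intros)
  have w: "continuous_on ?Y ?w"
    by (rule continuous_on_subset[OF continuous_on_boundary_density[OF c] Yimg])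
  have "continuous_on UNIV (bump z s)"
    by (rule Ck_on_imp_continuous_on[OF Ck_on_bump[OF open_UNIV]])
  then have b: "continuous_on ?Y (\<lambda>y. (bump z s (boundary_point y))\<^sup>2)"
    by (intro continuous_intros continuous_on_compose2[OF _ continuous_on_boundary_point, of UNIV]) auto
  have wpos: "0 < ?w y" if "y \<in> ?Y" for y
    using posdef_det_pos[OF boundary_metric_posdef[OF c chart_inv_in[OF c]]] Yimg that by auto
  have cont: "continuous_on ?Y (\<lambda>y. ?w y * (bump z s (boundary_point y))\<^sup>2)"
    by (intro continuous_on_mult w b)
  have I: "integrable lborel ?I"
    using borel_integrable_compact[OF Y cont] by (simp add: mult_ac)
  have I0: "0 \<le> ?I y" for y
    using wpos[of y] by (simp add: indicator_def less_imp_le)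
  have eq: "(\<integral>\<^sup>+q. ennreal ((?f q)\<^sup>2) \<partial>?\<nu>) = (\<integral>\<^sup>+y. ennreal (?I y) \<partial>lborel)"
  proof -
    have "(\<integral>\<^sup>+q. ennreal ((?f q)\<^sup>2) \<partial>?\<nu>) = (\<integral>\<^sup>+q. ennreal ((?f q)\<^sup>2) * indicator (chart_dom c \<inter> mfd_boundary A) q \<partial>?\<nu>)"
      by (intro nn_integral_cong) (auto simp: indicator_def space lift_chart_def)
    also have "\<dots> = (\<integral>\<^sup>+y. ennreal (?w y) * indicator {y. boundary_point y \<in> chart_img c} y *
        ennreal ((?f (chart_inv c (boundary_point y)))\<^sup>2) \<partial>lborel)"
      using fm by (intro bnd.nn_integral_glued[OF boundary_measure_glued c]) (auto intro: measurable_restrict_space1)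
    also have "\<dots> = (\<integral>\<^sup>+y. ennreal (?I y) \<partial>lborel)"
    proof (intro nn_integral_cong)
      fix y
      show "ennreal (?w y) * indicator {y. boundary_point y \<in> chart_img c} y *
        ennreal ((?f (chart_inv c (boundary_point y)))\<^sup>2) = ennreal (?I y)"
      proof (cases "y \<in> ?Y")
        case True
        then have "boundary_point y \<in> chart_img c" using Yimg by blast
        then show ?thesis
          using True c by (simp add: lift_chart_def chart_inv_in ennreal_mult'')
      next
        case False
        then have "bump z s (boundary_point y) = 0"
          by (simp add: bump_eq_0_iff[OF s])
        then show ?thesis
          using False c by (auto simp: lift_chart_def chart_inv_in indicator_def)
      qed
    qed
    finally show ?thesis .
  qed
  have eq': "(\<integral>\<^sup>+q. ennreal ((?f q)\<^sup>2) \<partial>?\<nu>) = ennreal (\<integral>y. ?I y \<partial>lborel)"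
    unfolding eq by (rule nn_integral_eq_integral[OF I]) (use I0 in auto)
  show int: "integrable ?\<nu> (\<lambda>q. (?f q)\<^sup>2)"
    by (rule integrableI_bounded[OF f2]) (simp add: eq')
  have "(\<integral>q. (?f q)\<^sup>2 \<partial>?\<nu>) = (\<integral>y. ?I y \<partial>lborel)"
    using nn_integral_eq_integral[OF int] eq' I0 by (simp add: integral_nonneg_AE ennreal_inj)
  moreover have "(\<integral>y. ?I y \<partial>lborel) \<noteq> 0"
  proof
    assume "(\<integral>y. ?I y \<partial>lborel) = 0"
    then have "AE y in lborel. ?I y = 0"
      using integral_nonneg_eq_0_iff_AE[OF I] I0 by simp
    then have "AE y in lborel. y \<notin> ?O"
    proof (rule AE_mp, intro AE_I2 impI notI)
      fix y assume y: "?I y = 0" "y \<in> ?O"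
      then have "y \<in> ?Y" by auto
      then show False
        using y wpos[of y] bump_pos_iff[OF s, of z "boundary_point y"] by auto
    qed
    moreover have O: "open ?O"
      using open_vimage[OF open_ball continuous_on_boundary_point] by (simp add: vimage_def)
    ultimately have "?O \<in> null_sets lborel"
      using AE_iff_null_sets[of ?O lborel] by simp
    then have "negligible ?O"
      by (simp add: negligible_iff_null_sets null_sets_completionI)
    moreover have "tangential z \<in> ?O"
      using z s by (simp add: boundary_point_tangential)
    ultimately show False
      using open_not_negligible[OF O] by blast
  qed
  moreover have "0 \<le> (\<integral>y. ?I y \<partial>lborel)"
    using I0 by (intro integral_nonneg_AE AE_I2)
  ultimately show "0 < (\<integral>q. (?f q)\<^sup>2 \<partial>?\<nu>)"
    by simp
qed

end

section \<open>Min-max bounds for Steklov eigenvalues\<close>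

lemma steklov_eigenvalue_le:
  fixes f :: "nat \<Rightarrow> 'a::topological_space \<Rightarrow> real" and G :: "('a, 'n::finite) metric"
  assumes diag: "\<And>i j. i < k \<Longrightarrow> j < k \<Longrightarrow> f i (z j) = 0 \<longleftrightarrow> i \<noteq> j"
    and smooth: "\<And>a. (\<lambda>q. \<Sum>i<k. a i * f i q) \<in> smooth_functions A"
    and bound: "\<And>a i. i < k \<Longrightarrow> a i \<noteq> 0 \<Longrightarrow> steklov_quotient A G (\<lambda>q. \<Sum>i<k. a i * f i q) \<le> B"
  shows "steklov_eigenvalue A G k \<le> B"
proof -
  interpret fs: vector_space "fun_scale :: real \<Rightarrow> ('a \<Rightarrow> real) \<Rightarrow> 'a \<Rightarrow> real"
    by (rule vector_space_fun_scale)
  let ?B = "f ` {..<k}"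
  have inj: "inj_on f {..<k}"
    using diag by (metis inj_onI lessThan_iff)
  have sum_apply: "(\<Sum>i\<in>I. F i) q = (\<Sum>i\<in>I. F i q)" for F :: "nat \<Rightarrow> 'a \<Rightarrow> real" and I q
    by (induction I rule: infinite_finite_induct) auto
  have comb: "(\<Sum>v\<in>?B. fun_scale (u v) v) = (\<lambda>q. \<Sum>i<k. u (f i) * f i q)" for u
    by (simp add: sum.reindex[OF inj] fun_eq_iff sum_apply fun_scale_def)
  \<comment> \<open>Evaluation at \<open>z j\<close> isolates the j-th coefficient because the
    matrix of values is diagonal with nonzero diagonal; hence the functions are independent and span
    a k-dimensional space.\<close>
  have at: "(\<Sum>i<k. a i * f i (z j)) = a j * f j (z j)" if "j < k" for a j
    using diag that by (subst sum.mono_neutral_right[of "{..<k}" "{j}"]) auto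
  have "fs.independent ?B"
  proof (rule fs.independent_if_scalars_zero)
    fix u v assume "(\<Sum>v\<in>?B. fun_scale (u v) v) = 0" "v \<in> ?B"
    then obtain j where "j < k" "v = f j" "(\<Sum>i<k. u (f i) * f i (z j)) = 0"
      unfolding comb by (auto simp: fun_eq_iff)
    then show "u v = 0" using at[of j "\<lambda>i. u (f i)"] diag by auto
  qed simp
  then have "fs.dim (fs.span ?B) = card ?B"
    by (rule fs.dim_span_eq_card_independent)
  then have dim: "fs.dim (fs.span ?B) = k"
    using card_image[OF inj] by simp
  have span: "\<exists>a. v = (\<lambda>q. \<Sum>i<k. a i * f i q)" if "v \<in> fs.span ?B" for v
    using that by (auto simp: fs.span_finite comb)
  have "(SUP v \<in> fs.span ?B - {0}. steklov_quotient A G v) \<le> B"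
  proof (rule SUP_least)
    fix v assume v: "v \<in> fs.span ?B - {0}"
    then obtain a where a: "v = (\<lambda>q. \<Sum>i<k. a i * f i q)" using span by blast
    have "\<exists>i<k. a i \<noteq> 0"
    proof (rule ccontr)
      assume "\<not> (\<exists>i<k. a i \<noteq> 0)"
      then have "v = 0"
        unfolding a by (auto simp: fun_eq_iff intro!: sum.neutral)
      with v show False by simp
    qed
    then obtain i where "i < k" "a i \<noteq> 0" by blast
    then show "steklov_quotient A G v \<le> B"
      unfolding a by (rule bound)
  qed
  moreover have "steklov_eigenvalue A G k \<le> (SUP v \<in> fs.span ?B - {0}. steklov_quotient A G v)"
    unfolding steklov_eigenvalue_def
    by (rule INF_lower) (use dim span smooth in auto)
  ultimately show ?thesis by (rule order_trans[rotated])
qed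

text \<open>A space of dimension at least 1 contains a nonzero function, so each supremum is over a
  nonempty set of nonnegative quotients and cannot be the supremum of the empty set, minus
  infinity.\<close>

lemma (in compact_mfd_metric) steklov_eigenvalue_nonneg:
  assumes "1 \<le> k"
  shows "0 \<le> steklov_eigenvalue A g k"
  unfolding steklov_eigenvalue_def
proof (rule INF_greatest)
  interpret fs: vector_space "fun_scale :: real \<Rightarrow> ('a \<Rightarrow> real) \<Rightarrow> 'a \<Rightarrow> real"
    by (rule vector_space_fun_scale)
  fix E assume "E \<in> {E. fs.subspace E \<and> fs.dim E = k \<and> E \<subseteq> smooth_functions A}"
  then have E: "fs.subspace E" "fs.dim E = k" by auto
  have "E \<noteq> {0}"
  proof
    assume "E = {0}"
    then have "fs.dim E = card ({} :: ('a \<Rightarrow> real) set)"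
      by (intro fs.dim_eq_card) (auto simp: fs.span_insert_0 fs.independent_empty)
    then show False using E assms by simp
  qed
  then obtain f where f: "f \<in> E - {0}"
    using fs.subspace_0[OF E(1)] by auto
  have "0 \<le> steklov_quotient A g f"
    by (simp add: steklov_quotient_def differential_norm2_nonneg integral_nonneg_AE)
  also have "\<dots> \<le> (SUP f \<in> E - {0}. steklov_quotient A g f)"
    using f by (rule SUP_upper)
  finally show "0 \<le> (SUP f \<in> E - {0}. steklov_quotient A g f)" .
qed

section \<open>Collapsing the Steklov spectrum\<close>

text \<open>Cauchy-Schwarz in each coordinate separates the coefficients from the functions, giving
  a gradient bound uniform over the span.\<close>

lemma norm_gradient_sum_le:
  fixes \<beta> :: "'i \<Rightarrow> real^'m::finite \<Rightarrow> real"
  assumes \<beta>: "\<And>i. i \<in> I \<Longrightarrow> (\<beta> i has_derivative \<beta>' i) (at x)"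
  shows "(norm (\<chi> j. frechet_derivative (\<lambda>x. \<Sum>i\<in>I. a i * \<beta> i x) (at x) (axis j 1)))\<^sup>2 \<le>
    (\<Sum>i\<in>I. (a i)\<^sup>2) * (\<Sum>j\<in>UNIV. \<Sum>i\<in>I. (\<beta>' i (axis j 1))\<^sup>2)"
proof -
  have "((\<lambda>x. \<Sum>i\<in>I. a i * \<beta> i x) has_derivative (\<lambda>v. \<Sum>i\<in>I. a i * \<beta>' i v)) (at x)"
    by (intro has_derivative_sum has_derivative_mult_right \<beta>)
  then have "frechet_derivative (\<lambda>x. \<Sum>i\<in>I. a i * \<beta> i x) (at x) = (\<lambda>v. \<Sum>i\<in>I. a i * \<beta>' i v)"
    by (rule frechet_derivative_at[symmetric])
  then have "(norm (\<chi> j. frechet_derivative (\<lambda>x. \<Sum>i\<in>I. a i * \<beta> i x) (at x) (axis j 1)))\<^sup>2 =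
      (\<Sum>j\<in>UNIV. (\<Sum>i\<in>I. a i * \<beta>' i (axis j 1))\<^sup>2)"
    by (simp add: power2_norm_eq_inner inner_vec_def flip: power2_eq_square)
  also have "\<dots> \<le> (\<Sum>j\<in>UNIV. (\<Sum>i\<in>I. (a i)\<^sup>2) * (\<Sum>i\<in>I. (\<beta>' i (axis j 1))\<^sup>2))"
    by (intro sum_mono Cauchy_Schwarz_ineq_sum)
  finally show ?thesis
    by (simp add: sum_distrib_left)
qed

text \<open>The centres are placed along one tangential direction, hence on the boundary hyperplane,
  with consecutive ones 2 \<rho> apart so that open balls of radius \<rho> are disjoint.\<close>

lemma disjoint_bumps:
  fixes x :: "real ^ ('n::finite) option" and k :: nat
  assumes x: "x $ None = 0" and r: "0 < r"
  obtains z \<rho> where "0 < \<rho>" "\<And>i. z i $ None = 0" "\<And>i. i < k \<Longrightarrow> cball (z i) \<rho> \<subseteq> cball x r"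
    "\<And>i j. bump (z i) \<rho> (z j) = 0 \<longleftrightarrow> i \<noteq> j" "\<And>i j y. i \<noteq> j \<Longrightarrow> bump (z i) \<rho> y * bump (z j) \<rho> y = 0"
proof -
  \<comment> \<open>The farthest of the k balls reaches distance (2 (k - 1) + 1) \<rho> from
    \<open>x\<close>, which is below 2 (k + 1) \<rho> = r.\<close>
  define \<rho> where "\<rho> = r / (2 * (real k + 1))"
  define e :: "real ^ 'n option" where "e = axis (Some undefined) 1"
  define z where "z i = x + (2 * real i * \<rho>) *\<^sub>R e" for i :: nat
  have e: "norm e = 1" "e $ None = 0" by (simp add: e_def) (simp add: e_def axis_def)
  have \<rho>: "0 < \<rho>" using r by (simp add: \<rho>_def)
  have dist: "dist (z i) (z j) = 2 * \<rho> * \<bar>real i - real j\<bar>" for i j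
  proof -
    have "z i - z j = (2 * \<rho> * (real i - real j)) *\<^sub>R e"
      by (simp add: z_def algebra_simps)
    then show ?thesis using e \<rho> by (simp add: dist_norm abs_mult)
  qed
  have far: "2 * \<rho> \<le> dist (z i) (z j)" if "i \<noteq> j" for i j
  proof -
    have "1 \<le> \<bar>real i - real j\<bar>" using that by linarith
    then show ?thesis using \<rho> by (simp add: dist)
  qed
  show ?thesis
  proof (rule that[of \<rho> z])
    show "0 < \<rho>" by fact
    show "z i $ None = 0" for i using x e by (simp add: z_def)
    show "cball (z i) \<rho> \<subseteq> cball x r" if i: "i < k" for i
    proof
      fix y assume "y \<in> cball (z i) \<rho>"
      then have "dist x y \<le> 2 * real i * \<rho> + \<rho>"
        using dist_triangle[of x y "z i"] e \<rho> by (simp add: z_def dist_norm)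
      also have "\<dots> = (2 * real i + 1) * \<rho>"
        by (simp add: algebra_simps)
      also have "\<dots> \<le> (2 * (real k + 1)) * \<rho>"
        using i \<rho> by (intro mult_right_mono) auto
      also have "\<dots> = r" by (simp add: \<rho>_def field_simps)
      finally show "y \<in> cball x r" by simp
    qed
    show "bump (z i) \<rho> (z j) = 0 \<longleftrightarrow> i \<noteq> j" for i j
      using far[of i j] \<rho> by (cases "i = j") (auto simp: bump_eq_0_iff[OF \<rho>])
    show "bump (z i) \<rho> y * bump (z j) \<rho> y = 0" if "i \<noteq> j" for i j y
    proof (rule ccontr)
      assume "bump (z i) \<rho> y * bump (z j) \<rho> y \<noteq> 0"
      then have "dist (z i) y < \<rho>" "dist (z j) y < \<rho>"
        using bump_eq_0_iff[OF \<rho>] by auto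
      then show False
        using far[OF that] dist_triangle2[of "z i" "z j" y] by simp
    qed
  qed
qed

context compact_mfd_metric begin

text \<open>The point is the order of quantifiers: \<open>C\<close> may depend on k, the metric and
  the chart, but is fixed before the conformal factor \<open>h\<close>.\<close>

lemma steklov_eigenvalue_conformal_le:
  assumes n: "2 \<le> CARD('n)" and c: "c \<in> A" and x: "x \<in> chart_img c" "x $ None = 0" and r: "0 < r"
    and img: "cball x r \<inter> half_space \<subseteq> chart_img c" and k: "1 \<le> k"
  obtains C where "\<And>h \<eta>. \<lbrakk>h \<in> smooth_functions A; \<And>q. 0 < h q; \<And>q. h q \<le> 1; \<And>q. q \<in> mfd_boundary A \<Longrightarrow> h q = 1;
      \<eta> \<in> borel_measurable borel; \<And>x. 0 \<le> \<eta> x; \<And>x. \<eta> x \<le> 1; \<And>x. x \<in> chart_img c \<Longrightarrow> h (chart_inv c x) = \<eta> x\<rbrakk>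
    \<Longrightarrow> steklov_eigenvalue A (conformal h g) k \<le> ereal (C * (\<integral>y. \<eta> y * indicator (cball x r) y \<partial>lborel))"
proof -
  let ?K = "cball x r \<inter> half_space" and ?\<nu> = "boundary_measure A g"
  have K: "compact ?K" "x \<in> ?K"
  proof -
    show "compact ?K" by (intro compact_Int_closed compact_cball closed_half_space)
    show "x \<in> ?K" using x r by (simp add: half_space_def)
  qed
  have "continuous_on ?K (\<lambda>x. g c (chart_inv c x))"
    using continuous_on_subset[OF metric_continuous[OF c] img] by (simp add: o_def)
  moreover have "posdef (g c (chart_inv c x))" if "x \<in> ?K" for x
    using metric_posdef[OF c chart_inv_in[OF c]] img that by blast
  ultimately obtain l where l: "0 < l" "\<And>x v. x \<in> ?K \<Longrightarrow> l * (norm v)\<^sup>2 \<le> v \<bullet> (g c (chart_inv c x) *v v)"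
    using posdef_uniform_bounds[OF K(1), of "\<lambda>x. g c (chart_inv c x)"] by metis
  obtain S where S: "0 \<le> S" "\<And>x. x \<in> ?K \<Longrightarrow> sqrt (det (g c (chart_inv c x))) \<le> S"
  proof -
    obtain x1 where x1: "x1 \<in> ?K" "\<And>x. x \<in> ?K \<Longrightarrow> sqrt (det (g c (chart_inv c x))) \<le> sqrt (det (g c (chart_inv c x1)))"
      using continuous_attains_sup[OF K(1) _ continuous_on_subset[OF continuous_on_volume_density[OF c] img]] K(2) by blast
    show ?thesis
    proof (rule that[OF _ x1(2)])
      have "0 < det (g c (chart_inv c x1))"
        using posdef_det_pos[OF metric_posdef[OF c chart_inv_in[OF c]]] x1(1) img by blast
      then show "0 \<le> sqrt (det (g c (chart_inv c x1)))" by simp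
    qed
  qed
  obtain z \<rho> where \<rho>: "0 < \<rho>" and z: "\<And>i. z i $ None = 0" "\<And>i. i < k \<Longrightarrow> cball (z i) \<rho> \<subseteq> cball x r"
    and diag: "\<And>i j. bump (z i) \<rho> (z j) = 0 \<longleftrightarrow> i \<noteq> j"
    and disj: "\<And>i j y. i \<noteq> j \<Longrightarrow> bump (z i) \<rho> y * bump (z j) \<rho> y = 0"
    by (rule disjoint_bumps[OF x(2) r, where k = k]) blast
  define \<beta> where "\<beta> i = bump (z i) \<rho>" for i
  define f where "f i = lift_chart c 0 (\<beta> i)" for i
  have \<beta>_smooth: "Ck_on m UNIV (\<beta> i)" for m i
    by (simp add: \<beta>_def Ck_on_bump)
  have zimg: "z i \<in> chart_img c" "cball (z i) \<rho> \<inter> half_space \<subseteq> chart_img c" if "i < k" for i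
  proof -
    show sub: "cball (z i) \<rho> \<inter> half_space \<subseteq> chart_img c" using z(2)[OF that] img by blast
    have "z i \<in> cball (z i) \<rho> \<inter> half_space" using z(1)[of i] \<rho> by (simp add: half_space_def)
    then show "z i \<in> chart_img c" using sub by blast
  qed
  let ?\<Gamma> = "\<lambda>x. \<Sum>j\<in>UNIV. \<Sum>i<k. (frechet_derivative (\<beta> i) (at x) (axis j 1))\<^sup>2"
  have "continuous_on (cball x r) ?\<Gamma>"
  proof (intro continuous_intros)
    fix i j
    have "Ck_on (Suc 0) UNIV (\<beta> i)" by (rule \<beta>_smooth)
    then have "continuous_on UNIV (\<lambda>x. frechet_derivative (\<beta> i) (at x) (axis j 1))" by simp
    then show "continuous_on (cball x r) (\<lambda>x. frechet_derivative (\<beta> i) (at x) (axis j 1))"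
      by (rule continuous_on_subset) simp
  qed
  then obtain x2 where x2: "x2 \<in> cball x r" "\<And>y. y \<in> cball x r \<Longrightarrow> ?\<Gamma> y \<le> ?\<Gamma> x2"
    using continuous_attains_sup[OF compact_cball, of x r ?\<Gamma>] r by auto
  define \<Gamma> where "\<Gamma> = ?\<Gamma> x2"
  have \<Gamma>: "0 \<le> \<Gamma>" by (auto simp: \<Gamma>_def intro!: sum_nonneg)
  have f_int: "integrable ?\<nu> (\<lambda>q. (f i q)\<^sup>2)" "0 < (\<integral>q. (f i q)\<^sup>2 \<partial>?\<nu>)" if "i < k" for i
    using boundary_bump_integral[OF c zimg(1)[OF that] z(1) \<rho> zimg(2)[OF that]] by (simp_all add: f_def \<beta>_def)
  \<comment> \<open>The least squared boundary norm of the bumps; k \<ge> 1 makes this a minimum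
    over a nonempty set.\<close>
  define \<delta> where "\<delta> = Min ((\<lambda>i. \<integral>q. (f i q)\<^sup>2 \<partial>?\<nu>) ` {..<k})"
  have \<delta>: "0 < \<delta>" "\<And>i. i < k \<Longrightarrow> \<delta> \<le> (\<integral>q. (f i q)\<^sup>2 \<partial>?\<nu>)"
  proof -
    have "0 \<in> {..<k}" using k by simp
    then have "{..<k} \<noteq> {}" by blast
    then show "0 < \<delta>" "\<And>i. i < k \<Longrightarrow> \<delta> \<le> (\<integral>q. (f i q)\<^sup>2 \<partial>?\<nu>)"
      using f_int(2) by (auto simp: \<delta>_def)
  qed
  let ?\<Psi> = "\<lambda>a y. \<Sum>i<k. a i * \<beta> i y"
  have f_sum: "(\<lambda>q. \<Sum>i<k. a i * f i q) = lift_chart c 0 (?\<Psi> a)" for a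
    by (auto simp: f_def lift_chart_def)
  have \<Psi>: "Ck_on m UNIV (?\<Psi> a)" for m a
    by (intro Ck_on_sum Ck_on_mult Ck_on_const \<beta>_smooth open_UNIV)
  have \<Psi>0: "?\<Psi> a y = 0" if "y \<notin> cball x r" for a y
  proof (intro sum.neutral ballI)
    fix i assume "i \<in> {..<k}"
    then have "y \<notin> ball (z i) \<rho>" using z(2)[of i] that by (auto simp: subset_iff)
    then show "a i * \<beta> i y = 0" by (simp add: \<beta>_def bump_eq_0_iff[OF \<rho>])
  qed
  have grad: "(norm (\<chi> j. frechet_derivative (?\<Psi> a) (at y) (axis j 1)))\<^sup>2 \<le> (\<Sum>i<k. (a i)\<^sup>2) * \<Gamma>"
    if "y \<in> cball x r" for a y
  proof -
    have "(norm (\<chi> j. frechet_derivative (?\<Psi> a) (at y) (axis j 1)))\<^sup>2 \<le> (\<Sum>i<k. (a i)\<^sup>2) * ?\<Gamma> y"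
      by (rule norm_gradient_sum_le) (use Ck_on_Suc_has_derivative[OF \<beta>_smooth] in blast)
    also have "\<dots> \<le> (\<Sum>i<k. (a i)\<^sup>2) * \<Gamma>"
      unfolding \<Gamma>_def using x2(2)[OF that] by (intro mult_left_mono sum_nonneg) auto
    finally show ?thesis .
  qed
  show ?thesis
  \<comment> \<open>On the coordinate ball \<open>\<Gamma>\<close> bounds the sum of the squared
    partial derivatives of the bumps; on its half-space part \<open>l\<close> bounds the metric from
    below and \<open>S\<close> the volume density from above. \<open>\<delta>\<close> bounds the
    boundary norms from below.\<close>
  proof (rule that[of "\<Gamma> / l * S / \<delta>"])
    fix h \<eta>
    assume h: "h \<in> smooth_functions A" "\<And>q. 0 < h q" "\<And>q. h q \<le> 1" "\<And>q. q \<in> mfd_boundary A \<Longrightarrow> h q = 1"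
      and \<eta>: "\<eta> \<in> borel_measurable borel" "\<And>x. 0 \<le> \<eta> x" "\<And>x. \<eta> x \<le> 1" "\<And>x. x \<in> chart_img c \<Longrightarrow> h (chart_inv c x) = \<eta> x"
    let ?T = "\<integral>y. \<eta> y * indicator (cball x r) y \<partial>lborel"
    have T: "0 \<le> ?T" using \<eta>(2) by (intro integral_nonneg_AE AE_I2) (simp add: indicator_def)
    show "steklov_eigenvalue A (conformal h g) k \<le> ereal (\<Gamma> / l * S / \<delta> * ?T)"
    proof (rule steklov_eigenvalue_le[of k f "\<lambda>i. chart_inv c (z i)"])
      have fz: "f i (chart_inv c (z j)) = \<beta> i (z j)" if "j < k" for i j
        using zimg(1)[OF that] c by (simp add: f_def lift_chart_def chart_inv_in)
      show "f i (chart_inv c (z j)) = 0 \<longleftrightarrow> i \<noteq> j" if "i < k" "j < k" for i j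
        using that diag by (simp add: fz \<beta>_def)
      show "(\<lambda>q. \<Sum>i<k. a i * f i q) \<in> smooth_functions A" for a
        unfolding f_sum by (rule lift_chart_smooth[OF c img \<Psi> \<Psi>0])
      fix a :: "nat \<Rightarrow> real" and i0 assume i0: "i0 < k" "a i0 \<noteq> 0"
      let ?F = "\<lambda>q. \<Sum>i<k. a i * f i q" and ?N = "\<Sum>i<k. (a i)\<^sup>2"
      have N: "0 < ?N"
        using i0 by (intro sum_pos2[of _ i0]) auto
      \<comment> \<open>Disjoint supports kill the cross terms, so the boundary norm of a
        combination is controlled from below by its squared coefficients alone.\<close>
      have disj': "(a i * f i q) * (a j * f j q) = 0" if "i \<noteq> j" for i j q
        using disj[OF that] by (auto simp: f_def \<beta>_def lift_chart_def)
      have sq: "(?F q)\<^sup>2 = (\<Sum>i<k. (a i)\<^sup>2 * (f i q)\<^sup>2)" for q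
        using sum_square_orthogonal[of "{..<k}" "\<lambda>i. a i * f i q"] disj' by (simp add: power_mult_distrib)
      have den: "(\<integral>q. (?F q)\<^sup>2 \<partial>?\<nu>) = (\<Sum>i<k. (a i)\<^sup>2 * (\<integral>q. (f i q)\<^sup>2 \<partial>?\<nu>))"
        unfolding sq using f_int(1) by (subst Bochner_Integration.integral_sum) auto
      have den_ge: "?N * \<delta> \<le> (\<integral>q. (?F q)\<^sup>2 \<partial>?\<nu>)"
        unfolding den sum_distrib_right using \<delta>(2) by (intro sum_mono mult_left_mono) auto
      have num: "(\<integral>q. differential_norm2 A (conformal h g) ?F q \<partial>riem_measure A (conformal h g)) \<le> (?N * \<Gamma>) / l * S * ?T"
        unfolding f_sum
        by (rule energy_conformal_le[OF n c img h(1-3) l \<Psi> \<Psi>0 _ grad S \<eta>]) (use N \<Gamma> in auto)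
      have "chart_inv c (z i0) \<in> mfd_boundary A"
        using zimg(1)[OF i0(1)] z(1) c mfd_boundary_iff[OF c chart_inv_in[OF c]] by simp
      moreover have "?F (chart_inv c (z i0)) = a i0 * \<beta> i0 (z i0)"
        using i0(1) diag by (subst sum.mono_neutral_right[of "{..<k}" "{i0}"]) (auto simp: fz \<beta>_def)
      then have "?F (chart_inv c (z i0)) \<noteq> 0"
        using i0 diag[of i0 i0] by (simp add: \<beta>_def)
      ultimately have "\<not> (\<forall>q\<in>mfd_boundary A. ?F q = 0)"
        by blast
      then have "steklov_quotient A (conformal h g) ?F =
          ereal ((\<integral>q. differential_norm2 A (conformal h g) ?F q \<partial>riem_measure A (conformal h g)) / (\<integral>q. (?F q)\<^sup>2 \<partial>?\<nu>))"
        by (simp only: steklov_quotient_def if_False boundary_measure_conformal[OF h(4)])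
      also have "\<dots> \<le> ereal (((?N * \<Gamma>) / l * S * ?T) / (?N * \<delta>))"
        unfolding ereal_less_eq using N \<Gamma> l(1) S(1) T \<delta>(1) num den_ge by (intro frac_le) auto
      \<comment> \<open>The squared norm of the coefficients scales numerator and denominator alike
        and cancels, leaving a bound common to all test functions.\<close>
      also have "((?N * \<Gamma>) / l * S * ?T) / (?N * \<delta>) = \<Gamma> / l * S / \<delta> * ?T"
        using N by (simp add: field_simps)
      finally show "steklov_quotient A (conformal h g) ?F \<le> ereal (\<Gamma> / l * S / \<delta> * ?T)" .
    qed
  qed
qed

end

section \<open>The conformal factors in coordinates\<close>

definition damping :: "real ^ ('n::finite) option \<Rightarrow> real \<Rightarrow> nat \<Rightarrow> real ^ 'n option \<Rightarrow> real" where
  "damping x R m y = inverse (1 + real m * (bump x R y * (y $ None * y $ None)))"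

text \<open>The square of the transverse coordinate keeps the denominator at least 1 beyond the
  half-space too, so the factor is smooth on the whole coordinate space.\<close>

lemma damping_denominator: "1 \<le> 1 + real m * (bump x R y * (y $ None * y $ None))"
  by (simp add: bump_nonneg)

lemma damping_pos: "0 < damping x R m y"
  using damping_denominator[of m x R y] by (simp add: damping_def)

lemma damping_le_1: "damping x R m y \<le> 1"
  using damping_denominator[of m x R y] unfolding damping_def by (intro inverse_le_1_iff[THEN iffD2]) simp

lemma Ck_on_damping: "Ck_on k UNIV (damping x R m)"
  unfolding damping_def
proof (rule Ck_on_inverse[OF open_UNIV])
  show "Ck_on k UNIV (\<lambda>y. 1 + real m * (bump x R y * (y $ None * y $ None)))"
    by (intro Ck_on_add Ck_on_mult Ck_on_const Ck_on_bump Ck_on_linear open_UNIV bounded_linear_vec_nth)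
  show "1 + real m * (bump x R y * (y $ None * y $ None)) \<noteq> 0" for y
    using damping_denominator[of m x R y] by linarith
qed

lemma damping_measurable: "damping x R m \<in> borel_measurable borel"
  by (rule borel_measurable_continuous_onI[OF Ck_on_imp_continuous_on[OF Ck_on_damping]])

lemma damping_outside: "0 < R \<Longrightarrow> y \<notin> cball x R \<Longrightarrow> damping x R m y = 1"
  by (simp add: damping_def bump_eq_0_iff)

lemma damping_boundary: "y $ None = 0 \<Longrightarrow> damping x R m y = 1"
  by (simp add: damping_def)

text \<open>The gap between r and R makes the bump positive on the entire closed ball of radius r,
  so the integrand fails to decay only on the null hyperplane where the transverse coordinate is
  0.\<close>

lemma damping_integral_tendsto_0:
  fixes x :: "real ^ ('n::finite) option"
  assumes "r < R" "0 < R"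
  shows "(\<lambda>m. \<integral>y. damping x R m y * indicator (cball x r) y \<partial>lborel) \<longlonglongrightarrow> 0"
proof -
  have "(\<lambda>m. \<integral>y. damping x R m y * indicator (cball x r) y \<partial>lborel) \<longlonglongrightarrow> (\<integral>(y::real ^ 'n option). 0 \<partial>lborel)"
  proof (rule integral_dominated_convergence[where w = "indicator (cball x r)" and f = "\<lambda>y. 0"
        and s = "\<lambda>m y. damping x R m y * indicator (cball x r) y"])
    show "(\<lambda>y. damping x R m y * indicator (cball x r) y) \<in> borel_measurable lborel" for m
      using damping_measurable[of x R m] by (auto intro!: borel_measurable_times borel_measurable_indicator)
    show "integrable lborel (indicator (cball x r) :: _ \<Rightarrow> real)"
      using emeasure_bounded_finite[OF bounded_cball, of x r] by (simp add: integrable_indicator_iff)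
    show "AE y in lborel. norm (damping x R m y * indicator (cball x r) y) \<le> indicator (cball x r) y" for m
      using damping_pos[of x R m] damping_le_1[of x R m] by (auto simp: indicator_def less_imp_le)
    have "negligible {y :: real ^ 'n option. y $ None = 0}"
      by (rule negligible_standard_hyperplane_cart)
    moreover have "{y :: real ^ 'n option. y $ None = 0} \<in> sets borel"
      by (intro borel_closed closed_Collect_eq continuous_intros)
    ultimately have "{y :: real ^ 'n option. y $ None = 0} \<in> null_sets lborel"
      by (simp add: negligible_iff_null_sets null_sets_completion_iff)
    then have "AE y in lborel. y \<notin> {y :: real ^ 'n option. y $ None = 0}"
      by (rule AE_not_in)
    then show "AE y in lborel. (\<lambda>m. damping x R m y * indicator (cball x r) y) \<longlonglongrightarrow> 0"
    proof eventually_elim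
      case (elim y)
      show ?case
      proof (cases "y \<in> cball x r")
        case True
        then have "0 < bump x R y"
          using assms bump_pos_iff[of R x y] by simp
        moreover have "0 < y $ None * y $ None"
          using elim by (simp add: zero_less_mult_iff) linarith
        ultimately have "0 < bump x R y * (y $ None * y $ None)" by simp
        then have "filterlim (\<lambda>m. 1 + real m * (bump x R y * (y $ None * y $ None))) at_top sequentially"
          by (intro filterlim_tendsto_add_at_top[OF tendsto_const] filterlim_at_top_mult_tendsto_pos[OF tendsto_const]
              filterlim_real_sequentially)
        then have "(\<lambda>m. damping x R m y) \<longlonglongrightarrow> 0"
          unfolding damping_def by (rule tendsto_inverse_0_at_top)
        then show ?thesis using True by simp
      qed simp
    qed
  qed simp
  then show ?thesis by simp
qed

lemma compact_mfd_metric_riemannian: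
  assumes A: "smooth_atlas A" and g: "riemannian_metric A g"
    and cpt: "compact (UNIV :: 'a::{t2_space, second_countable_topology} set)" and bdry: "mfd_boundary A \<noteq> {}"
  shows "compact_mfd_metric (A :: ('a, 'n::finite) chart set) g"
proof
  fix c assume c: "c \<in> A"
  show "continuous_on (chart_img c) (g c \<circ> chart_inv c)"
    using g c unfolding riemannian_metric_def by (blast intro: smooth_in_continuous_on)
  fix q assume "q \<in> chart_dom c"
  then show "posdef (g c q)"
    using g c unfolding riemannian_metric_def posdef_def by blast
  fix d assume "d \<in> A" "q \<in> chart_dom d"
  then show "g c q = transpose (transition_jacobian c d q) ** g d q ** transition_jacobian c d q"
    using g c \<open>q \<in> chart_dom c\<close> unfolding riemannian_metric_def by blast
qed (use A cpt bdry in auto)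

theorem proposition2p1:
  fixes A :: "('a::{t2_space, second_countable_topology}, 'n::finite) chart set"
    and g :: "('a, 'n) metric"
    and p :: 'a and \<epsilon> :: real
  assumes "CARD('n) + 1 \<ge> 3"
    and "smooth_atlas A"
    and "compact (UNIV :: 'a set)"
    and "connected (UNIV :: 'a set)"
    and "mfd_boundary A \<noteq> {}"
    and "riemannian_metric A g"
    and "p \<in> mfd_boundary A"
    and "\<epsilon> > 0"
  shows "\<exists>h :: nat \<Rightarrow> 'a \<Rightarrow> real.
    (\<forall>m. h m \<in> smooth_functions A \<and> (\<forall>q. h m q > 0) \<and>
         (\<forall>q \<in> mfd_boundary A. h m q = 1) \<and>
         (\<forall>q. q \<notin> riem_ball A g p \<epsilon> \<longrightarrow> h m q = 1)) \<and>
    (\<forall>k\<ge>1. (\<lambda>m. steklov_eigenvalue A (conformal (h m) g) k) \<longlonglongrightarrow> 0)"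
proof -
  interpret compact_mfd_metric A g
    using assms(2,6,3,5) by (rule compact_mfd_metric_riemannian)
  let ?c = "chart_at A p" and ?x = "chart_map (chart_at A p) p"
  note c = chart_at(1)[of p] and pc = chart_at(2)[of p]
  have x: "?x \<in> chart_img ?c" "?x $ None = 0"
    using assms(7) mfd_boundary_iff[OF c pc] chart_map_in[OF pc] by auto
  obtain R where R: "0 < R" "cball ?x R \<inter> half_space \<subseteq> chart_img ?c"
    "\<And>x. x \<in> cball ?x R \<inter> half_space \<Longrightarrow> chart_inv ?c x \<in> riem_ball A g p \<epsilon>"
    using chart_ball_in_riem_ball[OF c pc assms(8)] by metis
  define h where "h m = lift_chart ?c 1 (damping ?x R m)" for m
  have smooth: "h m \<in> smooth_functions A" for m
    unfolding h_def by (rule lift_chart_smooth[OF c R(2) Ck_on_damping damping_outside[OF R(1)]])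
  have pos: "0 < h m q" and le1: "h m q \<le> 1" for m q
    by (simp_all add: h_def lift_chart_def damping_pos damping_le_1)
  have bdry: "h m q = 1" if "q \<in> mfd_boundary A" for m q
    using that mfd_boundary_iff[OF c, of q] by (simp add: h_def lift_chart_def damping_boundary)
  have outside: "h m q = 1" if "q \<notin> riem_ball A g p \<epsilon>" for m q
    unfolding h_def using that R(3) by (intro lift_chart_outside[OF c damping_outside[OF R(1)]]) auto
  have lim: "(\<lambda>m. steklov_eigenvalue A (conformal (h m) g) k) \<longlonglongrightarrow> 0" if k: "1 \<le> k" for k
  proof -
    \<comment> \<open>The test functions are confined to half the radius, where the bump of radius R
      inside the damping factor is positive.\<close>
    let ?T = "\<lambda>m. \<integral>y. damping ?x R m y * indicator (cball ?x (R / 2)) y \<partial>lborel"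
    have sub: "cball ?x (R / 2) \<inter> half_space \<subseteq> chart_img ?c"
      using R(1,2) by (auto simp: subset_iff)
    have n: "2 \<le> CARD('n)" and R2: "0 < R / 2"
      using assms(1) R(1) by auto
    \<comment> \<open>The constant obtained here depends on k, but the factors \<open>h m\<close>
      were chosen before k; the limit follows for each k from the same sequence of
      integrals.\<close>
    show ?thesis
    proof (rule steklov_eigenvalue_conformal_le[OF n c x R2 sub k])
      fix C
      assume C: "\<And>h \<eta>. \<lbrakk>h \<in> smooth_functions A; \<And>q. 0 < h q; \<And>q. h q \<le> 1; \<And>q. q \<in> mfd_boundary A \<Longrightarrow> h q = 1;
          \<eta> \<in> borel_measurable borel; \<And>x. 0 \<le> \<eta> x; \<And>x. \<eta> x \<le> 1; \<And>x. x \<in> chart_img ?c \<Longrightarrow> h (chart_inv ?c x) = \<eta> x\<rbrakk>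
        \<Longrightarrow> steklov_eigenvalue A (conformal h g) k \<le> ereal (C * (\<integral>y. \<eta> y * indicator (cball ?x (R / 2)) y \<partial>lborel))"
      have upper: "steklov_eigenvalue A (conformal (h m) g) k \<le> ereal (C * ?T m)" for m
      proof (rule C[OF smooth pos le1 bdry damping_measurable _ damping_le_1])
        show "0 \<le> damping ?x R m y" for y using damping_pos by (rule less_imp_le)
        show "h m (chart_inv ?c y) = damping ?x R m y" if "y \<in> chart_img ?c" for y
          using that c by (simp add: h_def lift_chart_def chart_inv_in)
      qed
      have lower: "0 \<le> steklov_eigenvalue A (conformal (h m) g) k" for m
        by (rule compact_mfd_metric.steklov_eigenvalue_nonneg[OF compact_mfd_metric_conformal[OF smooth pos] k])
      have "(\<lambda>m. ereal (C * ?T m)) \<longlonglongrightarrow> ereal (C * 0)"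
        using damping_integral_tendsto_0[of "R / 2" R ?x] R(1) by (intro tendsto_intros) auto
      then have "(\<lambda>m. ereal (C * ?T m)) \<longlonglongrightarrow> 0"
        by (simp add: zero_ereal_def)
      then show "(\<lambda>m. steklov_eigenvalue A (conformal (h m) g) k) \<longlonglongrightarrow> 0"
        by (rule tendsto_sandwich[OF _ _ tendsto_const, rotated 2]) (use upper lower in auto)
    qed
  qed
  show ?thesis
    using smooth pos bdry outside lim by (intro exI[of _ h]) auto
qed

end
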